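(* Let $\Phi=\mathbf{E}_\varphi+\psi:\mathbb{R}^d\to\mathbb{R}\cup\{+\infty\}$, where: $\psi:\mathbb{R}^d\to\mathbb{R}\cup\{+\infty\}$ is proper, lower semicontinuous and prox-bounded; $\varphi:\Xi\times\mathbb{R}^d\to\mathbb{R}$ is an upper-$C^2$ normal integrand; and $\xi\mapsto\inf_{x\in\mathbb{R}^d}(\varphi(\xi,x)+\psi(x))$ is integrable. Given $x^0\in\operatorname{dom}\Phi$, let $(x^k)_{k\in\mathbb{N}}$ be the sequence generated by the PSS algorithm, under the sampling and filtration assumptions (all described in the context). Then there exists a measurable set $\hat\Omega\subseteq\Omega$ with $\mathbb{P}(\Omega\setminus\hat\Omega)=0$ such that for all $\omega\in\hat\Omega$, if the sequence $(x^k)_{k\in\mathbb{N}}=(x^k(\omega))_{k\in\mathbb{N}}$ is bounded, then both $(\Phi_k(x^k))_{k\in\mathbb{N}}$ and $(\Phi(x^k))_{k\in\mathbb{N}}$ converge to the same limit, $$\sum_{k\in\mathbb{N}}\|x^{k+1}-x^k\|^2<+\infty,$$ and the following assertions hold: (i) $\inf_{k\in\mathbb{N}}\gamma_k>0$; (ii) if $x^{k_j}\to\bar x$ as $j\to\infty$ for some subsequence, then $\bar x$ is a stationary point of the problem $\min_{x\in\mathbb{R}^d}\Phi(x)$, and $\Phi(\bar x)=\lim_{k\to\infty}\Phi_k(x^k)=\lim_{k\to\infty}\Phi(x^k)$; (iii) the set of accumulation points of $(x^k)_{k\in\mathbb{N}}$ is nonempty, closed and connected; (iv) if $(x^k)_{k\in\mathbb{N}}$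 has an isolated accumulation point $\bar x$, then the entire sequence $(x^k)_{k\in\mathbb{N}}$ converges to the stationary point $\bar x$ as $k\to\infty$.
   Context: $\mathbb{N}=\{0,1,2,\dots\}$. $(\Xi,\mathcal{A},\mu)$ is a probability space, $L^p_\mu$ is the space of $p$-integrable functions on it, and $\varphi_\xi(x):=\varphi(\xi,x)$. Normal integrand: $\varphi:\Xi\times\mathbb{R}^d\to\mathbb{R}\cup\{+\infty\}$ is a normal integrand if $\xi\mapsto\operatorname{epi}\varphi_\xi$ is a measurable multifunction with closed values (a multifunction $M$ is measurable if $\{t: M(t)\cap U\ne\emptyset\}\in\mathcal{A}$ for all open $U$). It is locally Lipschitz around $\bar x$ with square integrable modulus if $\varphi(\cdot,\bar x)\in L^2_\mu$ and there are $\kappa\in L^2_\mu$ and a neighborhood $V$ of $\bar x$ with $|\varphi_\xi(y)-\varphi_\xi(z)|\le\kappa(\xi)\|y-z\|$ for all $y,z\in V$, $\xi\in\Xi$. It is upper-$C^2$ around $\bar x$ if it is locally Lipschitz around $\bar x$ with square integrable modulus and there exist a neighborhood $V$ of $\bar x$ and a nonnegative $\ell\in L^1_\mu$ such that for all $\xi\in\Xi$, $x\in V$, $v\in\partial\varphi_\xi(x)$: $\varphi_\xi(y)\le\varphi_\xi(x)+\langle v,y-x\rangle+\ell(\xi)\|y-x\|^2$ for all $y\in V$. It is an upper-$C^2$ normal integrand if it is upper-$C^2$ around every $\bar x\in\mathbb{R}^d$. Here $\partial$ denotes the Clarke subdifferential (taken in $x$). Prox: $f$ is prox-bounded if $f+\frac{1}{2\gamma}\|\cdot\|^2$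 is bounded below for some $\gamma>0$; the supremum of such $\gamma$ is the threshold $\gamma^f\in(0,+\infty]$. $\operatorname{prox}_{\gamma f}(x):=\operatorname{argmin}_{u\in\mathbb{R}^d}\{f(u)+\frac{1}{2\gamma}\|u-x\|^2\}$ (set-valued). Stationary point: $\bar x$ is a stationary point of $\min\Phi$ if there exist $\bar v\in\partial\mathbf{E}_\varphi(\bar x)$ and $\bar\gamma>0$ with $\bar x\in\operatorname{prox}_{\bar\gamma\psi}(\bar x-\bar\gamma\bar v)$. Sampling: $(\Omega,\mathcal{F},\mathbb{P})$ is a probability space, $\xi_i:\Omega\to\Xi$ ($i\ge1$) are i.i.d. random variables with law $\mu$, and $(n_k)_{k\in\mathbb{N}}$ is a nondecreasing sequence of positive integers with $n_k\to+\infty$. Set $\mathbf{E}_\varphi(x):=\int_\Xi\varphi(\xi,x)\,d\mu(\xi)$, $\mathbf{E}^k_\varphi(x):=\frac1{n_k}\sum_{j=1}^{n_k}\varphi(\xi_j,x)$, $\Phi:=\mathbf{E}_\varphi+\psi$, $\Phi_k:=\mathbf{E}^k_\varphi+\psi$. PSS algorithm: parameters $x^0\in\operatorname{dom}\psi$, $\rho\in(0,1)$, $\sigma>0$, $\gamma_{\min}>0$. At iteration $k=0,1,2,\dots$: choose $v_i^k\in\partial\varphi_{\xi_i}(x^k)$, $i=1,\dots,n_k$, and set $v^k:=\frac1{n_k}\sum_{i=1}^{n_k}v_i^k$; take $\overline\gamma_k\in[\gamma_{\min},\gamma^\psi)$ and set $\gamma_k:=\overline\gamma_k$; compute $\hat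 x^k\in\operatorname{prox}_{\gamma_k\psi}(x^k-\gamma_kv^k)$; while $\Phi_k(\hat x^k)>\Phi_k(x^k)-\sigma\|\hat x^k-x^k\|^2$, replace $\gamma_k$ by $\rho\gamma_k$ and recompute $\hat x^k\in\operatorname{prox}_{\gamma_k\psi}(x^k-\gamma_kv^k)$; finally set $x^{k+1}:=\hat x^k$. In the results, $\gamma_k$ denotes the final accepted stepsize of iteration $k$. Filtration: there is a filtration $(\mathcal{F}_k)_{k\in\mathbb{N}}$ of sub-$\sigma$-algebras of $\mathcal{F}$, representing all the information used by the algorithm up to iteration $k$ (in particular $x^{k+1}$, computed in iteration $k$, is $\mathcal{F}_k$-measurable), such that $\xi_j$ is $\mathcal{F}_k$-measurable for $j\le n_k$ and $\xi_j$ is independent of $\mathcal{F}_k$ for $j>n_k$. *)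

theory Defs
  imports "HOL-Probability.Probability"
begin

section \<open>Extended-real-valued functions and the proximal mapping\<close>

definition edom :: "('a \<Rightarrow> ereal) \<Rightarrow> 'a set" where
  "edom f = {x. f x < \<infinity>}"

definition proper_fun :: "('a \<Rightarrow> ereal) \<Rightarrow> bool" where
  "proper_fun f \<longleftrightarrow> (\<forall>x. f x \<noteq> -\<infinity>) \<and> edom f \<noteq> {}"

definition lower_semicont :: "('a::topological_space \<Rightarrow> ereal) \<Rightarrow> bool" where
  "lower_semicont f \<longleftrightarrow> (\<forall>x. f x \<le> Liminf (at x) f)"

definition bdd_below_with_prox :: "real \<Rightarrow> ('a::real_normed_vector \<Rightarrow> ereal) \<Rightarrow> bool" where
  "bdd_below_with_prox \<gamma> f \<longleftrightarrow>
     (\<exists>c::real. \<forall>u. ereal c \<le> f u + ereal (1 / (2 * \<gamma>) * (norm u)\<^sup>2))"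

definition prox_bounded :: "('a::real_normed_vector \<Rightarrow> ereal) \<Rightarrow> bool" where
  "prox_bounded f \<longleftrightarrow> (\<exists>\<gamma>>0. bdd_below_with_prox \<gamma> f)"

definition prox_threshold :: "('a::real_normed_vector \<Rightarrow> ereal) \<Rightarrow> ereal" where
  "prox_threshold f = Sup {ereal \<gamma> | \<gamma>. 0 < \<gamma> \<and> bdd_below_with_prox \<gamma> f}"

definition prox :: "real \<Rightarrow> ('a::real_normed_vector \<Rightarrow> ereal) \<Rightarrow> 'a \<Rightarrow> 'a set" where
  "prox \<gamma> f x =
     {u. is_arg_min (\<lambda>w. f w + ereal (1 / (2 * \<gamma>) * (norm (w - x))\<^sup>2)) (\<lambda>_. True) u}"

section \<open>Clarke subdifferential\<close>

text \<open>Clarke's generalized directional derivative, with the upper limit taken over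
  \<open>y \<rightarrow> x\<close> and \<open>t \<down> 0\<close> jointly. The resulting subdifferential is Clarke's for functions that are
  locally Lipschitz around \<open>x\<close>; it is used only for those.\<close>

definition clarke_dir_deriv ::
    "('a::euclidean_space \<Rightarrow> real) \<Rightarrow> 'a \<Rightarrow> 'a \<Rightarrow> ereal" where
  "clarke_dir_deriv f x d =
     Limsup (nhds x \<times>\<^sub>F at_right 0) (\<lambda>(y, t). ereal ((f (y + t *\<^sub>R d) - f y) / t))"

definition clarke_subdiff :: "('a::euclidean_space \<Rightarrow> real) \<Rightarrow> 'a \<Rightarrow> 'a set" where
  "clarke_subdiff f x = {v. \<forall>d. ereal (v \<bullet> d) \<le> clarke_dir_deriv f x d}"

definition stationary_point ::
    "('a::euclidean_space \<Rightarrow> real) \<Rightarrow> ('a \<Rightarrow> ereal) \<Rightarrow> 'a \<Rightarrow> bool" where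
  "stationary_point f \<psi> x \<longleftrightarrow>
     (\<exists>v \<in> clarke_subdiff f x. \<exists>\<gamma>>0. x \<in> prox \<gamma> \<psi> (x - \<gamma> *\<^sub>R v))"

section \<open>Normal integrands\<close>

definition square_integrable :: "'x measure \<Rightarrow> ('x \<Rightarrow> real) \<Rightarrow> bool" where
  "square_integrable M f \<longleftrightarrow> f \<in> borel_measurable M \<and> integrable M (\<lambda>\<xi>. (f \<xi>)\<^sup>2)"

text \<open>Integrability of an extended-real-valued function: it may take infinite values, but then
  only on a null set.\<close>

definition ereal_integrable :: "'x measure \<Rightarrow> ('x \<Rightarrow> ereal) \<Rightarrow> bool" where
  "ereal_integrable M f \<longleftrightarrow>
     f \<in> borel_measurable M \<and> (\<integral>\<^sup>+ \<xi>. e2ennreal \<bar>f \<xi>\<bar> \<partial>M) < \<infinity>"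

definition epi :: "('a \<Rightarrow> ereal) \<Rightarrow> ('a \<times> real) set" where
  "epi f = {(x, \<alpha>). f x \<le> ereal \<alpha>}"

definition measurable_multifunction ::
    "'x measure \<Rightarrow> ('x \<Rightarrow> 'b::topological_space set) \<Rightarrow> bool" where
  "measurable_multifunction M F \<longleftrightarrow>
     (\<forall>U. open U \<longrightarrow> {\<xi> \<in> space M. F \<xi> \<inter> U \<noteq> {}} \<in> sets M)"

definition normal_integrand ::
    "'x measure \<Rightarrow> ('x \<Rightarrow> 'a::euclidean_space \<Rightarrow> ereal) \<Rightarrow> bool" where
  "normal_integrand M \<phi> \<longleftrightarrow>
     (\<forall>\<xi>\<in>space M. \<forall>x. \<phi> \<xi> x \<noteq> -\<infinity>) \<and>
     measurable_multifunction M (\<lambda>\<xi>. epi (\<phi> \<xi>)) \<and>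
     (\<forall>\<xi>\<in>space M. closed (epi (\<phi> \<xi>)))"

definition loc_Lipschitz_sq_int ::
    "'x measure \<Rightarrow> ('x \<Rightarrow> 'a::euclidean_space \<Rightarrow> real) \<Rightarrow> 'a \<Rightarrow> bool" where
  "loc_Lipschitz_sq_int M \<phi> xbar \<longleftrightarrow>
     square_integrable M (\<lambda>\<xi>. \<phi> \<xi> xbar) \<and>
     (\<exists>\<kappa> V. square_integrable M \<kappa> \<and> open V \<and> xbar \<in> V \<and>
        (\<forall>y\<in>V. \<forall>z\<in>V. \<forall>\<xi>\<in>space M. \<bar>\<phi> \<xi> y - \<phi> \<xi> z\<bar> \<le> \<kappa> \<xi> * norm (y - z)))"

definition upper_C2_around ::
    "'x measure \<Rightarrow> ('x \<Rightarrow> 'a::euclidean_space \<Rightarrow> real) \<Rightarrow> 'a \<Rightarrow> bool" where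
  "upper_C2_around M \<phi> xbar \<longleftrightarrow>
     loc_Lipschitz_sq_int M \<phi> xbar \<and>
     (\<exists>V l. open V \<and> xbar \<in> V \<and> integrable M l \<and> (\<forall>\<xi>\<in>space M. 0 \<le> l \<xi>) \<and>
        (\<forall>\<xi>\<in>space M. \<forall>x\<in>V. \<forall>v\<in>clarke_subdiff (\<phi> \<xi>) x. \<forall>y\<in>V.
           \<phi> \<xi> y \<le> \<phi> \<xi> x + v \<bullet> (y - x) + l \<xi> * (norm (y - x))\<^sup>2))"

definition upper_C2_normal_integrand ::
    "'x measure \<Rightarrow> ('x \<Rightarrow> 'a::euclidean_space \<Rightarrow> real) \<Rightarrow> bool" where
  "upper_C2_normal_integrand M \<phi> \<longleftrightarrow>
     normal_integrand M (\<lambda>\<xi> x. ereal (\<phi> \<xi> x)) \<and> (\<forall>xbar. upper_C2_around M \<phi> xbar)"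

section \<open>Expectation and sample average\<close>

definition expect_fun :: "'x measure \<Rightarrow> ('x \<Rightarrow> 'a \<Rightarrow> real) \<Rightarrow> 'a \<Rightarrow> real" where
  "expect_fun M \<phi> x = (\<integral>\<xi>. \<phi> \<xi> x \<partial>M)"

definition sample_avg :: "nat \<Rightarrow> (nat \<Rightarrow> 'a \<Rightarrow> real) \<Rightarrow> 'a \<Rightarrow> real" where
  "sample_avg m f x = (1 / real m) * (\<Sum>j=1..m. f j x)"

definition composite :: "('a \<Rightarrow> real) \<Rightarrow> ('a \<Rightarrow> ereal) \<Rightarrow> 'a \<Rightarrow> ereal" where
  "composite f \<psi> x = ereal (f x) + \<psi> x"

section \<open>The algorithm\<close>

text \<open>One iteration from \<open>x\<close> to \<open>x'\<close> with accepted stepsize \<open>\<gamma>\<close>. Here \<open>m\<close> is the current sample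
  size, \<open>f i\<close> the integrand at the \<open>i\<close>-th sample, \<open>v i\<close> the chosen subgradients and \<open>\<gamma>bar\<close> the
  initial stepsize. The backtracking loop computes the trial points \<open>u 0, \<dots>, u q\<close> for the
  stepsizes \<open>\<gamma>bar, \<rho> \<gamma>bar, \<dots>, \<rho>^q \<gamma>bar\<close>; all but the last one satisfy the loop condition.\<close>

definition pss_iteration ::
    "real \<Rightarrow> real \<Rightarrow> real \<Rightarrow> ('a::euclidean_space \<Rightarrow> ereal) \<Rightarrow> nat \<Rightarrow> (nat \<Rightarrow> 'a \<Rightarrow> real) \<Rightarrow>
     'a \<Rightarrow> real \<Rightarrow> 'a \<Rightarrow> bool" where
  "pss_iteration \<rho> \<sigma> \<gamma>min \<psi> m f x \<gamma> x' \<longleftrightarrow>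
     (\<exists>v \<gamma>bar q u.
        (\<forall>i\<in>{1..m}. v i \<in> clarke_subdiff (f i) x) \<and>
        \<gamma>min \<le> \<gamma>bar \<and> ereal \<gamma>bar < prox_threshold \<psi> \<and>
        (let vbar = (1 / real m) *\<^sub>R (\<Sum>i=1..m. v i);
             step = (\<lambda>l. \<rho> ^ l * \<gamma>bar);
             \<Phi> = composite (sample_avg m f) \<psi>;
             rejected = (\<lambda>l. \<Phi> (u l) > \<Phi> x - ereal (\<sigma> * (norm (u l - x))\<^sup>2))
         in (\<forall>l\<le>q. u l \<in> prox (step l) \<psi> (x - step l *\<^sub>R vbar)) \<and>
            (\<forall>l<q. rejected l) \<and> \<not> rejected q \<and>
            \<gamma> = step q \<and> x' = u q))"

section \<open>Accumulation points of a sequence\<close>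

definition accumulation_points :: "(nat \<Rightarrow> 'a::topological_space) \<Rightarrow> 'a set" where
  "accumulation_points X = {xbar. \<exists>r. strict_mono r \<and> (\<lambda>j. X (r j)) \<longlonglongrightarrow> xbar}"

end

theory Submission
  imports Defs
begin

text \<open>
  Write \<open>A k\<close> for the sample average used in iteration \<open>k\<close>, and \<open>E\<close> for the expectation of the
  integrand. The line search makes \<open>A k + \<psi>\<close> decrease by \<open>\<sigma>\<close> times the squared step from \<open>x k\<close> to
  \<open>x (k + 1)\<close>, but the next iteration works with \<open>A (k + 1)\<close>, so the descent is only up to the
  resampling error \<open>e k\<close>, the value of \<open>A (k + 1) - A k\<close> at \<open>x (k + 1)\<close>. If the series of the errors
  converges, the objective values converge and the squared steps are summable; the rest is
  deterministic. The proof therefore has a probabilistic half, which shows that for almost every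
  outcome the series converges on every bounded trajectory, and a deterministic half for a fixed
  outcome.

  The sample sizes may grow arbitrarily slowly, so the errors need not be absolutely summable and
  their signs matter. Let \<open>w k = 1 - n k / n (k + 1)\<close> be the share of new samples and \<open>M k\<close> the average
  of the integrand over the new samples only. At the point \<open>x (k + 1)\<close>, the error is
  \<open>w k * (M k - E) - w k * (A k - E)\<close>.

  \<^item> In the second term the old samples and the iterate depend on each other, so a bound on \<open>A k - E\<close>
  that is uniform over a cube is needed. Covering the cube by a grid, with the square-integrable
  Lipschitz modulus between grid points, bounds the second moment of the supremum by a constant times
  \<open>n k powr (- r)\<close> with \<open>r = 2 / (d + 2)\<close> (\<open>uniform_deviation_rate\<close>). Any positive power is enough:
  the series of \<open>w k * n k powr (- b)\<close> converges for every \<open>b\<close> in \<open>(0, 1]\<close> by telescoping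
  (\<open>summable_batch_weights\<close>), no matter how \<open>n k\<close> tends to infinity.
  \<^item> In the first term every new sample is independent of the past, so the term is a martingale
  difference. By the same uniform rate, applied to the new batch alone, its second moments are
  summable, and a martingale series with summable second moments converges almost surely by
  Kolmogorov's maximal inequality (\<open>summable_AE\<close>). Because the batch is controlled by the uniform rate,
  it suffices that each new sample separately is independent of the past.

  The strong law of large numbers, derived from the same martingale theorem, gives locally uniform
  convergence of \<open>A k\<close> to \<open>E\<close> and bounds on the averages of the two moduli in the definition of
  upper-\<open>C\<^sup>2\<close> integrands. With these bounds the upper quadratic inequality is a descent lemma with a
  fixed constant \<open>B\<close>: trial points with small stepsizes are accepted, which bounds the stepsizes from
  below (\<open>stepsize_bounded_below\<close>). The same inequality passes to the limit along a convergent
  subsequence (\<open>stationary_limit\<close>). It gives \<open>E y \<le> E z + v \<bullet> (y - z) + B * (norm (y - z))\<^sup>2\<close> near the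
  limit point \<open>z\<close>, and this alone forces \<open>v\<close> into the Clarke subdifferential of \<open>E\<close>
  (\<open>clarke_subdiffI_quadratic_upper_bound\<close>).
\<close>

section \<open>Series of square-integrable martingale differences\<close>

lemma integrable_mult_of_squares:
  fixes f g :: "'a \<Rightarrow> real" and M :: "'a measure"
  assumes [measurable]: "f \<in> borel_measurable M" "g \<in> borel_measurable M"
    and "integrable M (\<lambda>x. (f x)\<^sup>2)" "integrable M (\<lambda>x. (g x)\<^sup>2)"
  shows "integrable M (\<lambda>x. f x * g x)"
proof (rule Bochner_Integration.integrable_bound[where f = "\<lambda>x. (f x)\<^sup>2 + (g x)\<^sup>2"])
  have "\<bar>a * b\<bar> \<le> a\<^sup>2 + b\<^sup>2" for a b :: real
  proof -
    have "0 \<le> (\<bar>a\<bar> - \<bar>b\<bar>)\<^sup>2" by simp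
    then have "2 * (\<bar>a\<bar> * \<bar>b\<bar>) \<le> a\<^sup>2 + b\<^sup>2" by (simp add: power2_diff)
    moreover have "0 \<le> \<bar>a\<bar> * \<bar>b\<bar>" by simp
    ultimately show ?thesis unfolding abs_mult by linarith
  qed
  then show "AE x in M. norm (f x * g x) \<le> norm ((f x)\<^sup>2 + (g x)\<^sup>2)" by simp
qed (use assms in auto)

text \<open>The indices are shifted: \<open>d k\<close> is known at time \<open>k + 1\<close> and centered given the information at time
  \<open>k\<close>. Centering is required on events, which is the form in which independence supplies it.\<close>

locale square_integrable_martingale_difference = prob_space M
  for M :: "'a measure" +
  fixes G :: "nat \<Rightarrow> 'a measure" and d :: "nat \<Rightarrow> 'a \<Rightarrow> real"
  assumes subalg: "\<And>k. subalgebra M (G k)"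
    and sets_Suc: "\<And>k. sets (G k) \<subseteq> sets (G (Suc k))"
    and adapted: "\<And>k. d k \<in> borel_measurable (G (Suc k))"
    and sq_int: "\<And>k. integrable M (\<lambda>x. (d k x)\<^sup>2)"
    and centered: "\<And>k A. A \<in> sets (G k) \<Longrightarrow> (\<integral>x. indicator A x * d k x \<partial>M) = 0"
begin

lemma sets_mono: "i \<le> j \<Longrightarrow> sets (G i) \<subseteq> sets (G j)"
  by (rule lift_Suc_mono_le[of "\<lambda>k. sets (G k)"]) (use sets_Suc in auto)

lemma measurable_mono: "i \<le> j \<Longrightarrow> f \<in> borel_measurable (G i) \<Longrightarrow> f \<in> borel_measurable (G j)"
  using sets_mono[of i j] subalg[of i] subalg[of j]
  unfolding measurable_def subalgebra_def by auto

lemma measurable_M: "f \<in> borel_measurable (G i) \<Longrightarrow> f \<in> borel_measurable M"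
  using measurable_from_subalg[OF subalg] by blast

lemma d_measurable [measurable]: "d k \<in> borel_measurable M"
  using measurable_M adapted by blast

lemma integrable_d: "integrable M (d k)"
proof -
  have "integrable M (\<lambda>x. d k x * 1)" by (rule integrable_mult_of_squares) (use sq_int in auto)
  then show ?thesis by simp
qed

text \<open>Centering is assumed on events only. It says that the conditional expectation vanishes, which
  extends the orthogonality to every square-integrable function of the past.\<close>

lemma orthogonal_to_past:
  assumes Z: "Z \<in> borel_measurable (G k)" and Z2: "integrable M (\<lambda>x. (Z x)\<^sup>2)"
  shows "(\<integral>x. Z x * d k x \<partial>M) = 0"
proof -
  interpret finite_measure_subalgebra M "G k"
    by standard (rule subalg)
  have ae: "AE x in M. real_cond_exp M (G k) (d k) x = 0"
  proof (rule real_cond_exp_charact)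
    show "integrable M (d k)" by (rule integrable_d)
    fix A assume "A \<in> sets (G k)"
    then show "set_lebesgue_integral M A (d k) = (\<integral>x\<in>A. 0 \<partial>M)"
      using centered[of A k] by (simp add: set_lebesgue_integral_def)
  qed auto
  have [measurable]: "Z \<in> borel_measurable M" by (rule measurable_M[OF Z])
  have "(\<integral>x. Z x * d k x \<partial>M) = (\<integral>x. Z x * real_cond_exp M (G k) (d k) x \<partial>M)"
    by (intro real_cond_exp_intg(2)[symmetric] integrable_mult_of_squares Z Z2 sq_int) measurable
  also have "\<dots> = (\<integral>x. 0 \<partial>M)"
    by (rule integral_cong_AE) (use ae in \<open>measurable, auto\<close>)
  finally show ?thesis by simp
qed

definition block :: "nat \<Rightarrow> nat \<Rightarrow> 'a \<Rightarrow> real" where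
  "block m n x = (\<Sum>k=m..<n. d k x)"

lemma block_adapted: "block m n \<in> borel_measurable (G n)"
proof -
  have "(\<lambda>x. \<Sum>k=m..<n. d k x) \<in> borel_measurable (G n)"
    by (intro borel_measurable_sum measurable_mono[OF _ adapted]) auto
  then show ?thesis by (simp add: block_def[abs_def])
qed

lemma block_measurable [measurable]: "block m n \<in> borel_measurable M"
  using block_adapted measurable_M by blast

lemma block_Suc: "m \<le> n \<Longrightarrow> block m (Suc n) x = block m n x + d n x"
  by (simp add: block_def)

lemma integrable_block_sq: "integrable M (\<lambda>x. (block m n x)\<^sup>2)"
proof (induction n)
  case (Suc n)
  show ?case
  proof (cases "m \<le> n")
    case True
    have "integrable M (\<lambda>x. (block m n x)\<^sup>2 + (d n x)\<^sup>2 + 2 * (block m n x * d n x))"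
      by (intro Bochner_Integration.integrable_add integrable_mult_right[OF integrable_mult_of_squares]
            Suc sq_int d_measurable block_measurable)
    then show ?thesis using True by (simp add: block_Suc power2_sum algebra_simps)
  qed (simp add: block_def)
qed (simp add: block_def)

text \<open>The cross term of the square is orthogonal to the past, so that only the two squares remain.\<close>

lemma indicator_block_Suc:
  assumes A: "A \<in> sets (G n)" and "m \<le> n"
  shows "(\<integral>x. indicator A x * (block m (Suc n) x)\<^sup>2 \<partial>M) =
    (\<integral>x. indicator A x * (block m n x)\<^sup>2 \<partial>M) + (\<integral>x. indicator A x * (d n x)\<^sup>2 \<partial>M)"
proof -
  have AM: "A \<in> sets M" using A subalg unfolding subalgebra_def by auto
  have [measurable]: "indicator A \<in> borel_measurable (G n)" using A by simp
  have Z: "(\<lambda>x. indicator A x * block m n x) \<in> borel_measurable (G n)"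
    using block_adapted by measurable
  have Z2: "integrable M (\<lambda>x. (indicator A x * block m n x)\<^sup>2)"
  proof -
    have "(\<lambda>x. (indicator A x * block m n x)\<^sup>2) = (\<lambda>x. indicator A x *\<^sub>R (block m n x)\<^sup>2)"
      by (auto simp: fun_eq_iff indicator_def)
    then show ?thesis using integrable_mult_indicator[OF AM integrable_block_sq[of m n]] by simp
  qed
  have i1: "integrable M (\<lambda>x. indicator A x * (block m n x)\<^sup>2)"
    using integrable_mult_indicator[OF AM integrable_block_sq[of m n]] by simp
  have i2: "integrable M (\<lambda>x. indicator A x * (d n x)\<^sup>2)"
    using integrable_mult_indicator[OF AM sq_int[of n]] by simp
  have i3: "integrable M (\<lambda>x. indicator A x * block m n x * d n x)"
    by (rule integrable_mult_of_squares) (use Z measurable_M[OF Z] Z2 sq_int in auto)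
  have "(\<integral>x. indicator A x * (block m (Suc n) x)\<^sup>2 \<partial>M) =
    (\<integral>x. indicator A x * (block m n x)\<^sup>2 + indicator A x * (d n x)\<^sup>2
         + 2 * (indicator A x * block m n x * d n x) \<partial>M)"
    using \<open>m \<le> n\<close>
    by (intro Bochner_Integration.integral_cong refl) (simp add: block_Suc power2_eq_square algebra_simps)
  also have "\<dots> = (\<integral>x. indicator A x * (block m n x)\<^sup>2 \<partial>M) + (\<integral>x. indicator A x * (d n x)\<^sup>2 \<partial>M)
       + 2 * (\<integral>x. indicator A x * block m n x * d n x \<partial>M)"
    using i1 i2 i3 by simp
  finally show ?thesis using orthogonal_to_past[OF Z Z2] by simp
qed

lemma block_variance: "m \<le> n \<Longrightarrow> (\<integral>x. (block m n x)\<^sup>2 \<partial>M) = (\<Sum>k=m..<n. \<integral>x. (d k x)\<^sup>2 \<partial>M)"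
proof (induction n rule: dec_induct)
  case (step n)
  have *: "space M = space (G n)" using subalg unfolding subalgebra_def by auto
  have eq: "(\<integral>x. indicator (space M) x * (block m (Suc n) x)\<^sup>2 \<partial>M) =
    (\<integral>x. indicator (space M) x * (block m n x)\<^sup>2 \<partial>M) + (\<integral>x. indicator (space M) x * (d n x)\<^sup>2 \<partial>M)"
    by (rule indicator_block_Suc) (use step * in auto)
  have space: "(\<integral>x. indicator (space M) x * f x \<partial>M) = (\<integral>x. f x \<partial>M)" for f :: "'a \<Rightarrow> real"
    by (rule Bochner_Integration.integral_cong) auto
  show ?case using eq[unfolded space] step by simp
qed (simp add: block_def)

lemma indicator_block_mono:
  assumes "A \<in> sets (G k)" "m \<le> k" "k \<le> n"
  shows "(\<integral>x. indicator A x * (block m k x)\<^sup>2 \<partial>M) \<le> (\<integral>x. indicator A x * (block m n x)\<^sup>2 \<partial>M)"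
  using \<open>k \<le> n\<close>
proof (induction n rule: dec_induct)
  case (step n)
  have "A \<in> sets (G n)" using assms step sets_mono by blast
  then have "(\<integral>x. indicator A x * (block m (Suc n) x)\<^sup>2 \<partial>M) =
    (\<integral>x. indicator A x * (block m n x)\<^sup>2 \<partial>M) + (\<integral>x. indicator A x * (d n x)\<^sup>2 \<partial>M)"
    by (rule indicator_block_Suc) (use step assms in auto)
  moreover have "0 \<le> (\<integral>x. indicator A x * (d n x)\<^sup>2 \<partial>M)"
    by (rule integral_nonneg_AE) auto
  ultimately show ?case using step.IH by linarith
qed simp

text \<open>Kolmogorov's argument: split the event by the first time \<open>k\<close> at which the partial sums reach \<open>\<epsilon>\<close>.
  This event is decided by the past of \<open>k\<close>, and on it the second moment of the partial sums cannot
  decrease after \<open>k\<close>.\<close>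

lemma maximal_inequality:
  assumes "0 < \<epsilon>" "m \<le> n"
  shows "\<epsilon>\<^sup>2 * prob {x \<in> space M. \<exists>k\<in>{m..n}. \<epsilon> \<le> \<bar>block m k x\<bar>} \<le> (\<Sum>k=m..<n. \<integral>x. (d k x)\<^sup>2 \<partial>M)"
proof -
  \<comment> \<open>\<open>k\<close> is the first time at which the level \<open>\<epsilon>\<close> is reached.\<close>
  define A where "A k = {x \<in> space M. \<epsilon> \<le> \<bar>block m k x\<bar> \<and> (\<forall>j\<in>{m..<k}. \<bar>block m j x\<bar> < \<epsilon>)}" for k
  have sp: "space (G k) = space M" for k using subalg unfolding subalgebra_def by auto
  have AG: "A k \<in> sets (G k)" for k
  proof -
    have *: "block m j \<in> borel_measurable (G k)" if "j \<le> k" for j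
      using that block_adapted measurable_mono by blast
    have "{x \<in> space (G k). \<epsilon> \<le> \<bar>block m k x\<bar> \<and> (\<forall>j\<in>{m..<k}. \<bar>block m j x\<bar> < \<epsilon>)} \<in> sets (G k)"
      by (intro sets.sets_Collect_conj sets.sets_Collect_finite_All borel_measurable_le
          borel_measurable_less borel_measurable_abs borel_measurable_const *) auto
    then show ?thesis unfolding A_def sp .
  qed
  have AM: "A k \<in> sets M" for k using AG[of k] subalg[of k] unfolding subalgebra_def by auto
  have disj: "disjoint_family_on A {m..n}"
    unfolding disjoint_family_on_def A_def
    by (auto simp: disjoint_iff) (metis linorder_neqE_nat not_less atLeastLessThan_iff)
  have cover: "{x \<in> space M. \<exists>k\<in>{m..n}. \<epsilon> \<le> \<bar>block m k x\<bar>} = (\<Union>k\<in>{m..n}. A k)" (is "?L = ?R")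
  proof
    show "?R \<subseteq> ?L" unfolding A_def by auto
    show "?L \<subseteq> ?R"
    proof
      fix x assume w: "x \<in> ?L"
      let ?P = "\<lambda>k. m \<le> k \<and> \<epsilon> \<le> \<bar>block m k x\<bar>"
      from w obtain k0 where k0: "?P k0" "k0 \<le> n" by auto
      have "?P (LEAST k. ?P k)" using k0 LeastI[of ?P] by blast
      moreover have "(LEAST k. ?P k) \<le> n" using k0 Least_le[of ?P k0] by auto
      moreover have "\<bar>block m j x\<bar> < \<epsilon>" if "j \<in> {m..<(LEAST k. ?P k)}" for j
        using that not_less_Least[of j ?P] by auto
      ultimately show "x \<in> ?R" using w unfolding A_def by auto
    qed
  qed
  have intA: "integrable M (\<lambda>x. indicator (A k) x * (block m j x)\<^sup>2)" for k j
    using integrable_mult_indicator[OF AM integrable_block_sq[of m j]] by simp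
  have "\<epsilon>\<^sup>2 * prob (A k) \<le> (\<integral>x. indicator (A k) x * (block m n x)\<^sup>2 \<partial>M)" if "k \<in> {m..n}" for k
  proof -
    have "\<epsilon>\<^sup>2 * prob (A k) = (\<integral>x. indicator (A k) x * \<epsilon>\<^sup>2 \<partial>M)"
      using AM[of k] by simp
    also have "\<dots> \<le> (\<integral>x. indicator (A k) x * (block m k x)\<^sup>2 \<partial>M)"
    proof (rule integral_mono)
      show "integrable M (\<lambda>x. indicat_real (A k) x * \<epsilon>\<^sup>2)" using AM[of k]
        by (simp add: integrable_indicator_iff less_top[symmetric])
      fix x assume "x \<in> space M"
      show "indicat_real (A k) x * \<epsilon>\<^sup>2 \<le> indicat_real (A k) x * (block m k x)\<^sup>2"
        using \<open>0 < \<epsilon>\<close> by (auto simp: indicator_def A_def abs_le_square_iff[symmetric])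
    qed (rule intA)
    also have "\<dots> \<le> (\<integral>x. indicator (A k) x * (block m n x)\<^sup>2 \<partial>M)"
      by (rule indicator_block_mono[OF AG]) (use that in auto)
    finally show ?thesis .
  qed
  then have "(\<Sum>k\<in>{m..n}. \<epsilon>\<^sup>2 * prob (A k)) \<le> (\<Sum>k\<in>{m..n}. \<integral>x. indicator (A k) x * (block m n x)\<^sup>2 \<partial>M)"
    by (rule sum_mono)
  also have "\<dots> = (\<integral>x. (\<Sum>k\<in>{m..n}. indicator (A k) x * (block m n x)\<^sup>2) \<partial>M)"
    by (rule Bochner_Integration.integral_sum[symmetric]) (rule intA)
  also have "\<dots> \<le> (\<integral>x. (block m n x)\<^sup>2 \<partial>M)"
  proof (rule integral_mono)
    fix x assume "x \<in> space M"
    have "(\<Sum>k\<in>{m..n}. indicat_real (A k) x) = indicator (\<Union>k\<in>{m..n}. A k) x"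
      by (rule indicator_UN_disjoint[symmetric]) (use disj in auto)
    also have "\<dots> \<le> 1" by (simp add: indicator_def)
    finally show "(\<Sum>k\<in>{m..n}. indicator (A k) x * (block m n x)\<^sup>2) \<le> (block m n x)\<^sup>2"
      by (simp add: sum_distrib_right[symmetric] mult_left_le_one_le sum_nonneg)
  qed (intro Bochner_Integration.integrable_sum intA integrable_block_sq)+
  also have "\<dots> = (\<Sum>k=m..<n. \<integral>x. (d k x)\<^sup>2 \<partial>M)" by (rule block_variance[OF \<open>m \<le> n\<close>])
  finally show ?thesis
    using finite_measure_finite_Union[of "{m..n}" A] AM disj
    by (simp add: cover sum_distrib_left image_subset_iff)
qed

text \<open>The maximal inequality bounds the oscillation of the partial sums after \<open>m\<close> by the tail of the
  series of second moments; hence almost surely the partial sums form a Cauchy sequence.\<close>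

theorem summable_AE:
  assumes s: "summable (\<lambda>k. \<integral>x. (d k x)\<^sup>2 \<partial>M)"
  shows "AE x in M. summable (\<lambda>k. d k x)"
proof -
  let ?v = "\<lambda>k. \<integral>x. (d k x)\<^sup>2 \<partial>M"
  have v0: "0 \<le> ?v k" for k by (rule integral_nonneg_AE) auto
  define B where "B \<epsilon> m = {x \<in> space M. \<exists>k\<ge>m. \<epsilon> \<le> \<bar>block m k x\<bar>}" for \<epsilon> m
  have BM [measurable]: "B \<epsilon> m \<in> sets M" for \<epsilon> m unfolding B_def by measurable
  have bound: "\<epsilon>\<^sup>2 * prob (B \<epsilon> m) \<le> (\<Sum>k. ?v (k + m))" if "0 < \<epsilon>" for \<epsilon> m
  proof -
    define C where "C n = {x \<in> space M. \<exists>k\<in>{m..m+n}. \<epsilon> \<le> \<bar>block m k x\<bar>}" for n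
    have C: "(\<lambda>n. prob (C n)) \<longlonglongrightarrow> prob (\<Union>n. C n)"
    proof (rule finite_Lim_measure_incseq)
      have "C n \<in> sets M" for n unfolding C_def by measurable
      then show "range C \<subseteq> events" by auto
      show "incseq C" unfolding C_def incseq_def by fastforce
    qed
    have "B \<epsilon> m \<subseteq> (\<Union>n. C n)"
    proof
      fix x assume "x \<in> B \<epsilon> m"
      then obtain k where "x \<in> space M" "m \<le> k" "\<epsilon> \<le> \<bar>block m k x\<bar>" unfolding B_def by blast
      then have "x \<in> C k" unfolding C_def by fastforce
      then show "x \<in> (\<Union>n. C n)" by blast
    qed
    then have "(\<Union>n. C n) = B \<epsilon> m" unfolding C_def B_def by fastforce
    with C have C': "(\<lambda>n. \<epsilon>\<^sup>2 * prob (C n)) \<longlonglongrightarrow> \<epsilon>\<^sup>2 * prob (B \<epsilon> m)" by (intro tendsto_intros) simp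
    show ?thesis
    proof (rule LIMSEQ_le_const2[OF C'], intro exI allI impI)
      fix n
      have "\<epsilon>\<^sup>2 * prob (C n) \<le> (\<Sum>k=m..<m+n. ?v k)"
        unfolding C_def by (rule maximal_inequality) (use that in auto)
      also have "\<dots> = (\<Sum>k<n. ?v (k + m))"
        using sum.shift_bounds_nat_ivl[of ?v 0 m n] by (simp add: add.commute atLeast0LessThan)
      also have "\<dots> \<le> (\<Sum>k. ?v (k + m))"
        by (rule sum_le_suminf[OF summable_ignore_initial_segment[OF s]]) (use v0 in auto)
      finally show "\<epsilon>\<^sup>2 * prob (C n) \<le> (\<Sum>k. ?v (k + m))" .
    qed
  qed
  have tail: "(\<lambda>m. \<Sum>k. ?v (k + m)) \<longlonglongrightarrow> 0" using suminf_exist_split2[OF s] .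
  have null: "AE x in M. x \<notin> (\<Inter>m. B \<epsilon> m)" if "0 < \<epsilon>" for \<epsilon>
  proof -
    have "\<epsilon>\<^sup>2 * prob (\<Inter>m. B \<epsilon> m) \<le> (\<Sum>k. ?v (k + m))" for m
    proof -
      have "prob (\<Inter>m. B \<epsilon> m) \<le> prob (B \<epsilon> m)" by (rule finite_measure_mono) auto
      then have "\<epsilon>\<^sup>2 * prob (\<Inter>m. B \<epsilon> m) \<le> \<epsilon>\<^sup>2 * prob (B \<epsilon> m)" by (intro mult_left_mono) auto
      then show ?thesis using bound[OF that, of m] by linarith
    qed
    then have "\<epsilon>\<^sup>2 * prob (\<Inter>m. B \<epsilon> m) \<le> 0"
      using tendsto_lowerbound[OF tail always_eventually, of "\<epsilon>\<^sup>2 * prob (\<Inter>m. B \<epsilon> m)"] by simp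
    then have "prob (\<Inter>m. B \<epsilon> m) = 0"
      using that measure_nonneg[of M "\<Inter>m. B \<epsilon> m"] by (auto simp: mult_le_0_iff intro: order_antisym)
    moreover have "(\<Inter>m. B \<epsilon> m) \<in> sets M" by measurable
    ultimately show ?thesis using prob_eq_0 by blast
  qed
  have "AE x in M. \<forall>i. x \<notin> (\<Inter>m. B (1 / real (Suc i)) m)"
    unfolding AE_all_countable by (intro allI null) simp
  then show ?thesis using AE_space
  proof eventually_elim
    case (elim x)
    then have w: "\<forall>i. x \<notin> (\<Inter>m. B (1 / real (Suc i)) m)" and sp: "x \<in> space M" by auto
    show "summable (\<lambda>k. d k x)"
      unfolding summable_Cauchy
    proof (intro allI impI)
      fix e :: real assume "0 < e"
      then obtain i where i: "1 / real (Suc i) < e / 2" using nat_approx_posE[of "e/2"] by auto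
      obtain N where "x \<notin> B (1 / real (Suc i)) N" using w by auto
      then have N: "\<bar>block N k x\<bar> < e / 2" if "N \<le> k" for k
        using that sp i unfolding B_def by fastforce
      show "\<exists>N. \<forall>m\<ge>N. \<forall>n. norm (sum (\<lambda>k. d k x) {m..<n}) < e"
      proof (intro exI allI impI)
        fix m n assume m: "N \<le> m"
        show "norm (sum (\<lambda>k. d k x) {m..<n}) < e"
        proof (cases "m \<le> n")
          case True
          have "sum (\<lambda>k. d k x) {m..<n} = block N n x - block N m x"
            using sum.atLeastLessThan_concat[of N m n "\<lambda>k. d k x"] m True unfolding block_def by simp
          then show ?thesis using N[of n] N[of m] m True by simp
        qed (use \<open>0 < e\<close> in simp)
      qed
    qed
  qed
qed

end

section \<open>The strong law of large numbers\<close>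

lemma cesaro_mean:
  fixes a :: "nat \<Rightarrow> real"
  assumes a: "a \<longlonglongrightarrow> L"
  shows "(\<lambda>n. (\<Sum>j<n. a j) / real n) \<longlonglongrightarrow> L"
proof (rule LIMSEQ_I)
  fix e :: real assume "0 < e"
  then obtain N where N: "\<bar>a j - L\<bar> < e / 2" if "N \<le> j" for j
    using LIMSEQ_D[OF a, of "e/2"] by auto
  define C where "C = (\<Sum>j<N. \<bar>a j - L\<bar>)"
  obtain n0 where n0: "2 * C / e < real n0" using reals_Archimedean2 by blast
  show "\<exists>no. \<forall>n\<ge>no. norm ((\<Sum>j<n. a j) / real n - L) < e"
  proof (intro exI allI impI)
    fix n assume n: "max (Suc N) n0 \<le> n"
    then have pos: "0 < real n" by auto
    have "{..<n} = {..<N} \<union> {N..<n}" using n by auto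
    then have split: "(\<Sum>j<n. \<bar>a j - L\<bar>) = C + (\<Sum>j=N..<n. \<bar>a j - L\<bar>)"
      unfolding C_def by (simp add: sum.union_disjoint ivl_disj_int)
    have "(\<Sum>j=N..<n. \<bar>a j - L\<bar>) \<le> (\<Sum>j=N..<n. e / 2)" by (rule sum_mono) (use N in force)
    also have "\<dots> \<le> real n * (e / 2)" using \<open>0 < e\<close> by (simp add: mult_right_mono)
    finally have 1: "(\<Sum>j<n. \<bar>a j - L\<bar>) \<le> C + real n * (e / 2)" using split by simp
    have "2 * C / e < real n" using n n0 by linarith
    then have "C < real n * (e / 2)" using \<open>0 < e\<close> by (simp add: field_simps)
    then have 2: "(\<Sum>j<n. \<bar>a j - L\<bar>) < real n * e" using 1 by simp
    have "(\<Sum>j<n. a j) / real n - L = (\<Sum>j<n. a j - L) / real n"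
      using pos by (simp add: sum_subtractf field_simps)
    then have "\<bar>(\<Sum>j<n. a j) / real n - L\<bar> \<le> (\<Sum>j<n. \<bar>a j - L\<bar>) / real n"
      using pos by (simp add: abs_div divide_right_mono)
    also have "\<dots> < e" using 2 pos by (simp add: field_simps)
    finally show "norm ((\<Sum>j<n. a j) / real n - L) < e" by simp
  qed
qed

text \<open>Kronecker's lemma for the weights \<open>j + 1\<close>. Summation by parts expresses the mean of \<open>a\<close> as a partial
  sum of the series minus the Cesaro mean of the partial sums, and both have the same limit.\<close>

lemma kronecker:
  fixes a :: "nat \<Rightarrow> real"
  assumes "summable (\<lambda>j. a j / real (Suc j))"
  shows "(\<lambda>n. (\<Sum>j<n. a j) / real n) \<longlonglongrightarrow> 0"
proof -
  define s where "s n = (\<Sum>j<n. a j / real (Suc j))" for n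
  obtain S where S: "s \<longlonglongrightarrow> S" using summable_LIMSEQ[OF assms] unfolding s_def by blast
  have parts: "(\<Sum>j<n. a j) = real n * s n - (\<Sum>j<n. s j)" for n
  proof (induction n)
    case (Suc n)
    have "s (Suc n) = s n + a n / real (Suc n)" by (simp add: s_def)
    then have "real (Suc n) * s (Suc n) = real (Suc n) * s n + a n" by (simp add: field_simps)
    then show ?case using Suc by (simp add: algebra_simps)
  qed simp
  have "(\<lambda>n. s n - (\<Sum>j<n. s j) / real n) \<longlonglongrightarrow> S - S"
    by (intro tendsto_diff S cesaro_mean)
  moreover have "\<forall>\<^sub>F n in sequentially. s n - (\<Sum>j<n. s j) / real n = (\<Sum>j<n. a j) / real n"
    using eventually_gt_at_top[of 0] by eventually_elim (simp add: parts diff_divide_distrib)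
  ultimately show ?thesis by (simp cong: filterlim_cong)
qed

text \<open>Only the terms with \<open>j + 1 \<ge> \<bar>a\<bar>\<close> count, and the tail of the series of inverse squares from there on
  is at most \<open>2 / \<bar>a\<bar>\<close>. The induction carries the telescoping remainder \<open>2 a\<^sup>2 / (n + 1)\<close> along.\<close>

lemma truncated_square_sum_le:
  "(\<Sum>j<n. if \<bar>a\<bar> \<le> real (Suc j) then a\<^sup>2 / (real (Suc j))\<^sup>2 else 0) \<le> 2 * \<bar>a\<bar>" (is "?S n \<le> _")
proof -
  have step: "a\<^sup>2 / (real (Suc n))\<^sup>2 \<le> 2 * a\<^sup>2 / real (n + 1) - 2 * a\<^sup>2 / real (n + 2)" for n
  proof -
    have "1 / (real (Suc n))\<^sup>2 \<le> 2 / real (n + 1) - 2 / real (n + 2)"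
    proof -
      have "0 < real n + 1" "0 < real n + 2" by auto
      then have "2 / real (n + 1) - 2 / real (n + 2) = 2 / ((real n + 1) * (real n + 2))"
        by (simp add: field_simps)
      also have "\<dots> \<ge> 2 / ((real n + 1) * (2 * (real n + 1)))"
        by (intro divide_left_mono mult_left_mono mult_pos_pos) auto
      finally have "2 / ((real n + 1) * (2 * (real n + 1))) \<le> 2 / real (n + 1) - 2 / real (n + 2)" .
      moreover have "2 / (b * (2 * b)) = 1 / b\<^sup>2" for b :: real by (simp add: power2_eq_square)
      ultimately show ?thesis by (simp only: of_nat_Suc add.commute)
    qed
    then have "a\<^sup>2 * (1 / (real (Suc n))\<^sup>2) \<le> a\<^sup>2 * (2 / real (n + 1) - 2 / real (n + 2))"
      by (intro mult_left_mono) auto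
    then show ?thesis by (simp add: algebra_simps)
  qed
  have "(real n < \<bar>a\<bar> \<longrightarrow> ?S n = 0) \<and> (\<bar>a\<bar> \<le> real n \<longrightarrow> ?S n \<le> 2 * \<bar>a\<bar> - 2 * a\<^sup>2 / real (n + 1))"
  proof (induction n)
    case (Suc n)
    show ?case
    proof (intro conjI impI)
      assume "real (Suc n) < \<bar>a\<bar>"
      then show "?S (Suc n) = 0" using Suc by auto
    next
      assume le: "\<bar>a\<bar> \<le> real (Suc n)"
      then have eq: "?S (Suc n) = ?S n + a\<^sup>2 / (real (Suc n))\<^sup>2" by simp
      show "?S (Suc n) \<le> 2 * \<bar>a\<bar> - 2 * a\<^sup>2 / real (Suc n + 1)"
      proof (cases "\<bar>a\<bar> \<le> real n")
        case True
        then show ?thesis using Suc eq step[of n] by simp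
      next
        case False
        have "a\<^sup>2 = \<bar>a\<bar> * \<bar>a\<bar>" by (simp add: power2_eq_square)
        also have "\<dots> \<le> \<bar>a\<bar> * real (n + 1)" using le by (intro mult_left_mono) auto
        finally have "2 * a\<^sup>2 / real (n + 1) \<le> 2 * \<bar>a\<bar>" by (simp add: field_simps)
        then show ?thesis using Suc eq step[of n] False by simp
      qed
    qed
  qed simp
  moreover have "0 \<le> 2 * a\<^sup>2 / real (n + 1)" by simp
  ultimately show ?thesis by linarith
qed

lemma count_exceeding_le: "(\<Sum>j<n. if real (Suc j) < \<bar>a\<bar> then 1 else 0) \<le> \<bar>a::real\<bar>"
proof -
  have "(\<Sum>j<n. if real (Suc j) < \<bar>a\<bar> then 1 else 0) \<le> min (real n) \<bar>a\<bar>"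
    by (induction n) auto
  then show ?thesis by simp
qed

text \<open>Truncate the \<open>j\<close>-th variable at level \<open>j\<close>. Integrability makes the truncation inactive for all but
  finitely many \<open>j\<close> by the Borel-Cantelli lemma, and it also bounds the sum of the variances divided
  by \<open>j\<^sup>2\<close>. So the centered truncated variables, divided by \<open>j\<close>, form an almost surely convergent
  martingale series, and Kronecker's lemma turns this into convergence of the means.\<close>

theorem (in prob_space) strong_law_of_large_numbers:
  fixes h :: "'x \<Rightarrow> real"
  assumes ind: "indep_vars (\<lambda>_. N) X {1..}"
    and distr: "\<And>i. 1 \<le> i \<Longrightarrow> distr M N (X i) = N"
    and h: "integrable N h"
  shows "AE \<omega> in M. (\<lambda>n. (\<Sum>j=1..n. h (X j \<omega>)) / real n) \<longlonglongrightarrow> (\<integral>s. h s \<partial>N)"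
proof -
  have X [measurable]: "X (Suc i) \<in> measurable M N" for i
    using ind unfolding indep_vars_def by auto
  have hm [measurable]: "h \<in> borel_measurable N" using h by auto
  interpret N: prob_space N
    using prob_space_distr[OF X[of 0]] distr[of "Suc 0"] by simp
  have expect: "(\<integral>\<omega>. f (X (Suc i) \<omega>) \<partial>M) = (\<integral>s. f s \<partial>N)" if "f \<in> borel_measurable N" for f :: "'x \<Rightarrow> real" and i
    using integral_distr[OF X[of i] that] distr[of "Suc i"] by simp
  have integ: "integrable M (\<lambda>\<omega>. f (X (Suc i) \<omega>)) \<longleftrightarrow> integrable N f" if "f \<in> borel_measurable N" for f :: "'x \<Rightarrow> real" and i
    using integrable_distr_eq[OF X[of i] that] distr[of "Suc i"] by simp
  define t where "t j s = (if \<bar>h s\<bar> \<le> real (Suc j) then h s else 0)" for j s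
  have t_m [measurable]: "t j \<in> borel_measurable N" for j unfolding t_def by measurable
  have t_le: "\<bar>t j s\<bar> \<le> real (Suc j)" "\<bar>t j s\<bar> \<le> \<bar>h s\<bar>" for j s unfolding t_def by auto
  have t_int: "integrable N (t j)" for j
    by (rule N.integrable_const_bound[where B = "real (Suc j)"]) (use t_le in auto)
  have t2_int: "integrable N (\<lambda>s. (t j s)\<^sup>2)" for j
    by (rule N.integrable_const_bound[where B = "(real (Suc j))\<^sup>2"])
       (use power_mono[OF t_le(1) abs_ge_zero, where n = 2] in auto)
  define c where "c j = (\<integral>s. t j s \<partial>N)" for j
  define e where "e j s = (t j s - c j) / real (Suc j)" for j s
  have e_m [measurable]: "e j \<in> borel_measurable N" for j unfolding e_def by measurable
  have e_int: "integrable N (e j)" for j unfolding e_def using t_int by auto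
  have e_mean: "(\<integral>s. e j s \<partial>N) = 0" for j
    unfolding e_def using t_int by (simp add: c_def N.prob_space)
  have e2_int: "integrable N (\<lambda>s. (e j s)\<^sup>2)" for j
    using t_int[of j] t2_int[of j] unfolding e_def power_divide power2_diff
    by (intro integrable_divide Bochner_Integration.integrable_add Bochner_Integration.integrable_diff) auto
  have e_var: "(\<integral>s. (e j s)\<^sup>2 \<partial>N) \<le> (\<integral>s. (t j s)\<^sup>2 / (real (Suc j))\<^sup>2 \<partial>N)" for j
  proof -
    have "(\<integral>s. (e j s)\<^sup>2 \<partial>N) = (\<integral>s. (t j s - c j)\<^sup>2 \<partial>N) / (real (Suc j))\<^sup>2"
      unfolding e_def power_divide by simp
    also have "(\<integral>s. (t j s - c j)\<^sup>2 \<partial>N) = (\<integral>s. (t j s)\<^sup>2 \<partial>N) - (c j)\<^sup>2"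
      unfolding c_def by (rule N.variance_eq[OF t_int t2_int])
    also have "((\<integral>s. (t j s)\<^sup>2 \<partial>N) - (c j)\<^sup>2) / (real (Suc j))\<^sup>2 \<le> (\<integral>s. (t j s)\<^sup>2 \<partial>N) / (real (Suc j))\<^sup>2"
      by (intro divide_right_mono) auto
    finally show ?thesis by simp
  qed
  have sum_var: "summable (\<lambda>j. \<integral>s. (e j s)\<^sup>2 \<partial>N)"
  proof (rule summableI_nonneg_bounded)
    show "0 \<le> (\<integral>s. (e j s)\<^sup>2 \<partial>N)" for j by (rule integral_nonneg_AE) auto
    fix n
    have "(\<Sum>j<n. \<integral>s. (e j s)\<^sup>2 \<partial>N) \<le> (\<Sum>j<n. \<integral>s. (t j s)\<^sup>2 / (real (Suc j))\<^sup>2 \<partial>N)"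
      by (rule sum_mono) (rule e_var)
    also have "\<dots> = (\<integral>s. (\<Sum>j<n. (t j s)\<^sup>2 / (real (Suc j))\<^sup>2) \<partial>N)"
      by (rule Bochner_Integration.integral_sum[symmetric]) (use t2_int in auto)
    also have "\<dots> \<le> (\<integral>s. 2 * \<bar>h s\<bar> \<partial>N)"
    proof (rule integral_mono)
      fix s
      have "(\<Sum>j<n. (t j s)\<^sup>2 / (real (Suc j))\<^sup>2)
        = (\<Sum>j<n. if \<bar>h s\<bar> \<le> real (Suc j) then (h s)\<^sup>2 / (real (Suc j))\<^sup>2 else 0)"
        by (rule sum.cong) (auto simp: t_def)
      then show "(\<Sum>j<n. (t j s)\<^sup>2 / (real (Suc j))\<^sup>2) \<le> 2 * \<bar>h s\<bar>"
        using truncated_square_sum_le[of "h s" n] by simp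
    qed (use t2_int h in auto)
    finally show "(\<Sum>j<n. \<integral>s. (e j s)\<^sup>2 \<partial>N) \<le> (\<integral>s. 2 * \<bar>h s\<bar> \<partial>N)" .
  qed
\<comment> \<open>The past of step \<open>k\<close> is the sigma-algebra generated by the vector of the first \<open>k\<close> variables.\<close>
  define V where "V k \<omega> = (\<lambda>i\<in>{1..k}. X i \<omega>)" for k \<omega>
  define G where "G k = vimage_algebra (space M) (V k) (PiM {1..k} (\<lambda>_. N))" for k
  have X1: "X i \<in> measurable M N" if "1 \<le> i" for i using X[of "i - 1"] that by simp
  have V_m: "V k \<in> measurable M (PiM {1..k} (\<lambda>_. N))" for k
    unfolding V_def by (intro measurable_restrict X1) auto
  have V_fun: "V k \<in> space M \<rightarrow> space (PiM {1..k} (\<lambda>_. N))" for k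
    using V_m unfolding measurable_def by auto
  have XG: "X i \<in> measurable (G k) N" if "i \<in> {1..k}" for i k
  proof -
    have "(\<lambda>\<omega>. V k \<omega> i) \<in> measurable (G k) N"
      using measurable_compose[OF measurable_vimage_algebra1[OF V_fun] measurable_component_singleton[OF that]]
      unfolding G_def by simp
    then show ?thesis using that by (simp add: V_def)
  qed
  interpret S: square_integrable_martingale_difference M G "\<lambda>j \<omega>. e j (X (Suc j) \<omega>)"
  proof
    fix k
    show "subalgebra M (G k)"
      unfolding subalgebra_def G_def by (auto intro: sets_image_in_sets[OF refl V_m, THEN subsetD])
    have "V k \<in> measurable (G (Suc k)) (PiM {1..k} (\<lambda>_. N))"
      unfolding V_def by (intro measurable_restrict XG) auto
    then show "sets (G k) \<subseteq> sets (G (Suc k))"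
      unfolding G_def by (intro sets_image_in_sets) auto
    show "(\<lambda>\<omega>. e k (X (Suc k) \<omega>)) \<in> borel_measurable (G (Suc k))"
      by (rule measurable_compose[OF XG e_m]) auto
    show "integrable M (\<lambda>\<omega>. (e k (X (Suc k) \<omega>))\<^sup>2)"
      using integ[of "\<lambda>s. (e k s)\<^sup>2" k] e2_int by simp
    fix A assume "A \<in> sets (G k)"
    then obtain B where B: "B \<in> sets (PiM {1..k} (\<lambda>_. N))" and A: "A = V k -` B \<inter> space M"
      unfolding G_def sets_vimage_algebra2[OF V_fun] by auto
    have "indep_var (PiM {1..k} (\<lambda>_. N)) (V k) (PiM {Suc k} (\<lambda>_. N)) (\<lambda>\<omega>. \<lambda>i\<in>{Suc k}. X i \<omega>)"
      unfolding V_def[abs_def] by (rule indep_var_restrict[OF ind]) auto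
    then have "indep_var borel (indicat_real B \<circ> V k) borel ((\<lambda>f. e k (f (Suc k))) \<circ> (\<lambda>\<omega>. \<lambda>i\<in>{Suc k}. X i \<omega>))"
      by (rule indep_var_compose) (use B in auto)
    then have iv: "indep_var borel (\<lambda>\<omega>. indicat_real B (V k \<omega>)) borel (\<lambda>\<omega>. e k (X (Suc k) \<omega>))"
      by (simp add: comp_def)
    have "integrable M (\<lambda>\<omega>. indicat_real B (V k \<omega>))"
      by (rule integrable_const_bound[where B = 1]) (use B V_m in auto)
    then have "(\<integral>\<omega>. indicat_real B (V k \<omega>) * e k (X (Suc k) \<omega>) \<partial>M) =
      (\<integral>\<omega>. indicat_real B (V k \<omega>) \<partial>M) * (\<integral>\<omega>. e k (X (Suc k) \<omega>) \<partial>M)"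
      by (intro indep_var_lebesgue_integral[OF iv]) (use integ e_int in auto)
    moreover have "(\<integral>\<omega>. indicat_real A \<omega> * e k (X (Suc k) \<omega>) \<partial>M) =
      (\<integral>\<omega>. indicat_real B (V k \<omega>) * e k (X (Suc k) \<omega>) \<partial>M)"
      by (rule Bochner_Integration.integral_cong) (auto simp: A indicator_def)
    ultimately show "(\<integral>\<omega>. indicator A \<omega> * e k (X (Suc k) \<omega>) \<partial>M) = 0"
      using expect[of "e k" k] e_mean by simp
  qed
  have "summable (\<lambda>k. \<integral>\<omega>. (e k (X (Suc k) \<omega>))\<^sup>2 \<partial>M)"
    using sum_var expect[of "\<lambda>s. (e _ s)\<^sup>2"] by simp
  then have AE1: "AE \<omega> in M. summable (\<lambda>k. e k (X (Suc k) \<omega>))" by (rule S.summable_AE)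
  define E where "E j = {\<omega> \<in> space M. real (Suc j) < \<bar>h (X (Suc j) \<omega>)\<bar>}" for j
  have AE2: "AE \<omega> in M. eventually (\<lambda>j. \<omega> \<in> space M - E j) sequentially"
  proof (rule borel_cantelli_AE1)
    show Em: "E j \<in> sets M" for j unfolding E_def by measurable
    have mE: "measure M (E j) = (\<integral>s. (if real (Suc j) < \<bar>h s\<bar> then 1 else 0) \<partial>N)" for j
    proof -
      have "measure M (E j) = (\<integral>\<omega>. indicat_real (E j) \<omega> \<partial>M)" using Em by simp
      also have "\<dots> = (\<integral>\<omega>. (if real (Suc j) < \<bar>h (X (Suc j) \<omega>)\<bar> then 1 else 0) \<partial>M)"
        by (rule Bochner_Integration.integral_cong) (auto simp: E_def indicator_def)
      also have "\<dots> = (\<integral>s. (if real (Suc j) < \<bar>h s\<bar> then 1 else 0) \<partial>N)"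
        by (rule expect) measurable
      finally show ?thesis .
    qed
    show "summable (\<lambda>j. measure M (E j))"
    proof (rule summableI_nonneg_bounded)
      fix n
      have i: "integrable N (\<lambda>s. (if real (Suc j) < \<bar>h s\<bar> then 1 else 0) :: real)" for j
        by (rule N.integrable_const_bound[where B = 1]) auto
      have "(\<Sum>j<n. measure M (E j)) = (\<integral>s. (\<Sum>j<n. if real (Suc j) < \<bar>h s\<bar> then 1 else 0) \<partial>N)"
        unfolding mE by (rule Bochner_Integration.integral_sum[symmetric]) (rule i)
      also have "\<dots> \<le> (\<integral>s. \<bar>h s\<bar> \<partial>N)"
        by (rule integral_mono) (use h i count_exceeding_le in auto)
      finally show "(\<Sum>j<n. measure M (E j)) \<le> (\<integral>s. \<bar>h s\<bar> \<partial>N)" .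
    qed simp
  qed (simp add: emeasure_eq_measure)
  have c_lim: "c \<longlonglongrightarrow> (\<integral>s. h s \<partial>N)"
    unfolding c_def
  proof (rule integral_dominated_convergence[where w = "\<lambda>s. \<bar>h s\<bar>"])
    have "(\<lambda>j. t j s) \<longlonglongrightarrow> h s" for s
    proof (rule tendsto_eventually)
      obtain m where "\<bar>h s\<bar> < real m" using reals_Archimedean2 by blast
      then have "t j s = h s" if "m \<le> j" for j using that by (simp add: t_def)
      then show "\<forall>\<^sub>F j in sequentially. t j s = h s" by (auto simp: eventually_sequentially)
    qed
    then show "AE s in N. (\<lambda>j. t j s) \<longlonglongrightarrow> h s" by simp
  qed (use h t_le in auto)
  show ?thesis using AE1 AE2
  proof eventually_elim
    case (elim \<omega>)
    let ?x = "\<lambda>j. X (Suc j) \<omega>"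
    have "\<forall>\<^sub>F j in sequentially. h (?x j) - t j (?x j) = 0"
      using elim(2) by eventually_elim (auto simp: E_def t_def)
    then have l1: "(\<lambda>n. (\<Sum>j<n. h (?x j) - t j (?x j)) / real n) \<longlonglongrightarrow> 0"
      by (intro cesaro_mean tendsto_eventually)
    have l2: "(\<lambda>n. (\<Sum>j<n. t j (?x j) - c j) / real n) \<longlonglongrightarrow> 0"
      by (rule kronecker) (use elim(1) in \<open>simp add: e_def\<close>)
    have l3: "(\<lambda>n. (\<Sum>j<n. c j) / real n) \<longlonglongrightarrow> (\<integral>s. h s \<partial>N)" by (rule cesaro_mean[OF c_lim])
    have "(\<lambda>n. (\<Sum>j<n. h (?x j) - t j (?x j)) / real n + (\<Sum>j<n. t j (?x j) - c j) / real n
       + (\<Sum>j<n. c j) / real n) \<longlonglongrightarrow> 0 + 0 + (\<integral>s. h s \<partial>N)"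
      by (intro tendsto_add l1 l2 l3)
    moreover have "(\<Sum>j<n. h (?x j) - t j (?x j)) / real n + (\<Sum>j<n. t j (?x j) - c j) / real n
       + (\<Sum>j<n. c j) / real n = (\<Sum>j=1..n. h (X j \<omega>)) / real n" for n
      by (simp add: sum_subtractf sum.atLeast1_atMost_eq add_divide_distrib[symmetric])
    ultimately show ?case by simp
  qed
qed

section \<open>Clarke subgradients and moduli on compact sets\<close>

lemma square_integrable_abs:
  "square_integrable M f \<Longrightarrow> square_integrable M (\<lambda>s. \<bar>f s\<bar>)"
  unfolding square_integrable_def by auto

lemma square_integrable_cmult:
  "square_integrable M f \<Longrightarrow> square_integrable M (\<lambda>s. c * f s)"
  unfolding square_integrable_def by (auto simp: power_mult_distrib)

lemma square_integrable_add:
  assumes "square_integrable M f" "square_integrable M g"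
  shows "square_integrable M (\<lambda>s. f s + g s)"
  unfolding square_integrable_def
proof
  have [measurable]: "f \<in> borel_measurable M" "g \<in> borel_measurable M"
    using assms unfolding square_integrable_def by auto
  show "(\<lambda>s. f s + g s) \<in> borel_measurable M" by measurable
  show "integrable M (\<lambda>s. (f s + g s)\<^sup>2)"
  proof (rule Bochner_Integration.integrable_bound)
    show "integrable M (\<lambda>s. 2 * (f s)\<^sup>2 + 2 * (g s)\<^sup>2)"
      using assms unfolding square_integrable_def by simp
    have "(a + b)\<^sup>2 \<le> 2 * a\<^sup>2 + 2 * b\<^sup>2" for a b :: real
      using sum_squares_bound[of a b] by (simp add: power2_sum)
    then show "AE s in M. norm ((f s + g s)\<^sup>2) \<le> norm (2 * (f s)\<^sup>2 + 2 * (g s)\<^sup>2)" by simp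
  qed measurable
qed

lemma square_integrable_sum:
  "finite I \<Longrightarrow> (\<And>i. i \<in> I \<Longrightarrow> square_integrable M (f i)) \<Longrightarrow> square_integrable M (\<lambda>s. \<Sum>i\<in>I. f i s)"
proof (induction I rule: finite_induct)
  case empty
  show ?case by (simp add: square_integrable_def)
next
  case (insert i I)
  then show ?case by (simp add: square_integrable_add)
qed

lemma (in finite_measure) square_integrable_imp_integrable:
  assumes "square_integrable M f"
  shows "integrable M f"
proof (rule Bochner_Integration.integrable_bound)
  show "integrable M (\<lambda>s. 1 + (f s)\<^sup>2)" using assms unfolding square_integrable_def by simp
  have "\<bar>a\<bar> \<le> 1 + a\<^sup>2" for a :: real
  proof -
    have "0 \<le> (\<bar>a\<bar> - 1)\<^sup>2" by simp
    then have "2 * \<bar>a\<bar> \<le> 1 + a\<^sup>2" by (simp add: power2_diff)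
    then show ?thesis by linarith
  qed
  then show "AE s in M. norm (f s) \<le> norm (1 + (f s)\<^sup>2)" by simp
qed (use assms in \<open>simp add: square_integrable_def\<close>)

lemma clarke_subdiff_norm_le:
  fixes f :: "'a::euclidean_space \<Rightarrow> real"
  assumes "0 < e" and lip: "\<And>y z. y \<in> ball x e \<Longrightarrow> z \<in> ball x e \<Longrightarrow> \<bar>f y - f z\<bar> \<le> K * norm (y - z)"
    and v: "v \<in> clarke_subdiff f x"
  shows "norm v \<le> K"
proof -
  define \<tau> where "\<tau> = e / (2 * (norm v + 1))"
  have "0 < norm v + 1" by (simp add: add_nonneg_pos)
  then have \<tau>: "0 < \<tau>" using \<open>0 < e\<close> unfolding \<tau>_def by simp
  have "clarke_dir_deriv f x v \<le> ereal (K * norm v)"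
    unfolding clarke_dir_deriv_def
  proof (rule Limsup_bounded)
    have ev1: "\<forall>\<^sub>F y in nhds x. y \<in> ball x (e/2)"
      using \<open>0 < e\<close> by (intro eventually_nhds_in_open) auto
    have ev2: "\<forall>\<^sub>F t in at_right 0. t \<in> {0<..<\<tau>}"
      using eventually_at_right_real[OF \<tau>] by simp
    show "\<forall>\<^sub>F p in nhds x \<times>\<^sub>F at_right 0. (case p of (y, t) \<Rightarrow> ereal ((f (y + t *\<^sub>R v) - f y) / t)) \<le> ereal (K * norm v)"
      unfolding eventually_prod_filter
    proof (intro exI conjI allI impI)
      show "\<forall>\<^sub>F y in nhds x. y \<in> ball x (e/2)" by (rule ev1)
      show "\<forall>\<^sub>F t in at_right 0. t \<in> {0<..<\<tau>}" by (rule ev2)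
      fix y t assume y: "y \<in> ball x (e/2)" and t: "t \<in> {0<..<\<tau>}"
      have "t * norm v \<le> t * (norm v + 1)" using t by simp
      also have "\<dots> < \<tau> * (norm v + 1)" using t \<open>0 < norm v + 1\<close> by simp
      also have "\<dots> = e / 2" using \<open>0 < norm v + 1\<close> unfolding \<tau>_def by (simp add: field_simps)
      finally have "norm (t *\<^sub>R v) < e / 2" using t by simp
      moreover have "dist x (y + t *\<^sub>R v) \<le> dist x y + norm (t *\<^sub>R v)"
        using norm_triangle_ineq4[of "x - y" "t *\<^sub>R v"] by (simp add: dist_norm algebra_simps)
      ultimately have "y + t *\<^sub>R v \<in> ball x e" "y \<in> ball x e" using y \<open>0 < e\<close> by auto
      from lip[OF this] have "f (y + t *\<^sub>R v) - f y \<le> K * (t * norm v)" using t by simp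
      then show "(case (y, t) of (y, t) \<Rightarrow> ereal ((f (y + t *\<^sub>R v) - f y) / t)) \<le> ereal (K * norm v)"
        using t by (simp add: field_simps)
    qed
  qed
  moreover have "ereal (v \<bullet> v) \<le> clarke_dir_deriv f x v" using v unfolding clarke_subdiff_def by blast
  ultimately have "ereal (v \<bullet> v) \<le> ereal (K * norm v)" by (rule order_trans[rotated])
  then have "norm v * norm v \<le> K * norm v" by (simp add: power2_norm_eq_inner[symmetric] power2_eq_square)
  moreover have "0 \<le> K"
  proof (rule ccontr)
    assume "\<not> 0 \<le> K"
    obtain b :: 'a where b: "b \<in> Basis" using nonempty_Basis by blast
    have "x + (e/2) *\<^sub>R b \<in> ball x e" using \<open>0 < e\<close> b by (simp add: dist_norm)
    then have "\<bar>f (x + (e/2) *\<^sub>R b) - f x\<bar> \<le> K * (e/2)" using lip[of "x + (e/2) *\<^sub>R b" x] b \<open>0 < e\<close> by simp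
    moreover have "K * (e/2) < 0" using \<open>\<not> 0 \<le> K\<close> \<open>0 < e\<close> by (simp add: mult_neg_pos)
    ultimately show False by linarith
  qed
  ultimately show ?thesis by (cases "v = 0") auto
qed

text \<open>In the difference quotients of Clarke's directional derivative take the base point \<open>x - t d\<close>: the
  upper bound at this point makes the quotient at least \<open>v \<bullet> d - C * (norm d)\<^sup>2 * t\<close>.\<close>

lemma clarke_subdiffI_quadratic_upper_bound:
  fixes f :: "'a::euclidean_space \<Rightarrow> real"
  assumes "0 < \<delta>" and le: "\<And>y. norm (y - x) < \<delta> \<Longrightarrow> f y \<le> f x + v \<bullet> (y - x) + C * (norm (y - x))\<^sup>2"
  shows "v \<in> clarke_subdiff f x"
  unfolding clarke_subdiff_def
proof (intro CollectI allI, rule ccontr)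
  fix d assume "\<not> ereal (v \<bullet> d) \<le> clarke_dir_deriv f x d"
  then obtain z where z: "clarke_dir_deriv f x d < z" "z < ereal (v \<bullet> d)"
    using dense by (metis not_le)
  have "filterlim (\<lambda>t. (x - t *\<^sub>R d, t)) (nhds x \<times>\<^sub>F at_right 0) (at_right 0)"
  proof (rule filterlim_Pair)
    have "((\<lambda>t. x - t *\<^sub>R d) \<longlongrightarrow> x - 0 *\<^sub>R d) (at_right 0)" by (intro tendsto_intros)
    then show "filterlim (\<lambda>t. x - t *\<^sub>R d) (nhds x) (at_right 0)" by simp
  qed (rule filterlim_ident)
  from filterlim_iff[THEN iffD1, OF this, rule_format, OF Limsup_lessD[OF z(1)[unfolded clarke_dir_deriv_def]]]
  have ev: "\<forall>\<^sub>F t in at_right 0. ereal ((f x - f (x - t *\<^sub>R d)) / t) < z" by simp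
  have "((\<lambda>t. norm (x - t *\<^sub>R d - x)) \<longlongrightarrow> norm (x - 0 *\<^sub>R d - x)) (at_right 0)"
    by (intro tendsto_intros)
  then have ev2: "\<forall>\<^sub>F t in at_right 0. norm (x - t *\<^sub>R d - x) < \<delta>"
    using \<open>0 < \<delta>\<close> by (intro order_tendstoD) auto
  have "((\<lambda>t. ereal (v \<bullet> d - C * (norm d)\<^sup>2 * t)) \<longlongrightarrow> ereal (v \<bullet> d - C * (norm d)\<^sup>2 * 0)) (at_right 0)"
    by (intro tendsto_intros)
  then have lim: "((\<lambda>t. ereal (v \<bullet> d - C * (norm d)\<^sup>2 * t)) \<longlongrightarrow> ereal (v \<bullet> d)) (at_right 0)" by simp
  have "ereal (v \<bullet> d) \<le> z"
  proof (rule tendsto_upperbound[OF lim])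
    show "\<forall>\<^sub>F t in at_right 0. ereal (v \<bullet> d - C * (norm d)\<^sup>2 * t) \<le> z"
      using ev ev2 eventually_at_right_less[of 0]
    proof eventually_elim
      case (elim t)
      have "f (x - t *\<^sub>R d) \<le> f x - t * (v \<bullet> d) + C * (t\<^sup>2 * (norm d)\<^sup>2)"
        using le[OF elim(2)] elim(3) by (simp add: power_mult_distrib)
      then have "t * (v \<bullet> d - C * (norm d)\<^sup>2 * t) \<le> f x - f (x - t *\<^sub>R d)"
        by (simp add: algebra_simps power2_eq_square)
      then have "v \<bullet> d - C * (norm d)\<^sup>2 * t \<le> (f x - f (x - t *\<^sub>R d)) / t"
        using elim(3) by (simp add: field_simps)
      then show ?case using elim(1) by (meson ereal_less_eq(3) order_trans less_imp_le)
    qed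
  qed simp
  then show False using z(2) by simp
qed

text \<open>Finitely many neighborhoods with local moduli cover \<open>C\<close>. Two points closer than a Lebesgue number
  \<open>e\<close> of the cover share a neighborhood; for points further apart, the uniform bound on the function
  divided by \<open>e\<close> serves as a Lipschitz constant.\<close>

lemma compact_Lipschitz_modulus:
  fixes \<phi> :: "'x \<Rightarrow> 'a::euclidean_space \<Rightarrow> real"
  assumes "compact C" and loc: "\<And>p. loc_Lipschitz_sq_int M \<phi> p"
  shows "\<exists>K. square_integrable M K \<and> (\<forall>s. 0 \<le> K s) \<and>
    (\<forall>s\<in>space M. \<forall>y\<in>C. \<bar>\<phi> s y\<bar> \<le> K s \<and> (\<forall>z\<in>C. \<bar>\<phi> s y - \<phi> s z\<bar> \<le> K s * norm (y - z)))"
proof -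
  have "\<forall>p. \<exists>\<kappa> V. square_integrable M \<kappa> \<and> open V \<and> p \<in> V \<and>
      (\<forall>y\<in>V. \<forall>z\<in>V. \<forall>s\<in>space M. \<bar>\<phi> s y - \<phi> s z\<bar> \<le> \<kappa> s * norm (y - z))"
    using loc unfolding loc_Lipschitz_sq_int_def by blast
  then obtain \<kappa> V where \<kappa>: "\<And>p. square_integrable M (\<kappa> p)" and V: "\<And>p. open (V p)" "\<And>p. p \<in> V p"
    and lip: "\<And>p y z s. y \<in> V p \<Longrightarrow> z \<in> V p \<Longrightarrow> s \<in> space M \<Longrightarrow> \<bar>\<phi> s y - \<phi> s z\<bar> \<le> \<kappa> p s * norm (y - z)"
    by metis
  define W where "W p = V p \<inter> ball p 1" for p
  have W: "open (W p)" "p \<in> W p" for p using V unfolding W_def by auto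
  have "C \<subseteq> (\<Union>p\<in>C. W p)" using W(2) by blast
  then obtain P where P: "P \<subseteq> C" "finite P" "C \<subseteq> (\<Union>p\<in>P. W p)"
    by (rule compactE_image[OF \<open>compact C\<close> W(1)])
  obtain e where e: "0 < e" "\<And>x. x \<in> C \<Longrightarrow> \<exists>G\<in>W ` P. ball x e \<subseteq> G"
    using Heine_Borel_lemma[OF \<open>compact C\<close> P(3)] W(1) by blast
  define k where "k s = (\<Sum>p\<in>P. \<bar>\<kappa> p s\<bar>)" for s
  define g where "g s = (\<Sum>p\<in>P. \<bar>\<phi> s p\<bar> + \<bar>\<kappa> p s\<bar>)" for s
  define K where "K s = k s + (g s + 2 / e * g s)" for s
  have k0: "0 \<le> k s" "0 \<le> g s" for s unfolding k_def g_def by (auto intro!: sum_nonneg add_nonneg_nonneg)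
  have kp: "\<bar>\<kappa> p s\<bar> \<le> k s" if "p \<in> P" for p s
    unfolding k_def using P(2) that by (intro member_le_sum) auto
  have gp: "\<bar>\<phi> s p\<bar> + \<bar>\<kappa> p s\<bar> \<le> g s" if "p \<in> P" for p s
    unfolding g_def using P(2) that by (intro member_le_sum[of p P "\<lambda>p. \<bar>\<phi> s p\<bar> + \<bar>\<kappa> p s\<bar>"]) auto
  have bound: "\<bar>\<phi> s y\<bar> \<le> g s" if "s \<in> space M" "y \<in> C" for s y
  proof -
    obtain p where p: "p \<in> P" "y \<in> W p" using P(3) \<open>y \<in> C\<close> by blast
    have "\<bar>\<phi> s y - \<phi> s p\<bar> \<le> \<kappa> p s * norm (y - p)"
      using lip[of y p p s] p V that unfolding W_def by auto
    also have "\<dots> \<le> \<bar>\<kappa> p s\<bar> * 1"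
      using p(2) unfolding W_def by (intro mult_mono) (auto simp: dist_norm norm_minus_commute)
    finally show ?thesis using gp[OF p(1), of s] by linarith
  qed
  have "K s * norm (y - z) \<ge> \<bar>\<phi> s y - \<phi> s z\<bar>" if s: "s \<in> space M" and y: "y \<in> C" and z: "z \<in> C" for s y z
  proof (cases "norm (y - z) < e")
    case True
    obtain p where p: "p \<in> P" "ball y e \<subseteq> W p" using e(2)[OF y] by blast
    have "y \<in> W p" "z \<in> W p" using p(2) True \<open>0 < e\<close> by (auto simp: dist_norm)
    then have "\<bar>\<phi> s y - \<phi> s z\<bar> \<le> \<kappa> p s * norm (y - z)" unfolding W_def by (intro lip s) auto
    also have "\<dots> \<le> k s * norm (y - z)" using kp[OF p(1), of s] by (intro mult_right_mono) auto
    also have "\<dots> \<le> K s * norm (y - z)" unfolding K_def using k0[of s] e(1) by (intro mult_right_mono) auto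
    finally show ?thesis .
  next
    case False
    have "\<bar>\<phi> s y - \<phi> s z\<bar> \<le> 2 / e * g s * e" using bound[OF s y] bound[OF s z] e(1) by simp
    also have "\<dots> \<le> K s * norm (y - z)"
      unfolding K_def using False k0[of s] e(1) by (intro mult_mono) auto
    finally show ?thesis .
  qed
  moreover have "\<bar>\<phi> s y\<bar> \<le> K s" if "s \<in> space M" "y \<in> C" for s y
  proof -
    have "0 \<le> 2 / e * g s" using k0(2)[of s] e(1) by simp
    then show ?thesis using bound[OF that] k0(1)[of s] unfolding K_def by linarith
  qed
  moreover have "0 \<le> K s" for s unfolding K_def using k0[of s] e(1) by auto
  moreover have "square_integrable M K"
  proof -
    have "square_integrable M (\<lambda>s. \<phi> s p)" for p using loc[of p] unfolding loc_Lipschitz_sq_int_def by blast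
    then have "square_integrable M k" "square_integrable M g"
      unfolding k_def g_def using P(2) \<kappa>
      by (auto intro!: square_integrable_sum square_integrable_add square_integrable_abs)
    then show ?thesis unfolding K_def by (intro square_integrable_add square_integrable_cmult)
  qed
  ultimately show ?thesis by (intro exI[of _ K]) simp
qed

text \<open>The Lebesgue number of a finite subcover becomes the radius \<open>\<delta>\<close> within which one integrable modulus
  works. The second point ranges over a full ball, because trial points of the line search may leave
  \<open>C\<close>.\<close>

lemma compact_upper_C2_modulus:
  fixes \<phi> :: "'x \<Rightarrow> 'a::euclidean_space \<Rightarrow> real"
  assumes "compact C" and loc: "\<And>p. upper_C2_around M \<phi> p"
  shows "\<exists>l \<delta>. 0 < \<delta> \<and> integrable M l \<and> (\<forall>s\<in>space M. 0 \<le> l s) \<and>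
    (\<forall>s\<in>space M. \<forall>x\<in>C. \<forall>v\<in>clarke_subdiff (\<phi> s) x. \<forall>y. norm (y - x) < \<delta> \<longrightarrow>
       \<phi> s y \<le> \<phi> s x + v \<bullet> (y - x) + l s * (norm (y - x))\<^sup>2)"
proof -
  have "\<forall>p. \<exists>V l. open V \<and> p \<in> V \<and> integrable M l \<and> (\<forall>s\<in>space M. 0 \<le> l s) \<and>
        (\<forall>s\<in>space M. \<forall>x\<in>V. \<forall>v\<in>clarke_subdiff (\<phi> s) x. \<forall>y\<in>V.
           \<phi> s y \<le> \<phi> s x + v \<bullet> (y - x) + l s * (norm (y - x))\<^sup>2)"
    using loc unfolding upper_C2_around_def by blast
  then obtain V l where V: "\<And>p. open (V p)" "\<And>p. p \<in> V p"
    and l: "\<And>p. integrable M (l p)" "\<And>p s. s \<in> space M \<Longrightarrow> 0 \<le> l p s"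
    and ub: "\<And>p s x v y. s \<in> space M \<Longrightarrow> x \<in> V p \<Longrightarrow> v \<in> clarke_subdiff (\<phi> s) x \<Longrightarrow> y \<in> V p \<Longrightarrow>
           \<phi> s y \<le> \<phi> s x + v \<bullet> (y - x) + l p s * (norm (y - x))\<^sup>2"
    by metis
  have "C \<subseteq> (\<Union>p\<in>C. V p)" using V(2) by blast
  then obtain P where P: "P \<subseteq> C" "finite P" "C \<subseteq> (\<Union>p\<in>P. V p)"
    by (rule compactE_image[OF \<open>compact C\<close> V(1)])
  obtain e where e: "0 < e" "\<And>x. x \<in> C \<Longrightarrow> \<exists>G\<in>V ` P. ball x e \<subseteq> G"
    using Heine_Borel_lemma[OF \<open>compact C\<close> P(3)] V(1) by blast
  define L where "L s = (\<Sum>p\<in>P. l p s)" for s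
  have "integrable M L" unfolding L_def using l by auto
  moreover have "0 \<le> L s" if "s \<in> space M" for s unfolding L_def using l that by (auto intro: sum_nonneg)
  moreover have "\<phi> s y \<le> \<phi> s x + v \<bullet> (y - x) + L s * (norm (y - x))\<^sup>2"
    if s: "s \<in> space M" and x: "x \<in> C" and v: "v \<in> clarke_subdiff (\<phi> s) x" and y: "norm (y - x) < e" for s x v y
  proof -
    obtain p where p: "p \<in> P" "ball x e \<subseteq> V p" using e(2)[OF x] by blast
    have "x \<in> V p" "y \<in> V p" using p(2) y e(1) by (auto simp: dist_norm norm_minus_commute)
    then have "\<phi> s y \<le> \<phi> s x + v \<bullet> (y - x) + l p s * (norm (y - x))\<^sup>2" by (intro ub s v)
    moreover have "l p s \<le> L s" unfolding L_def using P(2) p(1) l s by (intro member_le_sum) auto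
    then have "l p s * (norm (y - x))\<^sup>2 \<le> L s * (norm (y - x))\<^sup>2" by (intro mult_right_mono) auto
    ultimately show ?thesis by linarith
  qed
  ultimately show ?thesis using e(1) by blast
qed

definition cube :: "nat \<Rightarrow> (real ^ 'd) set" where
  "cube R = {y. \<forall>i. \<bar>y $ i\<bar> \<le> real R}"

lemma compact_cube: "compact (cube R :: (real ^ 'd) set)"
proof -
  have "cube R = cbox (\<chi> i. - real R) (\<chi> i. real R :: real ^ 'd)"
  proof -
    have "\<bar>a\<bar> \<le> r \<longleftrightarrow> - r \<le> a \<and> a \<le> r" for a r :: real by linarith
    then show ?thesis unfolding cube_def by (simp add: mem_box_cart set_eq_iff)
  qed
  then show ?thesis by simp
qed

lemma cube_mono: "R \<le> S \<Longrightarrow> cube R \<subseteq> cube S"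
  unfolding cube_def by (auto intro: order_trans)

lemma mem_cubeI: "norm x \<le> real R \<Longrightarrow> x \<in> cube R"
  unfolding cube_def using component_le_norm_cart order_trans by blast

lemma mem_cube_Suc: "x \<in> cube R \<Longrightarrow> norm (y - x) \<le> 1 \<Longrightarrow> y \<in> cube (Suc R)"
  unfolding cube_def
proof (intro CollectI allI)
  fix i assume x: "x \<in> {y. \<forall>i. \<bar>y $ i\<bar> \<le> real R}" and d: "norm (y - x) \<le> 1"
  have "\<bar>(y - x) $ i\<bar> \<le> 1" using component_le_norm_cart[of "y - x" i] d by linarith
  moreover have "\<bar>x $ i\<bar> \<le> real R" using x by blast
  ultimately show "\<bar>y $ i\<bar> \<le> real (Suc R)" by simp
qed

lemma zero_mem_cube: "0 \<in> cube R"
  by (rule mem_cubeI) simp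

lemma sets_cube [measurable]: "cube R \<in> sets borel"
  by (intro borel_closed compact_imp_closed compact_cube)

text \<open>The points of the grid of mesh \<open>1 / m\<close>. Since \<open>R\<close> is an integer, rounding the coordinates down stays
  inside the cube. Only the polynomial growth of the cardinality in \<open>m\<close> matters later.\<close>

lemma cube_net:
  assumes "0 < m"
  shows "\<exists>Z. finite Z \<and> Z \<subseteq> cube R \<and> real (card Z) \<le> real (2 * m * R + 1) ^ CARD('d) \<and>
    (\<forall>y\<in>cube R. \<exists>z\<in>Z. norm (y - z :: real ^ 'd) \<le> real CARD('d) / real m)"
proof -
  define I where "I = {- int (m * R) .. int (m * R)}"
  define F where "F = (UNIV :: 'd set) \<rightarrow>\<^sub>E I"
  define z where "z a = (\<chi> i. real_of_int (a i) / real m :: real ^ 'd)" for a :: "'d \<Rightarrow> int"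
  have "finite I" unfolding I_def by simp
  then have "finite F" unfolding F_def by (intro finite_PiE) auto
  have "card F = (2 * m * R + 1) ^ CARD('d)"
    unfolding F_def by (simp add: card_PiE I_def nat_add_distrib nat_mult_distrib mult_ac)
  then have "card (z ` F) \<le> (2 * m * R + 1) ^ CARD('d)" using card_image_le[OF \<open>finite F\<close>, of z] by simp
  then have card: "real (card (z ` F)) \<le> real (2 * m * R + 1) ^ CARD('d)"
    by (metis of_nat_le_iff of_nat_power)
  have sub: "z ` F \<subseteq> cube R"
  proof
    fix y assume "y \<in> z ` F"
    then obtain a where a: "a \<in> F" "y = z a" by auto
    have "\<bar>y $ i\<bar> \<le> real R" for i
    proof -
      have "a i \<in> I" using a unfolding F_def by (auto simp: PiE_iff)
      then have "\<bar>a i\<bar> \<le> int (m * R)" unfolding I_def by auto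
      then have "\<bar>real_of_int (a i)\<bar> \<le> real (m * R)" by linarith
      then show ?thesis using a(2) \<open>0 < m\<close> by (simp add: z_def abs_div field_simps)
    qed
    then show "y \<in> cube R" unfolding cube_def by simp
  qed
  have near: "\<exists>w\<in>z ` F. norm (y - w) \<le> real CARD('d) / real m" if y: "y \<in> cube R" for y
  proof
    define a where "a i = \<lfloor>real m * y $ i\<rfloor>" for i
    have "a i \<in> I" for i
    proof -
      have "\<bar>y $ i\<bar> \<le> real R" using y unfolding cube_def by simp
      then have "\<bar>real m * y $ i\<bar> \<le> real (m * R)" by (simp add: abs_mult mult_left_mono)
      then have "- real (m * R) \<le> real m * y $ i" "real m * y $ i \<le> real (m * R)" by auto
      then show ?thesis unfolding I_def a_def
        by (auto simp: le_floor_iff floor_le_iff simp del: of_nat_mult)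
    qed
    then show "z a \<in> z ` F" unfolding F_def by (auto simp: PiE_iff)
    have "norm (y - z a) \<le> (\<Sum>i\<in>UNIV. \<bar>(y - z a) $ i\<bar>)" by (rule norm_le_l1_cart)
    also have "\<dots> \<le> (\<Sum>i\<in>(UNIV::'d set). 1 / real m)"
    proof (rule sum_mono)
      fix i
      have "\<bar>real m * y $ i - real_of_int (a i)\<bar> \<le> 1" unfolding a_def by linarith
      moreover have "(y - z a) $ i = (real m * y $ i - real_of_int (a i)) / real m"
        using \<open>0 < m\<close> by (simp add: z_def field_simps)
      ultimately show "\<bar>(y - z a) $ i\<bar> \<le> 1 / real m" using \<open>0 < m\<close> by (simp add: abs_div divide_right_mono)
    qed
    finally show "norm (y - z a) \<le> real CARD('d) / real m" by simp
  qed
  show ?thesis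
    by (intro exI[of _ "z ` F"] conjI ballI near card sub) (use \<open>finite F\<close> in simp)
qed

text \<open>Rounding \<open>y\<close> down to a grid leaves countably many values, so that the rounded function is measurable;
  by continuity it converges to \<open>\<phi>\<close> as the grid is refined.\<close>

lemma caratheodory_measurable:
  fixes \<phi> :: "'x \<Rightarrow> real ^ 'd \<Rightarrow> real"
  assumes [measurable]: "\<And>y. (\<lambda>s. \<phi> s y) \<in> borel_measurable M"
    and cont: "\<And>s. s \<in> space M \<Longrightarrow> continuous_on UNIV (\<phi> s)"
  shows "(\<lambda>(s, y). \<phi> s y) \<in> borel_measurable (M \<Otimes>\<^sub>M borel)"
proof -
  define a where "a m y = (\<lambda>i. \<lfloor>real (Suc m) * y $ i\<rfloor>)" for m and y :: "real ^ 'd"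
  define q where "q m b = (\<chi> i. real_of_int (b i) / real (Suc m) :: real ^ 'd)" for m and b :: "'d \<Rightarrow> int"
  have a [measurable]: "a m \<in> measurable borel (count_space UNIV)" for m
    unfolding measurable_count_space_eq_countable[OF countableI_type]
  proof (intro conjI ballI)
    fix b :: "'d \<Rightarrow> int"
    have "{y \<in> space borel :: (real ^ 'd) set. \<forall>i\<in>UNIV. \<lfloor>real (Suc m) * y $ i\<rfloor> = b i} \<in> sets borel"
    proof (intro sets.sets_Collect_finite_All)
      fix i
      have "{y :: real ^ 'd. \<lfloor>real (Suc m) * y $ i\<rfloor> = b i} =
          {y. real_of_int (b i) \<le> real (Suc m) * y $ i} \<inter> {y. real (Suc m) * y $ i < real_of_int (b i) + 1}"
        by (auto simp: floor_eq_iff)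
      moreover have "\<dots> \<in> sets borel"
        by (intro sets.Int borel_closed borel_open closed_Collect_le open_Collect_less continuous_intros)
      ultimately show "{y \<in> space borel :: (real ^ 'd) set. \<lfloor>real (Suc m) * y $ i\<rfloor> = b i} \<in> sets borel" by simp
    qed simp
    moreover have "a m -` {b} \<inter> space borel = {y :: real ^ 'd. \<forall>i\<in>UNIV. \<lfloor>real (Suc m) * y $ i\<rfloor> = b i}"
      unfolding a_def by (auto simp: fun_eq_iff)
    ultimately show "a m -` {b} \<inter> space borel \<in> sets borel" by simp
  qed simp
  have "(\<lambda>p. \<phi> (fst p) (snd p)) \<in> borel_measurable (M \<Otimes>\<^sub>M borel)"
  proof (rule borel_measurable_LIMSEQ_real)
    show "(\<lambda>p. \<phi> (fst p) (q m (a m (snd p)))) \<in> borel_measurable (M \<Otimes>\<^sub>M borel)" for m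
      by (rule measurable_compose_countable[where f = "\<lambda>b p. \<phi> (fst p) (q m b)" and g = "\<lambda>p. a m (snd p)",
            OF measurable_compose[OF measurable_fst assms(1)] measurable_compose[OF measurable_snd a]])
    fix p :: "'x \<times> (real ^ 'd)" assume "p \<in> space (M \<Otimes>\<^sub>M borel)"
    then have s: "fst p \<in> space M" by (auto simp: space_pair_measure)
    have "(\<lambda>m. q m (a m y)) \<longlonglongrightarrow> y" for y
    proof (rule vec_tendstoI)
      fix i
      show "(\<lambda>m. q m (a m y) $ i) \<longlonglongrightarrow> y $ i"
      proof (rule tendsto_sandwich)
        have le: "y $ i - 1 / real (Suc m) \<le> q m (a m y) $ i \<and> q m (a m y) $ i \<le> y $ i" for m
        proof -
          have "real (Suc m) * y $ i - 1 \<le> real_of_int \<lfloor>real (Suc m) * y $ i\<rfloor>"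
            "real_of_int \<lfloor>real (Suc m) * y $ i\<rfloor> \<le> real (Suc m) * y $ i" by linarith+
          then have "(real (Suc m) * y $ i - 1) / real (Suc m) \<le> q m (a m y) $ i"
            "q m (a m y) $ i \<le> (real (Suc m) * y $ i) / real (Suc m)"
            unfolding q_def a_def by (simp_all only: vec_lambda_beta divide_right_mono of_nat_0_le_iff)
          then show ?thesis by (simp add: diff_divide_distrib del: of_nat_Suc)
        qed
        show "\<forall>\<^sub>F m in sequentially. y $ i - 1 / real (Suc m) \<le> q m (a m y) $ i"
          "\<forall>\<^sub>F m in sequentially. q m (a m y) $ i \<le> y $ i" using le by auto
        have "(\<lambda>m. y $ i - 1 / real (Suc m)) \<longlonglongrightarrow> y $ i - 0"
          by (intro tendsto_diff tendsto_const LIMSEQ_Suc[OF lim_1_over_n])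
        then show "(\<lambda>m. y $ i - 1 / real (Suc m)) \<longlonglongrightarrow> y $ i" by simp
      qed simp
    qed
    then show "(\<lambda>m. \<phi> (fst p) (q m (a m (snd p)))) \<longlonglongrightarrow> \<phi> (fst p) (snd p)"
      by (intro continuous_on_tendsto_compose[OF cont[OF s]]) auto
  qed
  then show ?thesis unfolding case_prod_beta' .
qed

section \<open>Uniform rate for sample means\<close>

lemma powr_le_tangent_at_1:
  fixes r \<beta> :: real
  assumes "0 < r" "0 \<le> \<beta>" "\<beta> \<le> 1"
  shows "r powr \<beta> \<le> 1 - \<beta> * (1 - r)"
  using Youngs_inequality_0[of \<beta> "1 - \<beta>" r 1] assms by (simp add: algebra_simps)

text \<open>With \<open>r = n k / n (k + 1)\<close>, the tangent bound gives \<open>1 - r \<le> (1 - r powr \<beta>) / \<beta>\<close>, which makes each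
  term at most a difference of consecutive values of \<open>n k powr (- \<beta>) / \<beta>\<close>.\<close>

lemma summable_batch_weights:
  fixes n :: "nat \<Rightarrow> nat"
  assumes "mono n" and pos: "\<And>k. 0 < n k" and \<beta>: "0 < \<beta>" "\<beta> \<le> 1"
  shows "summable (\<lambda>k. (1 - real (n k) / real (n (Suc k))) * real (n k) powr (- \<beta>))"
proof (rule summableI_nonneg_bounded)
  have le: "n k \<le> n (Suc k)" for k using \<open>mono n\<close> by (simp add: monoD)
  show "0 \<le> (1 - real (n k) / real (n (Suc k))) * real (n k) powr (- \<beta>)" for k
    using le[of k] pos[of "Suc k"] by simp
  have term_le: "(1 - real (n k) / real (n (Suc k))) * real (n k) powr (- \<beta>)
      \<le> real (n k) powr (- \<beta>) / \<beta> - real (n (Suc k)) powr (- \<beta>) / \<beta>" for k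
  proof -
    define r where "r = real (n k) / real (n (Suc k))"
    have r: "0 < r" unfolding r_def using pos by simp
    have "\<beta> * (1 - r) \<le> 1 - r powr \<beta>" using powr_le_tangent_at_1[OF r, of \<beta>] \<beta> by simp
    then have "\<beta> * (1 - r) * real (n k) powr (- \<beta>) \<le> (1 - r powr \<beta>) * real (n k) powr (- \<beta>)"
      by (intro mult_right_mono) auto
    also have "\<dots> = real (n k) powr (- \<beta>) - real (n (Suc k)) powr (- \<beta>)"
      unfolding r_def using pos[of k] pos[of "Suc k"]
      by (simp add: powr_divide powr_minus field_simps)
    finally show ?thesis using \<beta>(1) unfolding r_def by (simp add: field_simps)
  qed
  fix m
  have "(\<Sum>k<m. (1 - real (n k) / real (n (Suc k))) * real (n k) powr (- \<beta>))
      \<le> (\<Sum>k<m. real (n k) powr (- \<beta>) / \<beta> - real (n (Suc k)) powr (- \<beta>) / \<beta>)"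
    by (rule sum_mono) (rule term_le)
  also have "\<dots> = real (n 0) powr (- \<beta>) / \<beta> - real (n m) powr (- \<beta>) / \<beta>"
    by (rule sum_lessThan_telescope')
  also have "\<dots> \<le> real (n 0) powr (- \<beta>) / \<beta>" using \<beta> by simp
  finally show "(\<Sum>k<m. (1 - real (n k) / real (n (Suc k))) * real (n k) powr (- \<beta>))
      \<le> real (n 0) powr (- \<beta>) / \<beta>" .
qed

lemma AE_summable_of_summable_integrals:
  fixes f :: "nat \<Rightarrow> 'a \<Rightarrow> real"
  assumes int: "\<And>k. integrable M (f k)" and nonneg: "\<And>k \<omega>. 0 \<le> f k \<omega>"
    and sum: "summable (\<lambda>k. \<integral>\<omega>. f k \<omega> \<partial>M)"
  shows "AE \<omega> in M. summable (\<lambda>k. f k \<omega>)"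
proof -
  have [measurable]: "f k \<in> borel_measurable M" for k using int by auto
  have "(\<integral>\<^sup>+\<omega>. (\<Sum>k. ennreal (f k \<omega>)) \<partial>M) = (\<Sum>k. \<integral>\<^sup>+\<omega>. ennreal (f k \<omega>) \<partial>M)"
    by (rule nn_integral_suminf) measurable
  also have "\<dots> = (\<Sum>k. ennreal (\<integral>\<omega>. f k \<omega> \<partial>M))"
    using int nonneg by (simp add: nn_integral_eq_integral)
  also have "\<dots> = ennreal (\<Sum>k. \<integral>\<omega>. f k \<omega> \<partial>M)"
    by (rule suminf_ennreal2) (use nonneg sum in \<open>auto intro: integral_nonneg_AE\<close>)
  finally have "(\<integral>\<^sup>+\<omega>. (\<Sum>k. ennreal (f k \<omega>)) \<partial>M) \<noteq> \<infinity>" by simp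
  then have "AE \<omega> in M. (\<Sum>k. ennreal (f k \<omega>)) \<noteq> \<infinity>"
    by (intro nn_integral_noteq_infinite) auto
  then show ?thesis
    by eventually_elim (use nonneg in \<open>auto intro: summable_suminf_not_top\<close>)
qed

locale iid_integrand = prob_space P
  for P :: "'w measure" +
  fixes \<mu> :: "'x measure" and \<xi> :: "nat \<Rightarrow> 'w \<Rightarrow> 'x" and \<phi> :: "'x \<Rightarrow> real ^ 'd \<Rightarrow> real"
  assumes prob_mu: "prob_space \<mu>"
    and indep: "indep_vars (\<lambda>_. \<mu>) \<xi> {1..}"
    and law: "\<And>i. 1 \<le> i \<Longrightarrow> distr P \<mu> (\<xi> i) = \<mu>"
    and loc_Lipschitz: "\<And>p. loc_Lipschitz_sq_int \<mu> \<phi> p"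

sublocale iid_integrand \<subseteq> mu: prob_space \<mu> by (rule prob_mu)

context iid_integrand
begin

lemma xi_measurable: "1 \<le> i \<Longrightarrow> \<xi> i \<in> measurable P \<mu>"
  using indep unfolding indep_vars_def by auto

lemma integral_xi: "1 \<le> i \<Longrightarrow> f \<in> borel_measurable \<mu> \<Longrightarrow> (\<integral>\<omega>. f (\<xi> i \<omega>) \<partial>P) = (\<integral>s. f s \<partial>\<mu>)"
  for f :: "'x \<Rightarrow> real"
  using integral_distr[OF xi_measurable, of i f] law[of i] by simp

lemma integrable_xi: "1 \<le> i \<Longrightarrow> integrable \<mu> f \<Longrightarrow> integrable P (\<lambda>\<omega>. f (\<xi> i \<omega>))"
  for f :: "'x \<Rightarrow> real"
  using integrable_distr[OF xi_measurable, of i f] law[of i] by simp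

text \<open>Pairwise uncorrelated centered variables: only the diagonal of the expanded square survives.\<close>

lemma mean_deviation:
  fixes h :: "'x \<Rightarrow> real"
  assumes h: "square_integrable \<mu> h" and J: "finite J" "J \<noteq> {}" "J \<subseteq> {1..}"
  defines "Z \<equiv> \<lambda>\<omega>. (\<Sum>j\<in>J. h (\<xi> j \<omega>)) / real (card J) - (\<integral>s. h s \<partial>\<mu>)"
  shows "integrable P (\<lambda>\<omega>. (Z \<omega>)\<^sup>2)" and "(\<integral>\<omega>. (Z \<omega>)\<^sup>2 \<partial>P) \<le> (\<integral>s. (h s)\<^sup>2 \<partial>\<mu>) / real (card J)"
proof -
  define c where "c = (\<integral>s. h s \<partial>\<mu>)"
  define g where "g s = h s - c" for s
  have hi: "integrable \<mu> h" by (rule mu.square_integrable_imp_integrable[OF h])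
  have h2: "integrable \<mu> (\<lambda>s. (h s)\<^sup>2)" using h unfolding square_integrable_def by simp
  have [measurable]: "g \<in> borel_measurable \<mu>" unfolding g_def using hi by auto
  have g2: "integrable \<mu> (\<lambda>s. (g s)\<^sup>2)"
    unfolding g_def power2_diff using hi h2
    by (intro Bochner_Integration.integrable_add Bochner_Integration.integrable_diff) auto
  have gi: "integrable \<mu> g" unfolding g_def using hi by auto
  have g0: "(\<integral>s. g s \<partial>\<mu>) = 0" unfolding g_def using hi by (simp add: c_def mu.prob_space)
  have gvar: "(\<integral>s. (g s)\<^sup>2 \<partial>\<mu>) \<le> (\<integral>s. (h s)\<^sup>2 \<partial>\<mu>)"
    using mu.variance_eq[OF hi h2] unfolding g_def c_def by simp
  have prod_int: "integrable P (\<lambda>\<omega>. g (\<xi> i \<omega>) * g (\<xi> j \<omega>))" if "i \<in> J" "j \<in> J" for i j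
  proof (rule integrable_mult_of_squares)
    have ij: "1 \<le> i" "1 \<le> j" using that J by auto
    show "integrable P (\<lambda>\<omega>. (g (\<xi> i \<omega>))\<^sup>2)" "integrable P (\<lambda>\<omega>. (g (\<xi> j \<omega>))\<^sup>2)"
      using integrable_xi[OF ij(1) g2] integrable_xi[OF ij(2) g2] .
    show "(\<lambda>\<omega>. g (\<xi> i \<omega>)) \<in> borel_measurable P" "(\<lambda>\<omega>. g (\<xi> j \<omega>)) \<in> borel_measurable P"
      using integrable_xi[OF ij(1) gi] integrable_xi[OF ij(2) gi] by auto
  qed
  have orth: "(\<integral>\<omega>. g (\<xi> i \<omega>) * g (\<xi> j \<omega>) \<partial>P) = (if i = j then (\<integral>s. (g s)\<^sup>2 \<partial>\<mu>) else 0)"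
    if "i \<in> J" "j \<in> J" for i j
  proof (cases "i = j")
    case True
    then show ?thesis using integral_xi[of j "\<lambda>s. (g s)\<^sup>2"] that J by (auto simp: power2_eq_square)
  next
    case False
    have ij: "1 \<le> i" "1 \<le> j" using that J by auto
    have "indep_vars (\<lambda>_. borel) (\<lambda>i \<omega>. g (\<xi> i \<omega>)) {i, j}"
      by (rule indep_vars_compose2[OF indep_vars_subset[OF indep]]) (use ij in auto)
    then have "(\<integral>\<omega>. (\<Prod>k\<in>{i, j}. g (\<xi> k \<omega>)) \<partial>P) = (\<Prod>k\<in>{i, j}. \<integral>\<omega>. g (\<xi> k \<omega>) \<partial>P)"
      by (rule indep_vars_lebesgue_integral[rotated]) (use integrable_xi[OF _ gi] ij in auto)
    then show ?thesis using False integral_xi[of i g] integral_xi[of j g] ij g0 by simp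
  qed
  have N: "0 < real (card J)" using J by (simp add: card_gt_0_iff)
  have Z: "Z \<omega> = (\<Sum>j\<in>J. g (\<xi> j \<omega>)) / real (card J)" for \<omega>
    using N unfolding Z_def g_def c_def[symmetric] by (simp add: sum_subtractf field_simps)
  have Z2: "(Z \<omega>)\<^sup>2 = (\<Sum>i\<in>J. \<Sum>j\<in>J. g (\<xi> i \<omega>) * g (\<xi> j \<omega>)) / (real (card J))\<^sup>2" for \<omega>
    unfolding Z by (simp add: power_divide power2_eq_square sum_product)
  show "integrable P (\<lambda>\<omega>. (Z \<omega>)\<^sup>2)"
    unfolding Z2 using prod_int by (intro integrable_divide Bochner_Integration.integrable_sum) auto
  have "(\<integral>\<omega>. (Z \<omega>)\<^sup>2 \<partial>P) = (\<Sum>i\<in>J. \<Sum>j\<in>J. \<integral>\<omega>. g (\<xi> i \<omega>) * g (\<xi> j \<omega>) \<partial>P) / (real (card J))\<^sup>2"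
    unfolding Z2 using prod_int by (simp add: Bochner_Integration.integral_sum)
  also have "(\<Sum>i\<in>J. \<Sum>j\<in>J. \<integral>\<omega>. g (\<xi> i \<omega>) * g (\<xi> j \<omega>) \<partial>P) = real (card J) * (\<integral>s. (g s)\<^sup>2 \<partial>\<mu>)"
    using J(1) by (simp add: orth sum.delta)
  also have "\<dots> / (real (card J))\<^sup>2 = (\<integral>s. (g s)\<^sup>2 \<partial>\<mu>) / real (card J)"
    using N by (simp add: power2_eq_square)
  also have "\<dots> \<le> (\<integral>s. (h s)\<^sup>2 \<partial>\<mu>) / real (card J)" using gvar N by (intro divide_right_mono) auto
  finally show "(\<integral>\<omega>. (Z \<omega>)\<^sup>2 \<partial>P) \<le> (\<integral>s. (h s)\<^sup>2 \<partial>\<mu>) / real (card J)" .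
qed

text \<open>One modulus per cube, so that the rate and the law of large numbers below speak about the same
  function; it bounds both the values and the Lipschitz constants.\<close>

definition modulus :: "nat \<Rightarrow> 'x \<Rightarrow> real" where
  "modulus R = (SOME K. square_integrable \<mu> K \<and> (\<forall>s. 0 \<le> K s) \<and>
    (\<forall>s\<in>space \<mu>. \<forall>y\<in>cube R. \<bar>\<phi> s y\<bar> \<le> K s \<and> (\<forall>z\<in>cube R. \<bar>\<phi> s y - \<phi> s z\<bar> \<le> K s * norm (y - z))))"

lemma modulus:
  shows square_integrable_modulus: "square_integrable \<mu> (modulus R)"
    and modulus_nonneg: "0 \<le> modulus R s"
    and abs_le_modulus: "s \<in> space \<mu> \<Longrightarrow> y \<in> cube R \<Longrightarrow> \<bar>\<phi> s y\<bar> \<le> modulus R s"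
    and modulus_Lipschitz: "s \<in> space \<mu> \<Longrightarrow> y \<in> cube R \<Longrightarrow> z \<in> cube R \<Longrightarrow>
      \<bar>\<phi> s y - \<phi> s z\<bar> \<le> modulus R s * norm (y - z)"
  using someI_ex[OF compact_Lipschitz_modulus[OF compact_cube[of R], of \<mu> \<phi>, OF loc_Lipschitz]]
  unfolding modulus_def[symmetric] by blast+

lemma integrable_modulus: "integrable \<mu> (modulus R)"
  by (rule mu.square_integrable_imp_integrable[OF square_integrable_modulus])

abbreviation mean_modulus :: "nat \<Rightarrow> real" where
  "mean_modulus R \<equiv> (\<integral>s. modulus R s \<partial>\<mu>)"

lemma mean_modulus_nonneg: "0 \<le> mean_modulus R"
  by (rule integral_nonneg_AE) (simp add: modulus_nonneg)

abbreviation E :: "real ^ 'd \<Rightarrow> real" where "E \<equiv> expect_fun \<mu> \<phi>"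

lemma square_integrable_phi: "square_integrable \<mu> (\<lambda>s. \<phi> s y)"
  using loc_Lipschitz[of y] unfolding loc_Lipschitz_sq_int_def by blast

lemma phi_measurable: "(\<lambda>s. \<phi> s y) \<in> borel_measurable \<mu>"
  using square_integrable_phi[of y] unfolding square_integrable_def by blast

lemma integrable_phi: "integrable \<mu> (\<lambda>s. \<phi> s y)"
  by (rule mu.square_integrable_imp_integrable[OF square_integrable_phi])

lemma E_Lipschitz:
  assumes "y \<in> cube R" "z \<in> cube R"
  shows "\<bar>E y - E z\<bar> \<le> mean_modulus R * norm (y - z)"
proof -
  have "\<bar>\<integral>s. \<phi> s y - \<phi> s z \<partial>\<mu>\<bar> \<le> (\<integral>s. \<bar>\<phi> s y - \<phi> s z\<bar> \<partial>\<mu>)" by (rule integral_abs_bound)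
  also have "\<dots> \<le> (\<integral>s. modulus R s * norm (y - z) \<partial>\<mu>)"
    by (rule integral_mono) (use integrable_phi integrable_modulus modulus_Lipschitz assms in auto)
  finally show ?thesis using integrable_phi unfolding expect_fun_def by simp
qed

lemma continuous_of_Lipschitz_on_cubes:
  fixes f :: "real ^ 'd \<Rightarrow> real"
  assumes "\<And>R y z. y \<in> cube R \<Longrightarrow> z \<in> cube R \<Longrightarrow> \<bar>f y - f z\<bar> \<le> c R * norm (y - z)"
  shows "continuous_on UNIV f"
  unfolding continuous_on_eq_continuous_at[OF open_UNIV]
proof
  fix x :: "real ^ 'd"
  define R where "R = nat \<lceil>norm x\<rceil>"
  have x: "x \<in> cube R" unfolding R_def by (rule mem_cubeI) linarith
  have xs: "x \<in> cube (Suc R)" using x cube_mono[of R "Suc R"] by auto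
  have "(f \<longlongrightarrow> f x) (at x)"
  proof (rule metric_tendsto_imp_tendsto)
    have "((\<lambda>y. c (Suc R) * norm (y - x)) \<longlongrightarrow> c (Suc R) * norm (x - x)) (at x)" by (intro tendsto_intros)
    then show "((\<lambda>y. c (Suc R) * norm (y - x)) \<longlongrightarrow> 0) (at x)" by simp
    show "\<forall>\<^sub>F y in at x. dist (f y) (f x) \<le> dist (c (Suc R) * norm (y - x)) 0"
    proof (rule eventually_at_topological[THEN iffD2], intro exI conjI ballI impI)
      show "open (ball x 1)" "x \<in> ball x 1" by auto
      fix y assume "y \<in> ball x 1"
      then have "y \<in> cube (Suc R)" by (intro mem_cube_Suc[OF x]) (simp add: dist_norm norm_minus_commute)
      from assms[OF this xs] show "dist (f y) (f x) \<le> dist (c (Suc R) * norm (y - x)) 0"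
        by (simp add: dist_real_def)
    qed
  qed
  then show "isCont f x" by (simp add: isCont_def)
qed

lemma continuous_E: "continuous_on UNIV E"
  using E_Lipschitz by (rule continuous_of_Lipschitz_on_cubes)

lemma jointly_measurable: "(\<lambda>(s, y). \<phi> s y) \<in> borel_measurable (\<mu> \<Otimes>\<^sub>M borel)"
  using phi_measurable modulus_Lipschitz
  by (intro caratheodory_measurable continuous_of_Lipschitz_on_cubes) auto

definition dev :: "nat set \<Rightarrow> 'w \<Rightarrow> real ^ 'd \<Rightarrow> real" where
  "dev J \<omega> y = (\<Sum>j\<in>J. \<phi> (\<xi> j \<omega>) y) / real (card J) - E y"

definition dominates_dev :: "nat \<Rightarrow> nat set \<Rightarrow> ('w \<Rightarrow> real) \<Rightarrow> bool" where
  "dominates_dev R J W \<longleftrightarrow>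
     integrable P W \<and> (\<forall>\<omega>\<in>space P. \<forall>y\<in>cube R. (dev J \<omega> y)\<^sup>2 \<le> W \<omega>)"

text \<open>A grid of mesh \<open>1 / m\<close> replaces the supremum over the cube by a maximum over about \<open>m\<^sup>d\<close> points, at
  the cost of a Lipschitz error of order \<open>1 / m\<close>. Bounding the square of the maximum by the sum of the
  squares gives a second moment of order \<open>m\<^sup>d / N + 1 / m\<^sup>2\<close> for \<open>N\<close> samples, and \<open>m\<close> of order
  \<open>N powr (1 / (d + 2))\<close> balances the two terms. An explicit integrable \<open>W\<close> dominates the supremum,
  which avoids measurability questions.\<close>

lemma uniform_deviation_rate:
  "\<exists>C\<ge>0. \<forall>J. finite J \<longrightarrow> J \<noteq> {} \<longrightarrow> J \<subseteq> {1..} \<longrightarrow>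
    (\<exists>W. dominates_dev R J W \<and>
      (\<integral>\<omega>. W \<omega> \<partial>P) \<le> C * real (card J) powr (- (2 / real (CARD('d) + 2))))"
proof -
  let ?d = "CARD('d)"
  define a where "a = 1 / real (?d + 2)"
  define q where "q = (\<integral>s. (modulus R s)\<^sup>2 \<partial>\<mu>)"
  define k0 where "k0 = mean_modulus R"
  define c1 where "c1 = (6 * real (R + 1)) ^ ?d"
  define C where "C = 2 * (c1 * q) + 2 * ((real ?d)\<^sup>2 * (2 * q + 8 * k0\<^sup>2))"
  have q0: "0 \<le> q" unfolding q_def by (rule integral_nonneg_AE) auto
  have k00: "0 \<le> k0" unfolding k0_def by (rule mean_modulus_nonneg)
  have c10: "0 \<le> c1" unfolding c1_def by simp
  have C0: "0 \<le> C" unfolding C_def using q0 c10 by simp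
  show ?thesis
  proof (intro exI[of _ C] conjI C0 allI impI)
    fix J :: "nat set" assume J: "finite J" "J \<noteq> {}" "J \<subseteq> {1..}"
    define N where "N = real (card J)"
    have N1: "1 \<le> N" unfolding N_def using J by (simp add: Suc_leI card_gt_0_iff)
\<comment> \<open>The mesh that balances the grid size against the Lipschitz error.\<close>
    define m where "m = nat \<lceil>N powr a\<rceil>"
    have Na1: "1 \<le> N powr a" using N1 unfolding a_def by (simp add: ge_one_powr_ge_zero)
    have m1: "N powr a \<le> real m" unfolding m_def by linarith
    have m2: "real m \<le> 2 * N powr a" unfolding m_def using Na1 by linarith
    have m0: "0 < m" using m1 Na1 by linarith
    obtain Z where Z: "finite Z" "Z \<subseteq> (cube R :: (real ^ 'd) set)" "real (card Z) \<le> real (2 * m * R + 1) ^ ?d"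
      and net: "\<And>y. y \<in> cube R \<Longrightarrow> \<exists>z\<in>Z. norm (y - z) \<le> real ?d / real m"
      using cube_net[OF m0, of R] by blast
    define A where "A \<omega> = (\<Sum>j\<in>J. modulus R (\<xi> j \<omega>)) / N - k0" for \<omega>
    have A2: "integrable P (\<lambda>\<omega>. (A \<omega>)\<^sup>2)" "(\<integral>\<omega>. (A \<omega>)\<^sup>2 \<partial>P) \<le> q / N"
      using mean_deviation[OF square_integrable_modulus[of R] J] unfolding A_def N_def k0_def q_def by auto
    have D2: "integrable P (\<lambda>\<omega>. (dev J \<omega> z)\<^sup>2)" "(\<integral>\<omega>. (dev J \<omega> z)\<^sup>2 \<partial>P) \<le> q / N" if "z \<in> Z" for z
    proof -
      have "(\<integral>s. (\<phi> s z)\<^sup>2 \<partial>\<mu>) \<le> q"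
        unfolding q_def
      proof (rule integral_mono)
        fix s assume "s \<in> space \<mu>"
        then have "\<bar>\<phi> s z\<bar> \<le> \<bar>modulus R s\<bar>" using abs_le_modulus[of s z R] that Z(2) by fastforce
        then show "(\<phi> s z)\<^sup>2 \<le> (modulus R s)\<^sup>2" by (simp add: abs_le_square_iff)
      qed (use square_integrable_modulus[of R] square_integrable_phi[of z] in \<open>auto simp: square_integrable_def\<close>)
      then have "(\<integral>s. (\<phi> s z)\<^sup>2 \<partial>\<mu>) / N \<le> q / N" using N1 by (intro divide_right_mono) auto
      then show "integrable P (\<lambda>\<omega>. (dev J \<omega> z)\<^sup>2)" "(\<integral>\<omega>. (dev J \<omega> z)\<^sup>2 \<partial>P) \<le> q / N"
        using mean_deviation[OF square_integrable_phi[of z] J] unfolding dev_def N_def expect_fun_def by auto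
    qed
    define W where "W \<omega> = 2 * (\<Sum>z\<in>Z. (dev J \<omega> z)\<^sup>2) + 2 * ((real ?d / real m)\<^sup>2 * (2 * (A \<omega>)\<^sup>2 + 8 * k0\<^sup>2))" for \<omega>
    have W_int: "integrable P W"
      unfolding W_def using A2(1) D2(1) by auto
    have "(\<integral>\<omega>. W \<omega> \<partial>P) = 2 * (\<Sum>z\<in>Z. \<integral>\<omega>. (dev J \<omega> z)\<^sup>2 \<partial>P)
        + 2 * ((real ?d / real m)\<^sup>2 * (2 * (\<integral>\<omega>. (A \<omega>)\<^sup>2 \<partial>P) + 8 * k0\<^sup>2))"
      unfolding W_def using A2(1) D2(1) by (simp add: Bochner_Integration.integral_sum prob_space)
    also have "\<dots> \<le> 2 * (c1 * q * N powr (- 2 * a)) + 2 * ((real ?d)\<^sup>2 * N powr (- 2 * a) * (2 * q + 8 * k0\<^sup>2))"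
    proof (intro add_mono mult_left_mono)
      have "(\<Sum>z\<in>Z. \<integral>\<omega>. (dev J \<omega> z)\<^sup>2 \<partial>P) \<le> (\<Sum>z\<in>Z. q / N)" by (rule sum_mono) (rule D2(2))
      also have "\<dots> = real (card Z) * (q / N)" by simp
      also have "\<dots> \<le> (6 * real (R + 1) * N powr a) ^ ?d * (q / N)"
      proof (intro mult_right_mono order_trans[OF Z(3)] power_mono)
        have "real (2 * m * R + 1) \<le> 3 * real m * real (R + 1)"
        proof -
          have "2 * m * R + 1 \<le> 3 * m * (R + 1)" using m0 by (simp add: algebra_simps)
          then have "real (2 * m * R + 1) \<le> real (3 * m * (R + 1))" by (rule of_nat_mono)
          then show ?thesis by (simp only: of_nat_mult of_nat_numeral)
        qed
        also have "\<dots> \<le> 3 * (2 * N powr a) * real (R + 1)" using m2 by (intro mult_right_mono mult_left_mono) auto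
        finally show "real (2 * m * R + 1) \<le> 6 * real (R + 1) * N powr a" by (simp add: algebra_simps)
      qed (use q0 N1 in auto)
      also have "\<dots> = c1 * q * ((N powr a) ^ ?d / N)" unfolding c1_def by (simp add: power_mult_distrib)
      also have "(N powr a) ^ ?d / N = N powr (- 2 * a)"
      proof -
        have "(N powr a) ^ ?d = N powr (a * real ?d)"
          using N1 by (simp add: powr_realpow[symmetric] powr_powr)
        moreover have "a * real ?d = 1 + - 2 * a" unfolding a_def by (simp add: field_simps)
        ultimately show ?thesis using N1 by (simp only: powr_add) simp
      qed
      finally show "(\<Sum>z\<in>Z. \<integral>\<omega>. (dev J \<omega> z)\<^sup>2 \<partial>P) \<le> c1 * q * N powr (- 2 * a)" .
      have "(N powr a)\<^sup>2 \<le> (real m)\<^sup>2" using m1 by (intro power_mono) auto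
      moreover have "(N powr a)\<^sup>2 = N powr (2 * a)" using N1 by (simp add: power2_eq_square powr_add[symmetric])
      ultimately have "1 / (real m)\<^sup>2 \<le> N powr (- 2 * a)"
        using N1 m0 by (simp add: powr_minus field_simps)
      then have "(real ?d)\<^sup>2 * (1 / (real m)\<^sup>2) \<le> (real ?d)\<^sup>2 * N powr (- 2 * a)" by (intro mult_left_mono) auto
      then have dm: "(real ?d / real m)\<^sup>2 \<le> (real ?d)\<^sup>2 * N powr (- 2 * a)" by (simp add: power_divide)
      have "q / N \<le> q" using q0 N1 mult_left_mono[of 1 N q] by (simp add: divide_le_eq)
      then have "2 * (\<integral>\<omega>. (A \<omega>)\<^sup>2 \<partial>P) + 8 * k0\<^sup>2 \<le> 2 * q + 8 * k0\<^sup>2" using A2(2) by simp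
      then show "(real ?d / real m)\<^sup>2 * (2 * (\<integral>\<omega>. (A \<omega>)\<^sup>2 \<partial>P) + 8 * k0\<^sup>2)
         \<le> (real ?d)\<^sup>2 * N powr (- 2 * a) * (2 * q + 8 * k0\<^sup>2)"
        by (intro mult_mono dm) (auto intro!: add_nonneg_nonneg integral_nonneg_AE)
    qed auto
    also have "\<dots> = C * N powr (- 2 * a)" unfolding C_def by (simp add: algebra_simps)
    finally have W_le: "(\<integral>\<omega>. W \<omega> \<partial>P) \<le> C * N powr (- 2 * a)" .
    have dom: "(dev J \<omega> y)\<^sup>2 \<le> W \<omega>" if w: "\<omega> \<in> space P" and y: "y \<in> cube R" for \<omega> y
    proof -
      obtain z where z: "z \<in> Z" "norm (y - z) \<le> real ?d / real m" using net[OF y] by blast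
      have zR: "z \<in> cube R" using z Z by auto
      have xs: "\<xi> j \<omega> \<in> space \<mu>" if "j \<in> J" for j
        using that J(3) measurable_space[OF xi_measurable w] by auto
      have "\<bar>(\<Sum>j\<in>J. \<phi> (\<xi> j \<omega>) y) - (\<Sum>j\<in>J. \<phi> (\<xi> j \<omega>) z)\<bar> \<le> (\<Sum>j\<in>J. \<bar>\<phi> (\<xi> j \<omega>) y - \<phi> (\<xi> j \<omega>) z\<bar>)"
        unfolding sum_subtractf[symmetric] by (rule sum_abs)
      also have "\<dots> \<le> (\<Sum>j\<in>J. modulus R (\<xi> j \<omega>) * norm (y - z))"
        by (intro sum_mono modulus_Lipschitz xs y zR)
      also have "\<dots> = N * (A \<omega> + k0) * norm (y - z)"
        using N1 unfolding A_def by (simp add: sum_distrib_right)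
      finally have "\<bar>(\<Sum>j\<in>J. \<phi> (\<xi> j \<omega>) y) / N - (\<Sum>j\<in>J. \<phi> (\<xi> j \<omega>) z) / N\<bar> \<le> (A \<omega> + k0) * norm (y - z)"
        using N1 by (simp add: diff_divide_distrib[symmetric] abs_div field_simps)
      moreover have "\<bar>E y - E z\<bar> \<le> k0 * norm (y - z)" unfolding k0_def by (rule E_Lipschitz[OF y zR])
      ultimately have "\<bar>dev J \<omega> y - dev J \<omega> z\<bar> \<le> (A \<omega> + 2 * k0) * norm (y - z)"
        unfolding dev_def N_def[symmetric] by (simp add: algebra_simps)
      also have "\<dots> \<le> \<bar>A \<omega> + 2 * k0\<bar> * (real ?d / real m)" using z(2) by (intro mult_mono) auto
      finally have "\<bar>dev J \<omega> y\<bar> \<le> \<bar>dev J \<omega> z\<bar> + \<bar>A \<omega> + 2 * k0\<bar> * (real ?d / real m)" by linarith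
      then have "(dev J \<omega> y)\<^sup>2 \<le> (\<bar>dev J \<omega> z\<bar> + \<bar>A \<omega> + 2 * k0\<bar> * (real ?d / real m))\<^sup>2"
        using abs_le_square_iff[of "dev J \<omega> y" "\<bar>dev J \<omega> z\<bar> + \<bar>A \<omega> + 2 * k0\<bar> * (real ?d / real m)"] by simp
      also have "\<dots> \<le> 2 * (dev J \<omega> z)\<^sup>2 + 2 * ((real ?d / real m)\<^sup>2 * (A \<omega> + 2 * k0)\<^sup>2)"
      proof -
        have sq: "(u + v)\<^sup>2 \<le> 2 * u\<^sup>2 + 2 * v\<^sup>2" for u v :: real
          using sum_squares_bound[of u v] by (simp add: power2_sum)
        show ?thesis
          using sq[of "\<bar>dev J \<omega> z\<bar>" "\<bar>A \<omega> + 2 * k0\<bar> * (real ?d / real m)"]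
          unfolding power_mult_distrib power2_abs by (simp only: mult.commute)
      qed
      also have "\<dots> \<le> 2 * (\<Sum>z\<in>Z. (dev J \<omega> z)\<^sup>2) + 2 * ((real ?d / real m)\<^sup>2 * (2 * (A \<omega>)\<^sup>2 + 8 * k0\<^sup>2))"
      proof (intro add_mono mult_left_mono)
        show "(dev J \<omega> z)\<^sup>2 \<le> (\<Sum>z\<in>Z. (dev J \<omega> z)\<^sup>2)" using z(1) Z(1) by (intro member_le_sum) auto
        show "(A \<omega> + 2 * k0)\<^sup>2 \<le> 2 * (A \<omega>)\<^sup>2 + 8 * k0\<^sup>2"
          using sum_squares_bound[of "A \<omega>" "2 * k0"] by (simp add: power2_sum power_mult_distrib)
      qed auto
      finally show ?thesis unfolding W_def .
    qed
    show "\<exists>W. dominates_dev R J W \<and> (\<integral>\<omega>. W \<omega> \<partial>P) \<le> C * real (card J) powr (- (2 / real (?d + 2)))"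
      using W_int dom W_le unfolding dominates_dev_def N_def a_def by (intro exI[of _ W]) simp
  qed
qed

end

section \<open>Changing the sample between iterations\<close>

context iid_integrand
begin

text \<open>By independence the joint law of \<open>\<xi> j\<close> and of the whole information \<open>\<F>\<close> is a product. Integrating
  over the sample first, with the point \<open>X\<close> frozen, gives \<open>E (X) - E (X)\<close>.\<close>

lemma integral_independent_sample:
  assumes sub: "subalgebra P \<F>" and j: "1 \<le> j"
    and ind: "indep_set {\<xi> j -` A \<inter> space P | A. A \<in> sets \<mu>} (sets \<F>)"
    and X: "X \<in> borel_measurable \<F>" and A: "A \<in> sets \<F>"
  shows "integrable P (\<lambda>\<omega>. indicator A \<omega> * indicator (cube R) (X \<omega>) * (\<phi> (\<xi> j \<omega>) (X \<omega>) - E (X \<omega>)))"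
    and "(\<integral>\<omega>. indicator A \<omega> * indicator (cube R) (X \<omega>) * (\<phi> (\<xi> j \<omega>) (X \<omega>) - E (X \<omega>)) \<partial>P) = 0"
proof -
  have sp: "space \<F> = space P" and sets_sub: "sets \<F> \<subseteq> sets P" using sub unfolding subalgebra_def by auto
  have id: "(\<lambda>\<omega>. \<omega>) \<in> measurable P \<F>"
    using sub unfolding measurable_def subalgebra_def by auto
  have xm [measurable]: "\<xi> j \<in> measurable P \<mu>" by (rule xi_measurable[OF j])
  have pm: "(\<lambda>\<omega>. (\<xi> j \<omega>, \<omega>)) \<in> measurable P (\<mu> \<Otimes>\<^sub>M \<F>)" using xm id by (rule measurable_Pair)
  define Q where "Q = distr P \<F> (\<lambda>\<omega>. \<omega>)"
  interpret Q: prob_space Q unfolding Q_def by (rule prob_space_distr[OF id])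
  interpret pair: pair_prob_space \<mu> Q ..
  have setsQ [measurable_cong]: "sets Q = sets \<F>" unfolding Q_def by simp
  have joint: "\<mu> \<Otimes>\<^sub>M Q = distr P (\<mu> \<Otimes>\<^sub>M \<F>) (\<lambda>\<omega>. (\<xi> j \<omega>, \<omega>))"
  proof (rule pair_measure_eqI)
    show "sigma_finite_measure \<mu>" "sigma_finite_measure Q"
      by (rule mu.sigma_finite_measure_axioms, rule Q.sigma_finite_measure_axioms)
    show "sets (\<mu> \<Otimes>\<^sub>M Q) = sets (distr P (\<mu> \<Otimes>\<^sub>M \<F>) (\<lambda>\<omega>. (\<xi> j \<omega>, \<omega>)))"
      using sets_pair_measure_cong[OF refl setsQ] by simp
    fix B C assume B: "B \<in> sets \<mu>" and "C \<in> sets Q"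
    then have C: "C \<in> sets \<F>" using setsQ by simp
    have CP: "C \<inter> space P = C" "C \<in> sets P" using C sets_sub sets.sets_into_space[of C P] by auto
    have "emeasure \<mu> B = emeasure P (\<xi> j -` B \<inter> space P)"
      using emeasure_distr[OF xm B] law[OF j] by simp
    moreover have "emeasure Q C = emeasure P C"
      unfolding Q_def using emeasure_distr[OF id C] CP by simp
    moreover have "emeasure (distr P (\<mu> \<Otimes>\<^sub>M \<F>) (\<lambda>\<omega>. (\<xi> j \<omega>, \<omega>))) (B \<times> C)
        = emeasure P ((\<xi> j -` B \<inter> space P) \<inter> C)"
      using emeasure_distr[OF pm pair_measureI[OF B C]] by (simp add: vimage_def Int_def conj_ac)
    moreover have "prob ((\<xi> j -` B \<inter> space P) \<inter> C) = prob (\<xi> j -` B \<inter> space P) * prob C"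
      by (rule indep_setD[OF ind]) (use B C in auto)
    ultimately show "emeasure \<mu> B * emeasure Q C = emeasure (distr P (\<mu> \<Otimes>\<^sub>M \<F>) (\<lambda>\<omega>. (\<xi> j \<omega>, \<omega>))) (B \<times> C)"
      by (simp add: emeasure_eq_measure ennreal_mult)
  qed
  define g where "g = (\<lambda>(s, \<omega>). indicator A \<omega> * indicator (cube R) (X \<omega>) * (\<phi> s (X \<omega>) - E (X \<omega>)))"
  have [measurable]: "X \<in> borel_measurable \<F>" "A \<in> sets \<F>" "E \<in> borel_measurable borel"
    using X A borel_measurable_continuous_onI[OF continuous_E] by auto
  have phi_X: "(\<lambda>p. \<phi> (fst p) (X (snd p))) \<in> borel_measurable (\<mu> \<Otimes>\<^sub>M \<F>)"
  proof -
    have "(\<lambda>p. (fst p, X (snd p))) \<in> measurable (\<mu> \<Otimes>\<^sub>M \<F>) (\<mu> \<Otimes>\<^sub>M borel)" by measurable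
    from measurable_compose[OF this jointly_measurable] show ?thesis by simp
  qed
  have g_m: "g \<in> borel_measurable (\<mu> \<Otimes>\<^sub>M \<F>)"
    unfolding g_def case_prod_beta' using phi_X by measurable
  have sets_pair: "sets (\<mu> \<Otimes>\<^sub>M Q) = sets (\<mu> \<Otimes>\<^sub>M \<F>)" by (rule sets_pair_measure_cong[OF refl setsQ])
  have g_Q: "g \<in> borel_measurable (\<mu> \<Otimes>\<^sub>M Q)" using g_m measurable_cong_sets[OF sets_pair refl] by auto
  have spQ: "space Q = space P" unfolding Q_def using sp by simp
  have g_int: "integrable (\<mu> \<Otimes>\<^sub>M Q) g"
  proof (rule Bochner_Integration.integrable_bound)
    show "integrable (\<mu> \<Otimes>\<^sub>M Q) (\<lambda>(s, \<omega>). modulus R s + mean_modulus R)"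
    proof -
      have "integrable \<mu> (\<lambda>s. modulus R s + mean_modulus R)" using integrable_modulus by simp
      then have "integrable (distr (\<mu> \<Otimes>\<^sub>M Q) \<mu> fst) (\<lambda>s. modulus R s + mean_modulus R)"
        unfolding Q.distr_pair_fst .
      from integrable_distr[OF measurable_fst this] show ?thesis by (simp add: case_prod_beta')
    qed
    show "AE p in \<mu> \<Otimes>\<^sub>M Q. norm (g p) \<le> norm (case p of (s, \<omega>) \<Rightarrow> modulus R s + mean_modulus R)"
    proof (rule AE_I2, clarify)
      fix s \<omega> assume "(s, \<omega>) \<in> space (\<mu> \<Otimes>\<^sub>M Q)"
      then have s: "s \<in> space \<mu>" by (auto simp: space_pair_measure)
      have "\<bar>\<phi> s (X \<omega>) - E (X \<omega>)\<bar> \<le> modulus R s + mean_modulus R" if "X \<omega> \<in> cube R"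
      proof -
        have "\<bar>E (X \<omega>)\<bar> \<le> (\<integral>s. \<bar>\<phi> s (X \<omega>)\<bar> \<partial>\<mu>)" unfolding expect_fun_def by (rule integral_abs_bound)
        also have "\<dots> \<le> mean_modulus R"
          by (rule integral_mono) (use integrable_phi integrable_modulus abs_le_modulus that in auto)
        finally show ?thesis using abs_le_modulus[OF s that] by linarith
      qed
      then show "norm (g (s, \<omega>)) \<le> norm (modulus R s + mean_modulus R)"
        using modulus_nonneg[of R s] mean_modulus_nonneg[of R] unfolding g_def
        by (auto simp: indicator_def abs_mult)
    qed
  qed (rule g_Q)

  have "integrable P (\<lambda>\<omega>. g (\<xi> j \<omega>, \<omega>))"
    by (rule integrable_distr[OF pm]) (use g_int joint in simp)
  then show "integrable P (\<lambda>\<omega>. indicator A \<omega> * indicator (cube R) (X \<omega>) * (\<phi> (\<xi> j \<omega>) (X \<omega>) - E (X \<omega>)))"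
    unfolding g_def by simp
  have "(\<integral>\<omega>. g (\<xi> j \<omega>, \<omega>) \<partial>P) = integral\<^sup>L (\<mu> \<Otimes>\<^sub>M Q) g"
    unfolding joint by (rule integral_distr[symmetric, OF pm g_m])
  also have "\<dots> = (\<integral>\<omega>. (\<integral>s. g (s, \<omega>) \<partial>\<mu>) \<partial>Q)"
    using pair.integral_snd[of "\<lambda>s \<omega>. g (s, \<omega>)"] g_int by simp
  also have "\<dots> = (\<integral>\<omega>. 0 \<partial>Q)"
  proof (rule Bochner_Integration.integral_cong[OF refl])
    fix \<omega>
    show "(\<integral>s. g (s, \<omega>) \<partial>\<mu>) = 0"
      unfolding g_def using integrable_phi by (simp add: expect_fun_def mu.prob_space)
  qed
  finally show "(\<integral>\<omega>. indicator A \<omega> * indicator (cube R) (X \<omega>) * (\<phi> (\<xi> j \<omega>) (X \<omega>) - E (X \<omega>)) \<partial>P) = 0"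
    unfolding g_def by simp
qed

end

text \<open>Here \<open>X k\<close> is the point produced in iteration \<open>k\<close>, that is the iterate with index \<open>k + 1\<close>; it is
  known at time \<open>k\<close>.\<close>

locale adapted_sampling = iid_integrand P \<mu> \<xi> \<phi>
  for P :: "'w measure" and \<mu> :: "'x measure" and \<xi> and \<phi> :: "'x \<Rightarrow> real ^ 'd \<Rightarrow> real" +
  fixes n :: "nat \<Rightarrow> nat" and \<F> :: "nat \<Rightarrow> 'w measure" and X :: "nat \<Rightarrow> 'w \<Rightarrow> real ^ 'd"
  assumes mono_n: "mono n" and n_pos: "\<And>k. 0 < n k"
    and filt: "filtration (space P) \<F>" and subalg: "\<And>k. subalgebra P (\<F> k)"
    and X_adapted: "\<And>k. X k \<in> borel_measurable (\<F> k)"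
    and past: "\<And>k j. 1 \<le> j \<Longrightarrow> j \<le> n k \<Longrightarrow> \<xi> j \<in> measurable (\<F> k) \<mu>"
    and future: "\<And>k j. n k < j \<Longrightarrow> indep_set {\<xi> j -` A \<inter> space P | A. A \<in> sets \<mu>} (sets (\<F> k))"
begin

abbreviation avg :: "nat \<Rightarrow> 'w \<Rightarrow> real ^ 'd \<Rightarrow> real" where
  "avg k \<omega> \<equiv> sample_avg (n k) (\<lambda>j. \<phi> (\<xi> j \<omega>))"

definition weight :: "nat \<Rightarrow> real" where
  "weight k = 1 - real (n k) / real (n (Suc k))"

definition batch :: "nat \<Rightarrow> nat set" where
  "batch k = {n k <.. n (Suc k)}"

lemma n_le_Suc: "n k \<le> n (Suc k)"
  using mono_n by (simp add: monoD)

lemma weight_bounds: "0 \<le> weight k" "weight k \<le> 1"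
  using n_le_Suc[of k] n_pos[of "Suc k"] unfolding weight_def by simp_all

lemma weight_eq: "weight k = real (card (batch k)) / real (n (Suc k))"
  using n_le_Suc[of k] n_pos[of "Suc k"] unfolding weight_def batch_def by (simp add: of_nat_diff field_simps)

lemma dev_prefix: "dev {1..n k} \<omega> y = avg k \<omega> y - E y"
  unfolding dev_def sample_avg_def by simp

text \<open>Both averages are recentered at \<open>E\<close>, and the old and the new samples separated.\<close>

lemma avg_increment:
  "avg (Suc k) \<omega> y - avg k \<omega> y = weight k * dev (batch k) \<omega> y - weight k * dev {1..n k} \<omega> y"
proof -
  let ?S = "\<lambda>J. \<Sum>j\<in>J. \<phi> (\<xi> j \<omega>) y"
  have N: "0 < real (n (Suc k))" "0 < real (n k)" using n_pos by auto
  have "{1..n (Suc k)} = {1..n k} \<union> batch k" "{1..n k} \<inter> batch k = {}"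
    using n_le_Suc[of k] unfolding batch_def by auto
  then have S: "?S {1..n (Suc k)} = ?S {1..n k} + ?S (batch k)"
    by (simp add: sum.union_disjoint batch_def)
  have W: "weight k * dev (batch k) \<omega> y = ?S (batch k) / real (n (Suc k)) - weight k * E y"
  proof (cases "card (batch k) = 0")
    case True
    then have "batch k = {}" unfolding batch_def by (simp add: card_eq_0_iff)
    then show ?thesis by (simp add: weight_eq)
  next
    case False
    then show ?thesis using N unfolding weight_eq dev_def by (simp add: field_simps)
  qed
  have "weight k * avg k \<omega> y = avg k \<omega> y - ?S {1..n k} / real (n (Suc k))"
    using N unfolding weight_def sample_avg_def by (simp add: field_simps)
  moreover have "avg (Suc k) \<omega> y = ?S {1..n k} / real (n (Suc k)) + ?S (batch k) / real (n (Suc k))"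
    unfolding sample_avg_def S by (simp add: add_divide_distrib)
  ultimately show ?thesis unfolding W dev_prefix right_diff_distrib by linarith
qed

text \<open>The two terms of a resampling error, switched off when the iterate leaves the cube. The switch is
  \<open>\<F> k\<close>-measurable and therefore preserves the martingale property.\<close>

definition drift :: "nat \<Rightarrow> nat \<Rightarrow> 'w \<Rightarrow> real" where
  "drift R k \<omega> = weight k * (indicator (cube R) (X k \<omega>) * dev {1..n k} \<omega> (X k \<omega>))"

definition fluctuation :: "nat \<Rightarrow> nat \<Rightarrow> 'w \<Rightarrow> real" where
  "fluctuation R k \<omega> = weight k * (indicator (cube R) (X k \<omega>) * dev (batch k) \<omega> (X k \<omega>))"

lemma rate_bounds: "0 < (2 / real (CARD('d) + 2))" "(2 / real (CARD('d) + 2)) \<le> 1" "0 < (2 / real (CARD('d) + 2)) / 2" "(2 / real (CARD('d) + 2)) / 2 \<le> 1"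
  by (auto simp: field_simps)

text \<open>If \<open>W\<close> dominates the squared deviation \<open>D\<^sup>2\<close>, then \<open>\<bar>D\<bar> \<le> n powr (- b) + n powr b * W\<close>; choose \<open>b\<close> as half
  the exponent of the rate. This is linear in \<open>W\<close>, and both terms have expectation of order
  \<open>n powr (- b)\<close>, so that the batch weights make them summable.\<close>

lemma drift_summable: "AE \<omega> in P. summable (\<lambda>k. drift R k \<omega>)"
proof -
  obtain C where C: "0 \<le> C" and W: "\<forall>J. finite J \<longrightarrow> J \<noteq> {} \<longrightarrow> J \<subseteq> {1..} \<longrightarrow>
    (\<exists>W. dominates_dev R J W \<and>
      (\<integral>\<omega>. W \<omega> \<partial>P) \<le> C * real (card J) powr (- (2 / real (CARD('d) + 2))))"
    using uniform_deviation_rate[of R] by blast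
  have "\<exists>W. dominates_dev R {1..n k} W \<and>
      (\<integral>\<omega>. W \<omega> \<partial>P) \<le> C * real (n k) powr (- (2 / real (CARD('d) + 2)))" for k
    using W[rule_format, of "{1..n k}"] n_pos[of k] by (simp add: Suc_le_eq)
  then obtain W where W: "\<And>k. dominates_dev R {1..n k} (W k)"
    and W_le: "\<And>k. (\<integral>\<omega>. W k \<omega> \<partial>P) \<le> C * real (n k) powr (- (2 / real (CARD('d) + 2)))"
    by metis
  then have W_int: "\<And>k. integrable P (W k)"
    and W_dom: "\<And>k \<omega> y. \<omega> \<in> space P \<Longrightarrow> y \<in> cube R \<Longrightarrow> (dev {1..n k} \<omega> y)\<^sup>2 \<le> W k \<omega>"
    unfolding dominates_dev_def by blast+
  define b where "b = (2 / real (CARD('d) + 2)) / 2"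
  have b: "0 < b" "b \<le> 1" unfolding b_def by (rule rate_bounds)+
  have rb: "2 / real (CARD('d) + 2) = 2 * b"
  proof -
    have "x = 2 * (x / 2)" for x :: real by simp
    then show ?thesis unfolding b_def .
  qed
  have sum_w: "summable (\<lambda>k. weight k * real (n k) powr (- b))"
    unfolding weight_def by (rule summable_batch_weights[OF mono_n n_pos b])
  have AE: "AE \<omega> in P. summable (\<lambda>k. weight k * real (n k) powr b * \<bar>W k \<omega>\<bar>)"
  proof (rule AE_summable_of_summable_integrals)
    show "integrable P (\<lambda>\<omega>. weight k * real (n k) powr b * \<bar>W k \<omega>\<bar>)" for k using W_int by simp
    show "0 \<le> weight k * real (n k) powr b * \<bar>W k \<omega>\<bar>" for k \<omega> using weight_bounds by simp
    show "summable (\<lambda>k. \<integral>\<omega>. weight k * real (n k) powr b * \<bar>W k \<omega>\<bar> \<partial>P)"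
    proof (rule summable_comparison_test'[OF summable_mult[OF sum_w, of C]])
      fix k
      have "(\<integral>\<omega>. \<bar>W k \<omega>\<bar> \<partial>P) = (\<integral>\<omega>. W k \<omega> \<partial>P)"
      proof (rule Bochner_Integration.integral_cong[OF refl])
        fix \<omega> assume "\<omega> \<in> space P"
        then have "0 \<le> W k \<omega>"
          by (rule order_trans[OF zero_le_power2 W_dom[OF _ zero_mem_cube]])
        then show "\<bar>W k \<omega>\<bar> = W k \<omega>" by simp
      qed
      then have "(\<integral>\<omega>. \<bar>W k \<omega>\<bar> \<partial>P) \<le> C * real (n k) powr (- (2 / real (CARD('d) + 2)))" using W_le[of k] by simp
      then have "weight k * real (n k) powr b * (\<integral>\<omega>. \<bar>W k \<omega>\<bar> \<partial>P)
          \<le> weight k * real (n k) powr b * (C * real (n k) powr (- (2 / real (CARD('d) + 2))))"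
        using weight_bounds by (intro mult_left_mono) auto
      also have "\<dots> = C * (weight k * (real (n k) powr b * real (n k) powr (- (2 / real (CARD('d) + 2)))))" by simp
      also have "real (n k) powr b * real (n k) powr (- (2 / real (CARD('d) + 2))) = real (n k) powr (- b)"
        unfolding rb powr_add[symmetric] by simp
      finally show "norm (\<integral>\<omega>. weight k * real (n k) powr b * \<bar>W k \<omega>\<bar> \<partial>P) \<le> C * (weight k * real (n k) powr (- b))"
        using weight_bounds[of k] by (simp add: abs_mult)
    qed
  qed
  show ?thesis using AE AE_space
  proof eventually_elim
    case (elim \<omega>)
    show ?case
    proof (rule summable_comparison_test'[OF summable_add[OF sum_w elim(1)]])
      fix k
      let ?D = "\<bar>indicator (cube R) (X k \<omega>) * dev {1..n k} \<omega> (X k \<omega>)\<bar>" and ?p = "real (n k) powr b"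
      have D2: "?D\<^sup>2 \<le> \<bar>W k \<omega>\<bar>"
        using W_dom[OF elim(2), of "X k \<omega>" k] by (auto simp: indicator_def)
      have p: "0 < ?p" using n_pos[of k] by simp
      have "?D \<le> 1 / ?p + ?p * ?D\<^sup>2"
      proof -
        have "0 \<le> (1 - ?p * ?D)\<^sup>2" by simp
        then have "2 * (?p * ?D) \<le> 1 + (?p * ?D)\<^sup>2" by (simp only: power2_diff) simp
        moreover have "0 \<le> ?p * ?D" by simp
        ultimately have "?p * ?D \<le> 1 + ?p\<^sup>2 * ?D\<^sup>2" by (simp only: power_mult_distrib)
        then have "?p * ?D \<le> ?p * (1 / ?p + ?p * ?D\<^sup>2)" using p by (simp add: distrib_left power2_eq_square mult_ac)
        then show ?thesis using p by (simp only: mult_le_cancel_left_pos)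
      qed
      also have "\<dots> \<le> real (n k) powr (- b) + ?p * \<bar>W k \<omega>\<bar>"
        using D2 p by (intro add_mono mult_left_mono) (auto simp: powr_minus field_simps)
      finally have "weight k * ?D \<le> weight k * (real (n k) powr (- b) + ?p * \<bar>W k \<omega>\<bar>)"
        using weight_bounds by (intro mult_left_mono) auto
      then show "norm (drift R k \<omega>) \<le> weight k * real (n k) powr (- b) + weight k * real (n k) powr b * \<bar>W k \<omega>\<bar>"
        unfolding drift_def using weight_bounds[of k] by (simp add: abs_mult algebra_simps)
    qed
  qed
qed

lemma \<F>_mono: "i \<le> j \<Longrightarrow> sets (\<F> i) \<subseteq> sets (\<F> j)"
  by (rule filtration.sets_F_mono[OF filt])

lemma space_\<F>: "space (\<F> k) = space P"
  by (rule filtration.space_F[OF filt])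

lemma fluctuation_adapted: "fluctuation R k \<in> borel_measurable (\<F> (Suc k))"
proof -
  have X' [measurable]: "X k \<in> borel_measurable (\<F> (Suc k))"
    using X_adapted[of k] \<F>_mono[of k "Suc k"] unfolding measurable_def by (auto simp: space_\<F>)
  have [measurable]: "E \<in> borel_measurable borel"
    by (rule borel_measurable_continuous_onI[OF continuous_E])
  have "(\<lambda>\<omega>. \<phi> (\<xi> j \<omega>) (X k \<omega>)) \<in> borel_measurable (\<F> (Suc k))" if "j \<in> batch k" for j
  proof -
    have "\<xi> j \<in> measurable (\<F> (Suc k)) \<mu>" using that by (intro past) (auto simp: batch_def)
    from measurable_compose[OF measurable_Pair[OF this X'] jointly_measurable] show ?thesis by simp
  qed
  then have "(\<lambda>\<omega>. \<Sum>j\<in>batch k. \<phi> (\<xi> j \<omega>) (X k \<omega>)) \<in> borel_measurable (\<F> (Suc k))"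
    by (rule borel_measurable_sum)
  then show ?thesis unfolding fluctuation_def[abs_def] dev_def by measurable
qed

lemma fluctuation_centered:
  assumes A: "A \<in> sets (\<F> k)"
  shows "(\<integral>\<omega>. indicator A \<omega> * fluctuation R k \<omega> \<partial>P) = 0"
proof (cases "batch k = {}")
  case True
  then show ?thesis unfolding fluctuation_def weight_eq by simp
next
  case False
  have N: "0 < real (card (batch k))" using False by (simp add: card_gt_0_iff batch_def)
  let ?g = "\<lambda>j \<omega>. indicator A \<omega> * indicator (cube R) (X k \<omega>) * (\<phi> (\<xi> j \<omega>) (X k \<omega>) - E (X k \<omega>))"
  have g: "integrable P (?g j)" "(\<integral>\<omega>. ?g j \<omega> \<partial>P) = 0" if "j \<in> batch k" for j
  proof -
    have j: "1 \<le> j" "n k < j" using that by (auto simp: batch_def)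
    show "integrable P (?g j)" "(\<integral>\<omega>. ?g j \<omega> \<partial>P) = 0"
      using integral_independent_sample[OF subalg j(1) future[OF j(2)] X_adapted A] by blast+
  qed
  have "indicator A \<omega> * fluctuation R k \<omega> = weight k / real (card (batch k)) * (\<Sum>j\<in>batch k. ?g j \<omega>)" for \<omega>
    using N unfolding fluctuation_def dev_def
    by (simp add: sum_distrib_left[symmetric] sum_subtractf field_simps)
  then show ?thesis using g by (simp add: Bochner_Integration.integral_sum)
qed

text \<open>Let \<open>r\<close> be the exponent of the uniform rate. A batch of \<open>c\<close> samples has weight \<open>w = c / N\<close>, and up to a
  constant its second moment is at most \<open>w\<^sup>2 * c powr (- r)\<close>. Because \<open>c \<le> N\<close> and \<open>r \<le> 1\<close>, one factor
  satisfies \<open>w * c powr (- r) \<le> N powr (- r)\<close>, and what remains is a term of the batch-weight series.\<close>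

lemma fluctuation_second_moment:
  shows "integrable P (\<lambda>\<omega>. (fluctuation R k \<omega>)\<^sup>2)"
    and "summable (\<lambda>k. \<integral>\<omega>. (fluctuation R k \<omega>)\<^sup>2 \<partial>P)"
proof -
  obtain C where C: "0 \<le> C" and W: "\<forall>J. finite J \<longrightarrow> J \<noteq> {} \<longrightarrow> J \<subseteq> {1..} \<longrightarrow>
    (\<exists>W. dominates_dev R J W \<and>
      (\<integral>\<omega>. W \<omega> \<partial>P) \<le> C * real (card J) powr (- (2 / real (CARD('d) + 2))))"
    using uniform_deviation_rate[of R] by blast
  have fm: "fluctuation R k \<in> borel_measurable P" for k
    using measurable_from_subalg[OF subalg fluctuation_adapted] .
  have main: "integrable P (\<lambda>\<omega>. (fluctuation R k \<omega>)\<^sup>2) \<and>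
    (\<integral>\<omega>. (fluctuation R k \<omega>)\<^sup>2 \<partial>P) \<le> C * (weight k * real (n k) powr (- (2 / real (CARD('d) + 2))))" for k
  proof (cases "batch k = {}")
    case True
    then have "weight k = 0" unfolding weight_eq by simp
    then show ?thesis unfolding fluctuation_def by simp
  next
    case False
    define c where "c = real (card (batch k))"
    have c: "1 \<le> c" using False unfolding c_def by (simp add: Suc_leI card_gt_0_iff batch_def)
    have "finite (batch k)" "batch k \<subseteq> {1..}" unfolding batch_def by auto
    from W[rule_format, OF this(1) False this(2)] obtain V where V: "integrable P V"
      "\<And>\<omega> y. \<omega> \<in> space P \<Longrightarrow> y \<in> cube R \<Longrightarrow> (dev (batch k) \<omega> y)\<^sup>2 \<le> V \<omega>"
      "(\<integral>\<omega>. V \<omega> \<partial>P) \<le> C * c powr (- (2 / real (CARD('d) + 2)))" unfolding c_def dominates_dev_def by auto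
    have dom: "(fluctuation R k \<omega>)\<^sup>2 \<le> (weight k)\<^sup>2 * V \<omega>" if "\<omega> \<in> space P" for \<omega>
    proof -
      have "0 \<le> V \<omega>" by (rule order_trans[OF zero_le_power2 V(2)[OF that zero_mem_cube]])
      then have "(indicator (cube R) (X k \<omega>) * dev (batch k) \<omega> (X k \<omega>))\<^sup>2 \<le> V \<omega>"
        using V(2)[OF that, of "X k \<omega>"] by (auto simp: indicator_def)
      then show ?thesis unfolding fluctuation_def power_mult_distrib[of "weight k"] by (intro mult_left_mono) auto
    qed
    have int: "integrable P (\<lambda>\<omega>. (fluctuation R k \<omega>)\<^sup>2)"
    proof (rule Bochner_Integration.integrable_bound)
      show "integrable P (\<lambda>\<omega>. (weight k)\<^sup>2 * V \<omega>)" using V(1) by simp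
      show "AE \<omega> in P. norm ((fluctuation R k \<omega>)\<^sup>2) \<le> norm ((weight k)\<^sup>2 * V \<omega>)"
        using dom by (intro AE_I2) (metis abs_of_nonneg order_trans real_norm_def zero_le_power2)
    qed (use fm in measurable)
    have "(\<integral>\<omega>. (fluctuation R k \<omega>)\<^sup>2 \<partial>P) \<le> (\<integral>\<omega>. (weight k)\<^sup>2 * V \<omega> \<partial>P)"
      by (rule integral_mono[OF int]) (use V(1) dom in auto)
    also have "\<dots> \<le> (weight k)\<^sup>2 * (C * c powr (- (2 / real (CARD('d) + 2))))"
      using V(3) by (simp add: mult_left_mono)
    also have "\<dots> = C * weight k * (weight k * c powr (- (2 / real (CARD('d) + 2))))" by (simp add: power2_eq_square)
    also have "\<dots> \<le> C * weight k * real (n k) powr (- (2 / real (CARD('d) + 2)))"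
    proof (rule mult_left_mono)
      let ?N = "real (n (Suc k))"
      have N: "0 < ?N" "real (n k) \<le> ?N" "0 < real (n k)" using n_pos n_le_Suc[of k] by auto
      have cN: "c \<le> ?N" unfolding c_def batch_def by simp
      have "weight k * c powr (- (2 / real (CARD('d) + 2))) = c powr (1 - (2 / real (CARD('d) + 2))) / ?N"
        using c N(1) unfolding weight_eq c_def[symmetric] by (simp only: powr_diff powr_minus) (simp add: field_simps)
      also have "\<dots> \<le> ?N powr (1 - (2 / real (CARD('d) + 2))) / ?N"
        using c cN rate_bounds N by (intro divide_right_mono powr_mono2) auto
      also have "\<dots> = ?N powr (- (2 / real (CARD('d) + 2)))" using N(1) by (simp only: powr_diff powr_minus) (simp add: field_simps)
      also have "\<dots> \<le> real (n k) powr (- (2 / real (CARD('d) + 2)))"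
        using N rate_bounds by (intro powr_mono2') auto
      finally show "weight k * c powr (- (2 / real (CARD('d) + 2))) \<le> real (n k) powr (- (2 / real (CARD('d) + 2)))" .
    qed (use C weight_bounds in auto)
    finally show ?thesis using int by (simp add: mult.assoc)
  qed
  show "integrable P (\<lambda>\<omega>. (fluctuation R k \<omega>)\<^sup>2)" using main by blast
  have sum_w: "summable (\<lambda>k. weight k * real (n k) powr (- (2 / real (CARD('d) + 2))))"
    unfolding weight_def by (rule summable_batch_weights[OF mono_n n_pos rate_bounds(1,2)])
  show "summable (\<lambda>k. \<integral>\<omega>. (fluctuation R k \<omega>)\<^sup>2 \<partial>P)"
  proof (rule summable_comparison_test'[OF summable_mult[OF sum_w, of C]])
    fix k
    have "0 \<le> (\<integral>\<omega>. (fluctuation R k \<omega>)\<^sup>2 \<partial>P)" by (rule integral_nonneg_AE) auto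
    then show "norm (\<integral>\<omega>. (fluctuation R k \<omega>)\<^sup>2 \<partial>P) \<le> C * (weight k * real (n k) powr (- (2 / real (CARD('d) + 2))))"
      using main[of k] by simp
  qed
qed

lemma fluctuation_summable: "AE \<omega> in P. summable (\<lambda>k. fluctuation R k \<omega>)"
proof -
  interpret S: square_integrable_martingale_difference P \<F> "fluctuation R"
    by standard
      (use subalg \<F>_mono fluctuation_adapted fluctuation_second_moment(1) fluctuation_centered in auto)
  show ?thesis by (rule S.summable_AE[OF fluctuation_second_moment(2)])
qed

theorem resampling_errors_summable:
  "AE \<omega> in P. \<forall>R. summable (\<lambda>k. indicator (cube R) (X k \<omega>) * (avg (Suc k) \<omega> (X k \<omega>) - avg k \<omega> (X k \<omega>)))"
  unfolding AE_all_countable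
proof
  fix R
  show "AE \<omega> in P. summable (\<lambda>k. indicator (cube R) (X k \<omega>) * (avg (Suc k) \<omega> (X k \<omega>) - avg k \<omega> (X k \<omega>)))"
    using drift_summable[of R] fluctuation_summable[of R]
  proof eventually_elim
    case (elim \<omega>)
    have "fluctuation R k \<omega> - drift R k \<omega> =
      indicator (cube R) (X k \<omega>) * (avg (Suc k) \<omega> (X k \<omega>) - avg k \<omega> (X k \<omega>))" for k
      unfolding avg_increment fluctuation_def drift_def by (simp add: algebra_simps)
    then show ?case using summable_diff[OF elim(2,1)] by simp
  qed
qed

end

section \<open>Uniform law of large numbers\<close>

context iid_integrand
begin

lemma sample_means_converge:
  fixes h :: "'x \<Rightarrow> real"
  shows "integrable \<mu> h \<Longrightarrow>
    AE \<omega> in P. (\<lambda>m. (\<Sum>j=1..m. h (\<xi> j \<omega>)) / real m) \<longlonglongrightarrow> (\<integral>s. h s \<partial>\<mu>)"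
  by (rule strong_law_of_large_numbers[OF indep law])

lemma sample_means_bounded:
  fixes h :: "'x \<Rightarrow> real"
  assumes "integrable \<mu> h"
  shows "AE \<omega> in P. \<exists>B. \<forall>m. (\<Sum>j=1..m. h (\<xi> j \<omega>)) / real m \<le> B"
  using sample_means_converge[OF assms]
proof eventually_elim
  case (elim \<omega>)
  then have "Bseq (\<lambda>m. (\<Sum>j=1..m. h (\<xi> j \<omega>)) / real m)" by (intro convergent_imp_Bseq convergentI)
  then obtain B where "\<And>m. norm ((\<Sum>j=1..m. h (\<xi> j \<omega>)) / real m) \<le> B" using BseqE by blast
  then have "(\<Sum>j=1..m. h (\<xi> j \<omega>)) / real m \<le> B" for m by (metis abs_le_D1 real_norm_def)
  then show ?case by blast
qed

text \<open>The strong law holds simultaneously at the countably many grid points and for the moduli; bounded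
  average moduli make the sample means equi-Lipschitz, which spreads the convergence from a grid to
  the cube.\<close>

theorem uniform_law_of_large_numbers:
  "AE \<omega> in P. \<forall>R. uniform_limit (cube R) (\<lambda>m. sample_avg m (\<lambda>j. \<phi> (\<xi> j \<omega>))) E sequentially"
proof -
  let ?d = "CARD('d)"
  have "\<forall>R m. \<exists>Z. finite Z \<and> Z \<subseteq> (cube R :: (real ^ 'd) set) \<and>
    (\<forall>y\<in>cube R. \<exists>z\<in>Z. norm (y - z) \<le> real ?d / real (Suc m))"
    using cube_net[OF zero_less_Suc] by metis
  then obtain Z where Z: "\<And>R m. finite (Z R m)" "\<And>R m. Z R m \<subseteq> (cube R :: (real ^ 'd) set)"
    and net: "\<And>R m y. y \<in> cube R \<Longrightarrow> \<exists>z\<in>Z R m. norm (y - z) \<le> real ?d / real (Suc m)"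
    by metis
  have Z_count: "countable (\<Union>R m. Z R m)" by (intro countable_UN countableI_type countable_finite[OF Z(1)])
  have "AE \<omega> in P. \<forall>z\<in>(\<Union>R m. Z R m). (\<lambda>m. (\<Sum>j=1..m. \<phi> (\<xi> j \<omega>) z) / real m) \<longlonglongrightarrow> (\<integral>s. \<phi> s z \<partial>\<mu>)"
    unfolding AE_ball_countable[OF Z_count] by (intro ballI sample_means_converge integrable_phi)
  moreover have "AE \<omega> in P. \<forall>R. (\<lambda>m. (\<Sum>j=1..m. modulus R (\<xi> j \<omega>)) / real m) \<longlonglongrightarrow> mean_modulus R"
    unfolding AE_all_countable by (intro allI sample_means_converge integrable_modulus)
  ultimately show ?thesis using AE_space
  proof eventually_elim
    case (elim \<omega>)
    let ?a = "\<lambda>m. sample_avg m (\<lambda>j. \<phi> (\<xi> j \<omega>))"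
    have xs: "\<xi> j \<omega> \<in> space \<mu>" if "1 \<le> j" for j
      using measurable_space[OF xi_measurable[OF that] elim(3)] .
    have conv: "(\<lambda>m. ?a m z) \<longlonglongrightarrow> E z" if "z \<in> Z R i" for z R i
    proof -
      have "z \<in> (\<Union>R m. Z R m)" using that by blast
      from bspec[OF elim(1) this] show ?thesis unfolding sample_avg_def expect_fun_def by simp
    qed
    show ?case
    proof
      fix R
      let ?k = "mean_modulus R"
      let ?K = "\<lambda>m. (\<Sum>j=1..m. modulus R (\<xi> j \<omega>)) / real m"
      show "uniform_limit (cube R) ?a E sequentially"
        unfolding uniform_limit_iff
      proof (intro allI impI)
        fix e :: real assume "0 < e"
        define c where "c = 2 * ?k + 1"
        have c: "0 < c" unfolding c_def using mean_modulus_nonneg[of R] by linarith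
        then have "0 < e / (2 * c * real ?d)" using \<open>0 < e\<close> by simp
        then obtain i where "1 / real (Suc i) < e / (2 * c * real ?d)" using nat_approx_posE by blast
        then have i: "c * (real ?d / real (Suc i)) < e / 2"
          using c by (simp add: field_simps)
        have "\<forall>\<^sub>F m in sequentially. \<forall>z\<in>Z R i. dist (?a m z) (E z) < e / 2"
          using \<open>0 < e\<close> by (intro eventually_ball_finite Z ballI tendstoD[OF conv]) auto
        moreover have "\<forall>\<^sub>F m in sequentially. ?K m < ?k + 1"
          using elim(2) by (intro order_tendstoD) auto
        ultimately show "\<forall>\<^sub>F m in sequentially. \<forall>y\<in>cube R. dist (?a m y) (E y) < e"
        proof eventually_elim
          case (elim m)
          show ?case
          proof
            fix y :: "real ^ 'd" assume y: "y \<in> cube R"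
            obtain z where z: "z \<in> Z R i" "norm (y - z) \<le> real ?d / real (Suc i)" using net[OF y] by blast
            have zR: "z \<in> cube R" using z(1) Z(2) by blast
            have "\<bar>(\<Sum>j=1..m. \<phi> (\<xi> j \<omega>) y) - (\<Sum>j=1..m. \<phi> (\<xi> j \<omega>) z)\<bar>
                \<le> (\<Sum>j=1..m. \<bar>\<phi> (\<xi> j \<omega>) y - \<phi> (\<xi> j \<omega>) z\<bar>)"
              unfolding sum_subtractf[symmetric] by (rule sum_abs)
            also have "\<dots> \<le> (\<Sum>j=1..m. modulus R (\<xi> j \<omega>) * norm (y - z))"
              by (intro sum_mono modulus_Lipschitz xs y zR) simp
            finally have "\<bar>(\<Sum>j=1..m. \<phi> (\<xi> j \<omega>) y) - (\<Sum>j=1..m. \<phi> (\<xi> j \<omega>) z)\<bar> / real m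
                \<le> (\<Sum>j=1..m. modulus R (\<xi> j \<omega>) * norm (y - z)) / real m"
              by (intro divide_right_mono) auto
            then have "\<bar>?a m y - ?a m z\<bar> \<le> ?K m * norm (y - z)"
              unfolding sample_avg_def by (simp add: sum_distrib_right[symmetric] flip: diff_divide_distrib)
            moreover have "\<bar>E y - E z\<bar> \<le> ?k * norm (y - z)" by (rule E_Lipschitz[OF y zR])
            moreover have "\<bar>?a m z - E z\<bar> < e / 2" using elim(1) z(1) by (simp add: dist_real_def)
            moreover have "?K m * norm (y - z) + ?k * norm (y - z) < e / 2"
            proof -
              have "?K m * norm (y - z) + ?k * norm (y - z) = (?K m + ?k) * norm (y - z)" by (simp add: algebra_simps)
              also have "\<dots> \<le> c * norm (y - z)" using elim(2) unfolding c_def by (intro mult_right_mono) auto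
              also have "\<dots> \<le> c * (real ?d / real (Suc i))" using z(2) c by (intro mult_left_mono) auto
              finally show ?thesis using i by linarith
            qed
            ultimately have "\<bar>?a m y - E y\<bar> < e" by linarith
            then show "dist (?a m y) (E y) < e" by (simp add: dist_real_def)
          qed
        qed
      qed
    qed
  qed
qed
end

section \<open>Accumulation points of a sequence with vanishing steps\<close>

text \<open>Subsequences are replaced by the requirement that every ball is visited infinitely often.\<close>

lemma accumulation_points_eq: 
  fixes X :: "nat \<Rightarrow> 'a::metric_space"
  shows "accumulation_points X = {a. \<forall>e>0. \<exists>\<^sub>F k in sequentially. dist (X k) a < e}"
proof (intro set_eqI iffI)
  fix a assume "a \<in> accumulation_points X"
  then obtain r where r: "strict_mono r" "(\<lambda>j. X (r j)) \<longlonglongrightarrow> a" unfolding accumulation_points_def by blast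
  have "\<exists>\<^sub>F k in sequentially. dist (X k) a < e" if "0 < e" for e
    unfolding frequently_sequentially
  proof
    fix N
    obtain M where M: "\<And>j. M \<le> j \<Longrightarrow> dist (X (r j)) a < e" using metric_LIMSEQ_D[OF r(2) \<open>0 < e\<close>] by blast
    have "N \<le> r (max M N)" using strict_mono_imp_increasing[OF r(1), of "max M N"] by linarith
    then show "\<exists>k\<ge>N. dist (X k) a < e" using M[of "max M N"] by auto
  qed
  then show "a \<in> {a. \<forall>e>0. \<exists>\<^sub>F k in sequentially. dist (X k) a < e}" by blast
next
  fix a assume a: "a \<in> {a. \<forall>e>0. \<exists>\<^sub>F k in sequentially. dist (X k) a < e}"
  have "\<exists>k. k > m \<and> dist (X k) a < 1 / real (Suc j)" for m j
  proof -
    have "\<exists>\<^sub>F k in sequentially. dist (X k) a < 1 / real (Suc j)" using a by simp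
    then obtain k where "Suc m \<le> k" "dist (X k) a < 1 / real (Suc j)"
      unfolding frequently_sequentially by blast
    then show ?thesis by (intro exI[of _ k]) auto
  qed
  then obtain g where g: "\<And>m j. g m j > m" "\<And>m j. dist (X (g m j)) a < 1 / real (Suc j)" by metis
  define r where "r = rec_nat (g 0 0) (\<lambda>j m. g m (Suc j))"
  have rS: "r (Suc j) = g (r j) (Suc j)" for j unfolding r_def by simp
  have "strict_mono r" unfolding strict_mono_Suc_iff by (simp add: rS g)
  moreover have d: "dist (X (r j)) a < 1 / real (Suc j)" for j
    by (cases j) (simp_all only: rS g(2), simp add: r_def g(2)[of 0 0, simplified])
  have "(\<lambda>j. X (r j)) \<longlonglongrightarrow> a"
  proof (rule metric_LIMSEQ_I)
    fix e :: real assume "0 < e"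
    then obtain N where N: "1 / real (Suc N) < e" using nat_approx_posE by blast
    have "dist (X (r j)) a < e" if "N \<le> j" for j
    proof -
      have "1 / real (Suc j) \<le> 1 / real (Suc N)" using that by (intro divide_left_mono) auto
      then show ?thesis using d[of j] N by linarith
    qed
    then show "\<exists>N. \<forall>j\<ge>N. dist (X (r j)) a < e" by blast
  qed
  ultimately show "a \<in> accumulation_points X" unfolding accumulation_points_def by blast
qed

lemma frequently_near_accumulation_point:
  fixes X :: "nat \<Rightarrow> 'a::metric_space"
  shows "a \<in> accumulation_points X \<Longrightarrow> 0 < e \<Longrightarrow> \<exists>\<^sub>F k in sequentially. dist (X k) a < e"
  unfolding accumulation_points_eq by blast

lemma closed_accumulation_points:
  fixes X :: "nat \<Rightarrow> 'a::metric_space"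
  shows "closed (accumulation_points X)"
proof -
  have "a \<in> accumulation_points X" if a: "\<forall>e>0. \<exists>b\<in>accumulation_points X. dist b a < e" for a
    unfolding accumulation_points_eq
  proof (intro CollectI allI impI)
    fix e :: real assume "0 < e"
    then obtain b where b: "b \<in> accumulation_points X" "dist b a < e / 2" using a by (meson half_gt_zero)
    then have "\<exists>\<^sub>F k in sequentially. dist (X k) b < e / 2"
      using \<open>0 < e\<close> by (intro frequently_near_accumulation_point) auto
    then show "\<exists>\<^sub>F k in sequentially. dist (X k) a < e"
    proof (rule frequently_elim1)
      fix k assume "dist (X k) b < e / 2"
      then show "dist (X k) a < e" using b(2) dist_triangle[of "X k" a b] by linarith
    qed
  qed
  then show ?thesis unfolding closure_subset_eq[symmetric] subset_iff closure_approachable by blast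
qed

context
  fixes X :: "nat \<Rightarrow> 'a::heine_borel"
  assumes bdd: "bounded (range X)"
begin

text \<open>Bolzano-Weierstrass for the infinitely many terms that lie in \<open>C\<close>.\<close>

lemma accumulation_point_in_frequent_set:
  assumes "\<exists>\<^sub>F k in sequentially. X k \<in> C" and "closed C"
  shows "accumulation_points X \<inter> C \<noteq> {}"
proof -
  have inf: "infinite {k. X k \<in> C}" using assms(1) unfolding frequently_cofinite[symmetric] cofinite_eq_sequentially .
  define s where "s = enumerate {k. X k \<in> C}"
  have s: "strict_mono s" "\<And>j. X (s j) \<in> C"
    using strict_mono_enumerate[OF inf] enumerate_in_set[OF inf] unfolding s_def by auto
  have "bounded (range (X \<circ> s))" using bounded_subset[OF bdd, of "range (X \<circ> s)"] by auto
  then obtain l r where r: "strict_mono r" "((X \<circ> s) \<circ> r) \<longlonglongrightarrow> l" using bounded_imp_convergent_subsequence by blast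
  have "l \<in> C" using closed_sequentially[OF \<open>closed C\<close> _ r(2)] s(2) by simp
  moreover have "l \<in> accumulation_points X"
    unfolding accumulation_points_def
    using strict_mono_o[OF s(1) r(1)] r(2) by (intro CollectI exI[of _ "s \<circ> r"]) (simp add: comp_def)
  ultimately show ?thesis by blast
qed

lemma accumulation_points_nonempty: "accumulation_points X \<noteq> {}"
  using accumulation_point_in_frequent_set[of UNIV] by simp

lemma eventually_in_open:
  assumes "open U" "accumulation_points X \<subseteq> U"
  shows "\<forall>\<^sub>F k in sequentially. X k \<in> U"
proof (rule ccontr)
  assume "\<not> ?thesis"
  then have "\<exists>\<^sub>F k in sequentially. X k \<in> - U" by (simp add: not_eventually)
  then have "accumulation_points X \<inter> - U \<noteq> {}"
    by (rule accumulation_point_in_frequent_set) (use assms(1) in auto)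
  then show False using assms(2) by blast
qed

lemma compact_accumulation_points: "compact (accumulation_points X)"
proof (rule compact_eq_bounded_closed[THEN iffD2], intro conjI closed_accumulation_points)
  have "accumulation_points X \<subseteq> closure (range X)"
  proof
    fix a assume "a \<in> accumulation_points X"
    then obtain r where "(\<lambda>j. X (r j)) \<longlonglongrightarrow> a" unfolding accumulation_points_def by blast
    then show "a \<in> closure (range X)"
      unfolding closure_sequential by (intro exI[of _ "\<lambda>j. X (r j)"]) simp
  qed
  then show "bounded (accumulation_points X)" using bounded_closure[OF bdd] bounded_subset by blast
qed

text \<open>If the set of accumulation points split into two disjoint closed parts, they would be at a positive
  distance \<open>\<delta>\<close>. Eventually the sequence stays within \<open>\<delta> / 3\<close> of their union with steps shorter than
  \<open>\<delta> / 3\<close>, so it can never cross from one part to the other, although it visits both infinitely often.\<close>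

lemma connected_accumulation_points:
  assumes steps: "(\<lambda>k. dist (X (Suc k)) (X k)) \<longlonglongrightarrow> 0"
  shows "connected (accumulation_points X)"
proof (rule ccontr)
  let ?S = "accumulation_points X"
  assume "\<not> connected ?S"
  then obtain A B where AB: "closed A" "closed B" "?S \<subseteq> A \<union> B" "A \<inter> B \<inter> ?S = {}" "A \<inter> ?S \<noteq> {}" "B \<inter> ?S \<noteq> {}"
    unfolding connected_closed by blast
  define A' where "A' = A \<inter> ?S"
  define B' where "B' = B \<inter> ?S"
  have "compact A'" "closed B'" "A' \<inter> B' = {}"
    unfolding A'_def B'_def
    using AB closed_accumulation_points[of X] compact_Int_closed[OF compact_accumulation_points AB(1)]
    by (auto simp: Int_commute)
  then obtain \<delta> where \<delta>: "0 < \<delta>" "\<And>a b. a \<in> A' \<Longrightarrow> b \<in> B' \<Longrightarrow> \<delta> \<le> dist a b"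
    using separate_compact_closed[of A' B'] by blast
  define U where "U = (\<Union>a\<in>A'. ball a (\<delta> / 3))"
  define V where "V = (\<Union>b\<in>B'. ball b (\<delta> / 3))"
  have "?S \<subseteq> A' \<union> B'" using AB(3) unfolding A'_def B'_def by blast
  then have "?S \<subseteq> U \<union> V" unfolding U_def V_def using \<delta>(1) by fastforce
  moreover have "open (U \<union> V)" unfolding U_def V_def by auto
  ultimately have "\<forall>\<^sub>F k in sequentially. X k \<in> U \<union> V" by (intro eventually_in_open)
  moreover have "\<forall>\<^sub>F k in sequentially. dist (X (Suc k)) (X k) < \<delta> / 3"
    using \<delta>(1) by (intro order_tendstoD(2)[OF steps]) auto
  ultimately have "\<forall>\<^sub>F k in sequentially. X k \<in> U \<union> V \<and> dist (X (Suc k)) (X k) < \<delta> / 3"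
    by (rule eventually_conj)
  then obtain N where N: "\<And>k. N \<le> k \<Longrightarrow> X k \<in> U \<union> V" "\<And>k. N \<le> k \<Longrightarrow> dist (X (Suc k)) (X k) < \<delta> / 3"
    unfolding eventually_sequentially by blast
  have jump: False if yz: "y \<in> U" "z \<in> V" "dist y z < \<delta> / 3" for y z
  proof -
    obtain a b where ab: "a \<in> A'" "b \<in> B'" "dist a y < \<delta> / 3" "dist b z < \<delta> / 3"
      using yz(1,2) unfolding U_def V_def mem_ball UN_iff by blast
    have "dist a b \<le> dist a y + dist y z + dist z b"
      using dist_triangle[of a b y] dist_triangle[of y b z] by linarith
    then have "dist a b < \<delta>" using ab yz(3) dist_commute[of b z] by linarith
    then show False using \<delta>(2)[OF ab(1,2)] by linarith
  qed
  have stay: "X k \<in> W" if W: "W = U \<or> W = V" "X N \<in> W" "N \<le> k" for W k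
    using that(3)
  proof (induction k rule: dec_induct)
    case (step k)
    have "X (Suc k) \<in> U \<union> V" using N(1)[of "Suc k"] step by simp
    then show ?case using W(1) jump[of "X k" "X (Suc k)"] jump[of "X (Suc k)" "X k"] step N(2)[of k]
      by (auto simp: dist_commute)
  qed (rule W(2))
  have reach: "\<exists>k\<ge>N. X k \<in> ball a (\<delta> / 3)" if "a \<in> ?S" for a
  proof -
    have "\<exists>\<^sub>F k in sequentially. dist (X k) a < \<delta> / 3" using that \<delta>(1) by (intro frequently_near_accumulation_point) auto
    then show ?thesis unfolding frequently_sequentially by (auto simp: dist_commute)
  qed
  obtain a b where ab: "a \<in> A'" "b \<in> B'" using AB(5,6) unfolding A'_def B'_def by blast
  obtain k1 where k1: "N \<le> k1" "X k1 \<in> U" using reach[of a] ab(1) unfolding U_def A'_def by blast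
  obtain k2 where k2: "N \<le> k2" "X k2 \<in> V" using reach[of b] ab(2) unfolding V_def B'_def by blast
  show False
  proof (cases "X N \<in> U")
    case True
    then have "X k2 \<in> U" using stay[of U k2] k2 by blast
    then show False using jump[of "X k2" "X k2"] k2(2) \<delta>(1) by simp
  next
    case False
    then have "X k1 \<in> V" using stay[of V k1] k1 N(1)[of N] by blast
    then show False using jump[of "X k1" "X k1"] k1(2) \<delta>(1) by simp
  qed
qed

text \<open>An isolated point of a connected set is the whole set, and a bounded sequence with a single
  accumulation point converges.\<close>

lemma tendsto_isolated_accumulation_point:
  assumes conn: "connected (accumulation_points X)" and iso: "a isolated_in accumulation_points X"
  shows "X \<longlonglongrightarrow> a"
proof -
  let ?S = "accumulation_points X"
  obtain T where T: "a \<in> ?S" "open T" "T \<inter> ?S = {a}" using iso by (rule isolated_inE)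
  have "?S = {a}"
  proof (rule ccontr)
    assume "?S \<noteq> {a}"
    then have "- {a} \<inter> ?S \<noteq> {}" using T(1) by blast
    moreover have "open (- {a})" by (intro open_Compl closed_singleton)
    moreover have "?S \<subseteq> T \<union> - {a}" "T \<inter> - {a} \<inter> ?S = {}" "T \<inter> ?S \<noteq> {}" using T by auto
    ultimately show False using conn T(2) unfolding connected_def by blast
  qed
  then show ?thesis
    unfolding tendsto_def by (intro allI impI eventually_in_open) auto
qed

end

section \<open>One trajectory of the algorithm\<close>

lemma ereal_add_real_le_cancel: "u + ereal c \<le> w + ereal c \<longleftrightarrow> u \<le> w"
  by (cases u; cases w) auto

text \<open>Completing the square: the linearised form of the proximal step, without the constant
  \<open>t / 2 * \<parallel>v\<parallel>\<^sup>2\<close>. In this form steps with different \<open>t\<close> can be compared.\<close>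

lemma mem_prox_iff:
  fixes \<psi> :: "'a::euclidean_space \<Rightarrow> ereal"
  assumes "0 < t"
  shows "u \<in> prox t \<psi> (x - t *\<^sub>R v) \<longleftrightarrow>
    (\<forall>w. \<psi> u + ereal (v \<bullet> (u - x) + 1 / (2 * t) * (norm (u - x))\<^sup>2)
       \<le> \<psi> w + ereal (v \<bullet> (w - x) + 1 / (2 * t) * (norm (w - x))\<^sup>2))"
proof -
  have "1 / (2 * t) * (norm (w - (x - t *\<^sub>R v)))\<^sup>2
      = (v \<bullet> (w - x) + 1 / (2 * t) * (norm (w - x))\<^sup>2) + t / 2 * (norm v)\<^sup>2" for w
  proof -
    have "w - (x - t *\<^sub>R v) = (w - x) + t *\<^sub>R v" by simp
    moreover have "(norm (y + t *\<^sub>R v))\<^sup>2 = (norm y)\<^sup>2 + 2 * t * (v \<bullet> y) + t\<^sup>2 * (norm v)\<^sup>2" for y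
      unfolding power2_norm_eq_inner by (simp add: inner_add_left inner_add_right inner_commute power2_eq_square)
    ultimately have "(norm (w - (x - t *\<^sub>R v)))\<^sup>2 = (norm (w - x))\<^sup>2 + 2 * t * (v \<bullet> (w - x)) + t\<^sup>2 * (norm v)\<^sup>2"
      by (simp only:)
    then show ?thesis using assms by (simp add: field_simps power2_eq_square)
  qed
  then have "\<psi> w + ereal (1 / (2 * t) * (norm (w - (x - t *\<^sub>R v)))\<^sup>2)
      = \<psi> w + ereal (v \<bullet> (w - x) + 1 / (2 * t) * (norm (w - x))\<^sup>2) + ereal (t / 2 * (norm v)\<^sup>2)" for w
    by (simp only: add.assoc plus_ereal.simps)
  then show ?thesis
    unfolding prox_def is_arg_min_def by (simp add: not_less ereal_add_real_le_cancel del: times_ereal.simps)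
qed

lemma lower_semicont_eventually_less:
  assumes "lower_semicont \<psi>" "(X \<longlongrightarrow> a) F" "y < \<psi> a"
  shows "\<forall>\<^sub>F k in F. y < \<psi> (X k)"
proof -
  have "\<psi> a \<le> Liminf (at a) \<psi>" using assms(1) unfolding lower_semicont_def by blast
  then have "\<forall>\<^sub>F z in at a. y < \<psi> z" using assms(3) unfolding le_Liminf_iff by blast
  then have "\<forall>\<^sub>F z in nhds a. y < \<psi> z" using assms(3) by (simp add: eventually_nhds_conv_at)
  then show ?thesis using assms(2) unfolding filterlim_iff by blast
qed

text \<open>Subtracting the partial sums of \<open>e\<close>, which are bounded, turns \<open>a\<close> into a decreasing sequence.\<close>

lemma convergent_of_perturbed_descent:
  fixes a d e :: "nat \<Rightarrow> real"
  assumes step: "\<And>k. a (Suc k) \<le> a k - d k + e k" and d: "\<And>k. 0 \<le> d k"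
    and e: "summable e" and below: "\<And>k. m \<le> a k"
  shows "convergent a" and "summable d"
proof -
  define b where "b k = a k - (\<Sum>i<k. e i)" for k
  have b_step: "b (Suc k) \<le> b k - d k" for k using step[of k] by (simp add: b_def)
  have e_conv: "convergent (\<lambda>k. \<Sum>i<k. e i)" using e summable_iff_convergent by blast
  from convergent_imp_Bseq[OF this] have "\<exists>B. \<forall>k. norm (\<Sum>i<k. e i) \<le> B"
    unfolding Bseq_def by blast
  then obtain B where B: "norm (\<Sum>i<k. e i) \<le> B" for k by blast
  have b_below: "m - B \<le> b k" for k
    using below[of k] B[of k] unfolding b_def by (simp add: abs_le_iff)
  have "b (Suc k) \<le> b k" for k using b_step[of k] d[of k] by linarith
  then have "decseq b" by (rule decseq_SucI)
  then obtain l where "b \<longlonglongrightarrow> l" using decseq_convergent[of b "m - B"] b_below by blast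
  then have "convergent b" by (rule convergentI)
  then have "convergent (\<lambda>k. b k + (\<Sum>i<k. e i))" using e_conv by (rule convergent_add)
  then show "convergent a" by (simp add: b_def)
  show "summable d"
  proof (rule summableI_nonneg_bounded)
    fix N
    have "(\<Sum>k<N. d k) \<le> (\<Sum>k<N. b k - b (Suc k))" using b_step by (intro sum_mono) (simp add: le_diff_eq add.commute)
    also have "\<dots> = b 0 - b N" by (rule sum_lessThan_telescope')
    also have "\<dots> \<le> b 0 - (m - B)" using b_below[of N] by simp
    finally show "(\<Sum>k<N. d k) \<le> b 0 - (m - B)" .
  qed (rule d)
qed

text \<open>What the stochastic analysis provides for one outcome: the trajectory stays in the compact set \<open>S\<close>,
  \<open>T\<close> contains a \<open>\<delta>\<close>-neighborhood of \<open>S\<close>, and the averages of the moduli \<open>K\<close> and \<open>l\<close> are at most \<open>B\<close>.\<close>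

locale pss_trajectory =
  fixes \<rho> \<sigma> \<gamma>min :: real and \<psi> :: "'a::euclidean_space \<Rightarrow> ereal" and n :: "nat \<Rightarrow> nat"
    and f :: "nat \<Rightarrow> 'a \<Rightarrow> real" and E :: "'a \<Rightarrow> real" and x :: "nat \<Rightarrow> 'a" and \<gamma> :: "nat \<Rightarrow> real"
    and S T :: "'a set" and \<delta> :: real and K l :: "nat \<Rightarrow> real" and B :: real
  assumes \<rho>: "0 < \<rho>" "\<rho> < 1" and \<sigma>: "0 < \<sigma>" and \<gamma>min: "0 < \<gamma>min"
    and proper: "proper_fun \<psi>" and lsc: "lower_semicont \<psi>" and prox_bdd: "prox_bounded \<psi>"
    and n_pos: "\<And>k. 0 < n k"
    and iter: "\<And>k. pss_iteration \<rho> \<sigma> \<gamma>min \<psi> (n k) f (x k) (\<gamma> k) (x (Suc k))"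
    and start: "\<psi> (x 0) < \<infinity>"
    and xS: "\<And>k. x k \<in> S" and compact_S: "compact S" and \<delta>: "0 < \<delta>"
    and ST: "\<And>y. y \<in> S \<Longrightarrow> ball y \<delta> \<subseteq> T"
    and f_bound: "\<And>j y. 1 \<le> j \<Longrightarrow> y \<in> T \<Longrightarrow> \<bar>f j y\<bar> \<le> K j"
    and f_Lipschitz: "\<And>j y z. 1 \<le> j \<Longrightarrow> y \<in> T \<Longrightarrow> z \<in> T \<Longrightarrow> \<bar>f j y - f j z\<bar> \<le> K j * norm (y - z)"
    and f_upper: "\<And>j y z v. 1 \<le> j \<Longrightarrow> y \<in> S \<Longrightarrow> v \<in> clarke_subdiff (f j) y \<Longrightarrow> norm (z - y) < \<delta> \<Longrightarrow>
       f j z \<le> f j y + v \<bullet> (z - y) + l j * (norm (z - y))\<^sup>2"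
    and avg_K: "\<And>k. (\<Sum>j=1..n k. K j) / real (n k) \<le> B"
    and avg_l: "\<And>k. (\<Sum>j=1..n k. l j) / real (n k) \<le> B"
    and uniform: "uniform_limit T (\<lambda>k. sample_avg (n k) f) E sequentially"
    and E_cont: "continuous_on UNIV E"
    and errors: "summable (\<lambda>k. sample_avg (n (Suc k)) f (x (Suc k)) - sample_avg (n k) f (x (Suc k)))"
begin

abbreviation A :: "nat \<Rightarrow> 'a \<Rightarrow> real" where "A k \<equiv> sample_avg (n k) f"

lemma A_eq: "A k y = (\<Sum>j=1..n k. f j y) / real (n k)"
  unfolding sample_avg_def by simp

lemma S_subset_T: "y \<in> S \<Longrightarrow> y \<in> T"
  using ST[of y] \<delta> by auto

lemma A_bound: "y \<in> T \<Longrightarrow> \<bar>A k y\<bar> \<le> B"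
proof -
  assume y: "y \<in> T"
  have "\<bar>\<Sum>j=1..n k. f j y\<bar> \<le> (\<Sum>j=1..n k. K j)"
    by (rule order_trans[OF sum_abs]) (use f_bound y in \<open>auto intro!: sum_mono\<close>)
  then have "\<bar>A k y\<bar> \<le> (\<Sum>j=1..n k. K j) / real (n k)"
    unfolding A_eq by (simp add: divide_right_mono)
  then show ?thesis using avg_K[of k] by linarith
qed

lemma B_nonneg: "0 \<le> B"
  using A_bound[OF S_subset_T[OF xS], of 0 0] by linarith

definition accepted :: "nat \<Rightarrow> 'a \<Rightarrow> bool" where
  "accepted k u \<longleftrightarrow> composite (A k) \<psi> u \<le> composite (A k) \<psi> (x k) - ereal (\<sigma> * (norm (u - x k))\<^sup>2)"

definition mean_subgradient :: "nat \<Rightarrow> 'a \<Rightarrow> bool" where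
  "mean_subgradient k v \<longleftrightarrow> (\<exists>V. (\<forall>i\<in>{1..n k}. V i \<in> clarke_subdiff (f i) (x k)) \<and>
     v = (1 / real (n k)) *\<^sub>R (\<Sum>i=1..n k. V i))"

text \<open>All that is needed of the backtracking loop: either the first stepsize was accepted, or the previous
  one, which is larger by the factor \<open>1 / \<rho>\<close>, was rejected.\<close>

lemma iteration_cases:
  "\<exists>v. mean_subgradient k v \<and> 0 < \<gamma> k \<and> accepted k (x (Suc k)) \<and>
     x (Suc k) \<in> prox (\<gamma> k) \<psi> (x k - \<gamma> k *\<^sub>R v) \<and>
     (\<gamma>min \<le> \<gamma> k \<or> (\<exists>u. u \<in> prox (\<gamma> k / \<rho>) \<psi> (x k - (\<gamma> k / \<rho>) *\<^sub>R v) \<and> \<not> accepted k u))"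
proof -
  obtain V \<gamma>bar q u where V: "\<forall>i\<in>{1..n k}. V i \<in> clarke_subdiff (f i) (x k)" and \<gamma>bar: "\<gamma>min \<le> \<gamma>bar"
    and u: "\<forall>l\<le>q. u l \<in> prox (\<rho> ^ l * \<gamma>bar) \<psi>
          (x k - (\<rho> ^ l * \<gamma>bar) *\<^sub>R ((1 / real (n k)) *\<^sub>R (\<Sum>i=1..n k. V i)))"
    and rej: "\<forall>l<q. \<not> accepted k (u l)" and acc: "accepted k (u q)"
    and eq: "\<gamma> k = \<rho> ^ q * \<gamma>bar" "x (Suc k) = u q"
    using iter[of k] unfolding pss_iteration_def Let_def accepted_def not_less not_le by blast
  define v where "v = (1 / real (n k)) *\<^sub>R (\<Sum>i=1..n k. V i)"
  have "mean_subgradient k v" unfolding mean_subgradient_def v_def using V by blast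
  moreover have "0 < \<gamma> k" unfolding eq using \<rho> \<gamma>min \<gamma>bar by simp
  moreover have "x (Suc k) \<in> prox (\<gamma> k) \<psi> (x k - \<gamma> k *\<^sub>R v)" unfolding eq v_def using u by simp
  moreover have "\<gamma>min \<le> \<gamma> k \<or> (\<exists>u. u \<in> prox (\<gamma> k / \<rho>) \<psi> (x k - (\<gamma> k / \<rho>) *\<^sub>R v) \<and> \<not> accepted k u)"
  proof (cases q)
    case 0
    then show ?thesis using eq \<gamma>bar by simp
  next
    case (Suc p)
    then have "\<gamma> k / \<rho> = \<rho> ^ p * \<gamma>bar" using eq \<rho> by simp
    then have "u p \<in> prox (\<gamma> k / \<rho>) \<psi> (x k - (\<gamma> k / \<rho>) *\<^sub>R v)" using u Suc unfolding v_def by simp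
    then show ?thesis using rej Suc by blast
  qed
  ultimately show ?thesis using acc eq by metis
qed

lemma mean_subgradient_norm_le:
  assumes "mean_subgradient k v"
  shows "norm v \<le> B"
proof -
  obtain V where V: "\<forall>i\<in>{1..n k}. V i \<in> clarke_subdiff (f i) (x k)"
    and v: "v = (1 / real (n k)) *\<^sub>R (\<Sum>i=1..n k. V i)" using assms unfolding mean_subgradient_def by blast
  have "norm (V i) \<le> K i" if "i \<in> {1..n k}" for i
  proof (rule clarke_subdiff_norm_le[OF \<delta>])
    show "V i \<in> clarke_subdiff (f i) (x k)" using V that by blast
    show "\<bar>f i y - f i z\<bar> \<le> K i * norm (y - z)" if "y \<in> ball (x k) \<delta>" "z \<in> ball (x k) \<delta>" for y z
      by (rule f_Lipschitz) (use that subsetD[OF ST[OF xS[of k]]] \<open>i \<in> {1..n k}\<close> in auto)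
  qed
  then have "norm (\<Sum>i=1..n k. V i) \<le> (\<Sum>i=1..n k. K i)" by (intro sum_norm_le) auto
  then have "norm v \<le> (\<Sum>i=1..n k. K i) / real (n k)" unfolding v by (simp add: divide_right_mono)
  then show ?thesis using avg_K[of k] by linarith
qed

lemma mean_subgradient_upper:
  assumes "mean_subgradient k v" and y: "norm (y - x k) < \<delta>"
  shows "A k y \<le> A k (x k) + v \<bullet> (y - x k) + B * (norm (y - x k))\<^sup>2"
proof -
  obtain V where V: "\<forall>i\<in>{1..n k}. V i \<in> clarke_subdiff (f i) (x k)"
    and v: "v = (1 / real (n k)) *\<^sub>R (\<Sum>i=1..n k. V i)" using assms unfolding mean_subgradient_def by blast
  let ?s = "(norm (y - x k))\<^sup>2"
  have "(\<Sum>i=1..n k. f i y) \<le> (\<Sum>i=1..n k. f i (x k) + V i \<bullet> (y - x k) + l i * ?s)"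
    by (intro sum_mono f_upper xS y) (use V in auto)
  then have "A k y \<le> (\<Sum>i=1..n k. f i (x k) + V i \<bullet> (y - x k) + l i * ?s) / real (n k)"
    unfolding A_eq by (intro divide_right_mono) auto
  also have "\<dots> = A k (x k) + v \<bullet> (y - x k) + (\<Sum>i=1..n k. l i) / real (n k) * ?s"
    unfolding v A_eq by (simp add: sum.distrib inner_sum_left sum_distrib_right[symmetric] add_divide_distrib)
  also have "(\<Sum>i=1..n k. l i) / real (n k) * ?s \<le> B * ?s" using avg_l[of k] by (intro mult_right_mono) auto
  finally show ?thesis by simp
qed

lemma psi_real_below: "\<exists>\<gamma>0 c. 0 < \<gamma>0 \<and> (\<forall>u. ereal (c - 1 / (2 * \<gamma>0) * (norm u)\<^sup>2) \<le> \<psi> u)"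
proof -
  obtain \<gamma>0 c where g: "0 < \<gamma>0" "\<And>u. ereal c \<le> \<psi> u + ereal (1 / (2 * \<gamma>0) * (norm u)\<^sup>2)"
    using prox_bdd unfolding prox_bounded_def bdd_below_with_prox_def by blast
  have "ereal (c - 1 / (2 * \<gamma>0) * (norm u)\<^sup>2) \<le> \<psi> u" for u
    using g(2)[of u] by (cases "\<psi> u") auto
  then show ?thesis using g(1) by blast
qed

lemma psi_not_MInf: "\<psi> u \<noteq> -\<infinity>"
  using proper unfolding proper_fun_def by blast

definition penalty :: "nat \<Rightarrow> real" where "penalty k = real_of_ereal (\<psi> (x k))"

definition objective :: "nat \<Rightarrow> real" where "objective k = A k (x k) + penalty k"

lemma psi_x: "\<psi> (x k) = ereal (penalty k)"
proof -
  have "\<psi> (x k) < \<infinity>"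
  proof (induction k)
    case (Suc k)
    then obtain r where r: "\<psi> (x k) = ereal r" using psi_not_MInf[of "x k"] by (cases "\<psi> (x k)") auto
    have "accepted k (x (Suc k))" using iteration_cases by blast
    then show ?case unfolding accepted_def composite_def r by (cases "\<psi> (x (Suc k))") auto
  qed (rule start)
  then show ?thesis unfolding penalty_def using psi_not_MInf[of "x k"] by (cases "\<psi> (x k)") auto
qed

lemma composite_x: "composite (A k) \<psi> (x k) = ereal (objective k)"
  unfolding composite_def objective_def psi_x by simp

lemma objective_step: "objective (Suc k) \<le> objective k - \<sigma> * (norm (x (Suc k) - x k))\<^sup>2 + (A (Suc k) (x (Suc k)) - A k (x (Suc k)))"
proof -
  have "accepted k (x (Suc k))" using iteration_cases by blast
  then have "A k (x (Suc k)) + penalty (Suc k) \<le> objective k - \<sigma> * (norm (x (Suc k) - x k))\<^sup>2"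
    unfolding accepted_def composite_x by (simp add: composite_def psi_x)
  then show ?thesis unfolding objective_def[of "Suc k"] by linarith
qed

lemma S_norm_bound: "\<exists>r. \<forall>y\<in>S. norm y \<le> r"
  using compact_imp_bounded[OF compact_S] unfolding bounded_iff .

lemma objective_bounded_below: "\<exists>m. \<forall>k. m \<le> objective k"
proof -
  obtain \<gamma>0 c where g: "0 < \<gamma>0" "\<And>u. ereal (c - 1 / (2 * \<gamma>0) * (norm u)\<^sup>2) \<le> \<psi> u" using psi_real_below by blast
  obtain r where r: "\<And>y. y \<in> S \<Longrightarrow> norm y \<le> r" using S_norm_bound by blast
  have "c - 1 / (2 * \<gamma>0) * r\<^sup>2 - B \<le> objective k" for k
  proof -
    have "1 / (2 * \<gamma>0) * (norm (x k))\<^sup>2 \<le> 1 / (2 * \<gamma>0) * r\<^sup>2"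
      using g(1) r[OF xS[of k]] by (intro mult_left_mono power_mono) auto
    moreover have "c - 1 / (2 * \<gamma>0) * (norm (x k))\<^sup>2 \<le> penalty k" using g(2)[of "x k"] unfolding psi_x by simp
    moreover have "- B \<le> A k (x k)" using A_bound[OF S_subset_T[OF xS[of k]], of k] by linarith
    ultimately show ?thesis unfolding objective_def by linarith
  qed
  then show ?thesis by blast
qed

lemma convergent_objective: "convergent objective"
  and summable_steps: "summable (\<lambda>k. (norm (x (Suc k) - x k))\<^sup>2)"
proof -
  obtain m where m: "\<And>k. m \<le> objective k" using objective_bounded_below by blast
  have d0: "0 \<le> \<sigma> * (norm (x (Suc k) - x k))\<^sup>2" for k using \<sigma> by simp
  show "convergent objective" by (rule convergent_of_perturbed_descent(1)[OF objective_step d0 errors m])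
  have "summable (\<lambda>k. \<sigma> * (norm (x (Suc k) - x k))\<^sup>2)"
    by (rule convergent_of_perturbed_descent(2)[OF objective_step d0 errors m])
  then show "summable (\<lambda>k. (norm (x (Suc k) - x k))\<^sup>2)"
    using \<sigma> by (subst (asm) summable_cmult_iff) auto
qed

definition objective_limit :: real where "objective_limit = lim objective"

lemma objective_tendsto: "objective \<longlonglongrightarrow> objective_limit"
  unfolding objective_limit_def using convergent_objective convergent_LIMSEQ_iff by blast

lemma steps_tendsto_0: "(\<lambda>k. x (Suc k) - x k) \<longlonglongrightarrow> 0"
proof -
  have "(\<lambda>k. sqrt ((norm (x (Suc k) - x k))\<^sup>2)) \<longlonglongrightarrow> sqrt 0"
    by (intro tendsto_real_sqrt summable_LIMSEQ_zero summable_steps)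
  then show ?thesis by (simp add: tendsto_norm_zero_iff)
qed

lemma A_minus_E_tendsto_0: "(\<lambda>k. A k (x k) - E (x k)) \<longlonglongrightarrow> 0"
proof (rule metric_LIMSEQ_I)
  fix e :: real assume "0 < e"
  then obtain N where "\<And>k y. N \<le> k \<Longrightarrow> y \<in> T \<Longrightarrow> dist (A k y) (E y) < e"
    using uniform unfolding uniform_limit_iff eventually_sequentially by blast
  then have "\<forall>k\<ge>N. dist (A k (x k) - E (x k)) 0 < e" using S_subset_T[OF xS] by (simp add: dist_real_def)
  then show "\<exists>N. \<forall>k\<ge>N. dist (A k (x k) - E (x k)) 0 < e" ..
qed

lemma composite_tendsto:
  "(\<lambda>k. composite (A k) \<psi> (x k)) \<longlonglongrightarrow> ereal objective_limit" "(\<lambda>k. composite E \<psi> (x k)) \<longlonglongrightarrow> ereal objective_limit"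
proof -
  show "(\<lambda>k. composite (A k) \<psi> (x k)) \<longlonglongrightarrow> ereal objective_limit" unfolding composite_x using objective_tendsto by simp
  have "(\<lambda>k. objective k - (A k (x k) - E (x k))) \<longlonglongrightarrow> objective_limit - 0" by (intro tendsto_diff objective_tendsto A_minus_E_tendsto_0)
  moreover have "composite E \<psi> (x k) = ereal (objective k - (A k (x k) - E (x k)))" for k
    unfolding composite_def psi_x objective_def by simp
  ultimately show "(\<lambda>k. composite E \<psi> (x k)) \<longlonglongrightarrow> ereal objective_limit" by simp
qed

lemma prox_at_iterate:
  assumes "0 < t" "u \<in> prox t \<psi> (x k - t *\<^sub>R v)"
  shows "\<exists>pu. \<psi> u = ereal pu \<and> pu + v \<bullet> (u - x k) + 1 / (2 * t) * (norm (u - x k))\<^sup>2 \<le> penalty k"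
proof -
  have *: "\<psi> u + ereal (v \<bullet> (u - x k) + 1 / (2 * t) * (norm (u - x k))\<^sup>2) \<le> ereal (penalty k)"
    using assms(2)[unfolded mem_prox_iff[OF assms(1)], rule_format, of "x k"] by (simp add: psi_x)
  then obtain pu where "\<psi> u = ereal pu" using psi_not_MInf[of u] by (cases "\<psi> u") auto
  with * show ?thesis by simp
qed

text \<open>A rejected stepsize cannot be small. The penalty \<open>\<psi>\<close> falls at most quadratically and the mean
  subgradients are bounded, so small stepsizes keep the trial point within \<open>\<delta>\<close> of the iterate; there
  the upper quadratic bound with constant \<open>B\<close> applies, and \<open>1 / (2 * t)\<close> exceeds \<open>B + \<sigma>\<close>.\<close>

lemma stepsize_bounded_below: "\<exists>c>0. \<forall>k. c \<le> \<gamma> k"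
proof -
  obtain \<gamma>0 c where g: "0 < \<gamma>0" "\<And>u. ereal (c - 1 / (2 * \<gamma>0) * (norm u)\<^sup>2) \<le> \<psi> u" using psi_real_below by blast
  obtain r where r: "\<And>y. y \<in> S \<Longrightarrow> norm y \<le> r" using S_norm_bound by blast
  obtain b where b: "\<And>k. norm (objective k) \<le> b" using convergent_imp_Bseq[OF convergent_objective] unfolding Bseq_def by blast
  define D where "D = \<bar>b + B - c + r\<^sup>2 / \<gamma>0\<bar>"
  define M where "M = max (B + \<sigma>) (1 / \<gamma>0 + (D + 1) / \<delta>\<^sup>2 + B / \<delta>)"
  have D0: "0 \<le> D" unfolding D_def by simp
  have M0: "0 < M" unfolding M_def using B_nonneg \<sigma> by (simp add: less_max_iff_disj)
  \<comment> \<open>The trial points for stepsizes below \<open>1 / (2 * M)\<close> lie within \<open>\<delta>\<close> of the iterate and are accepted.\<close>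
  have small: "accepted k u" if t: "0 < t" and tM: "M < 1 / (2 * t)" and v: "mean_subgradient k v"
    and u: "u \<in> prox t \<psi> (x k - t *\<^sub>R v)" for k t v u
  proof -
    let ?s = "norm (u - x k)"
    obtain pu where pu: "\<psi> u = ereal pu" "pu + v \<bullet> (u - x k) + 1 / (2 * t) * ?s\<^sup>2 \<le> penalty k"
      using prox_at_iterate[OF t u] by blast
    have inner: "- (B * ?s) \<le> v \<bullet> (u - x k)"
    proof -
      have "\<bar>v \<bullet> (u - x k)\<bar> \<le> norm v * ?s" by (rule Cauchy_Schwarz_ineq2)
      also have "\<dots> \<le> B * ?s" by (intro mult_right_mono mean_subgradient_norm_le[OF v]) auto
      finally show ?thesis by linarith
    qed
    have "?s < \<delta>"
    proof (rule ccontr)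
      assume "\<not> ?s < \<delta>"
      then have s: "\<delta> \<le> ?s" by simp
      have "norm u \<le> ?s + r" using norm_triangle_ineq2[of u "x k"] r[OF xS[of k]] by linarith
      then have "(norm u)\<^sup>2 \<le> (?s + r)\<^sup>2" by (intro power_mono) auto
      also have "\<dots> \<le> 2 * ?s\<^sup>2 + 2 * r\<^sup>2" using sum_squares_bound[of ?s r] by (simp add: power2_sum)
      finally have "1 / (2 * \<gamma>0) * (norm u)\<^sup>2 \<le> 1 / (2 * \<gamma>0) * (2 * ?s\<^sup>2 + 2 * r\<^sup>2)"
        using g(1) by (intro mult_left_mono) auto
      also have "\<dots> = 1 / \<gamma>0 * ?s\<^sup>2 + r\<^sup>2 / \<gamma>0" using g(1) by (simp add: field_simps)
      finally have pu_low: "c - 1 / \<gamma>0 * ?s\<^sup>2 - r\<^sup>2 / \<gamma>0 \<le> pu" using g(2)[of u] unfolding pu(1) by simp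
      have "\<bar>objective k\<bar> \<le> b" using b[of k] by simp
      then have "penalty k \<le> b + B" using A_bound[OF S_subset_T[OF xS[of k]], of k] unfolding objective_def by linarith
      then have le_D: "1 / (2 * t) * ?s\<^sup>2 - 1 / \<gamma>0 * ?s\<^sup>2 - B * ?s \<le> D"
        using pu(2) pu_low inner unfolding D_def by linarith
      have "(1 / \<gamma>0 + (D + 1) / \<delta>\<^sup>2 + B / \<delta>) * ?s\<^sup>2 \<le> 1 / (2 * t) * ?s\<^sup>2"
        using tM unfolding M_def by (intro mult_right_mono) auto
      moreover have "(D + 1) / \<delta>\<^sup>2 * \<delta>\<^sup>2 \<le> (D + 1) / \<delta>\<^sup>2 * ?s\<^sup>2"
        using D0 s \<delta> by (intro mult_left_mono power_mono) auto
      moreover have "B / \<delta> * (\<delta> * ?s) \<le> B / \<delta> * (?s * ?s)"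
        using B_nonneg s \<delta> by (intro mult_left_mono mult_right_mono) auto
      moreover have "(D + 1) / \<delta>\<^sup>2 * \<delta>\<^sup>2 = D + 1" "B / \<delta> * (\<delta> * ?s) = B * ?s" using \<delta> by auto
      ultimately have "1 / \<gamma>0 * ?s\<^sup>2 + (D + 1) + B * ?s \<le> 1 / (2 * t) * ?s\<^sup>2"
        unfolding distrib_right power2_eq_square[of ?s] by linarith
      then show False using le_D by linarith
    qed
    then have "A k u \<le> A k (x k) + v \<bullet> (u - x k) + B * ?s\<^sup>2" by (rule mean_subgradient_upper[OF v])
    moreover have "(B + \<sigma>) * ?s\<^sup>2 \<le> 1 / (2 * t) * ?s\<^sup>2"
      using tM unfolding M_def by (intro mult_right_mono) auto
    ultimately have "A k u + pu \<le> objective k - \<sigma> * ?s\<^sup>2" using pu(2) unfolding objective_def distrib_right by linarith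
    then show ?thesis unfolding accepted_def composite_x by (simp add: composite_def pu)
  qed
  have "min \<gamma>min (\<rho> / (2 * M)) \<le> \<gamma> k" for k
  proof (rule ccontr)
    assume neg: "\<not> min \<gamma>min (\<rho> / (2 * M)) \<le> \<gamma> k"
    obtain v u where v: "mean_subgradient k v" and pos: "0 < \<gamma> k"
      and u: "u \<in> prox (\<gamma> k / \<rho>) \<psi> (x k - (\<gamma> k / \<rho>) *\<^sub>R v)" "\<not> accepted k u"
      using iteration_cases[of k] neg by auto
    have t: "0 < \<gamma> k / \<rho>" using pos \<rho> by simp
    have "\<gamma> k < \<rho> / (2 * M)" using neg by simp
    then have "M < 1 / (2 * (\<gamma> k / \<rho>))" using M0 pos \<rho> by (simp add: field_simps)
    then show False using small[OF t _ v u(1)] u(2) by blast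
  qed
  then show ?thesis using \<gamma>min \<rho> M0 by (intro exI[of _ "min \<gamma>min (\<rho> / (2 * M))"]) simp
qed

text \<open>Along a further subsequence the mean subgradients converge to some \<open>vbar\<close>. The upper quadratic bounds
  of the sample averages pass to the limit and make \<open>vbar\<close> a Clarke subgradient of \<open>E\<close>. In the
  proximal inequality the stepsizes may be unbounded, but they are at least \<open>c\<close>, and replacing them by
  \<open>c\<close> on the side of the competitor only weakens it; with lower semicontinuity the limit is a proximal
  step of size \<open>c\<close> that stays at \<open>xbar\<close>. The competitor \<open>xbar\<close> itself shows that \<open>\<psi>\<close> converges along
  the subsequence, which identifies the limit of the objective values.\<close>

lemma stationary_limit:
  assumes r: "strict_mono r" and lim: "(\<lambda>j. x (r j)) \<longlonglongrightarrow> xbar"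
  shows "stationary_point E \<psi> xbar" and "composite E \<psi> xbar = ereal objective_limit"
proof -
  have xbarS: "xbar \<in> S" using closed_sequentially[OF compact_imp_closed[OF compact_S] _ lim] xS by blast
  obtain c where c: "0 < c" "\<And>k. c \<le> \<gamma> k" using stepsize_bounded_below by blast
  have "\<forall>k. \<exists>v. mean_subgradient k v \<and> 0 < \<gamma> k \<and> x (Suc k) \<in> prox (\<gamma> k) \<psi> (x k - \<gamma> k *\<^sub>R v)"
    using iteration_cases by blast
  then obtain v where "\<forall>k. mean_subgradient k (v k) \<and> 0 < \<gamma> k \<and> x (Suc k) \<in> prox (\<gamma> k) \<psi> (x k - \<gamma> k *\<^sub>R v k)"
    by (rule choice[THEN exE])
  then have v: "\<And>k. mean_subgradient k (v k)" "\<And>k. 0 < \<gamma> k"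
    "\<And>k. x (Suc k) \<in> prox (\<gamma> k) \<psi> (x k - \<gamma> k *\<^sub>R v k)" by auto
  have "bounded (range (\<lambda>j. v (r j)))"
    using mean_subgradient_norm_le[OF v(1)] by (intro boundedI[of _ B]) auto
  then obtain vbar r' where r': "strict_mono r'" "((\<lambda>j. v (r j)) \<circ> r') \<longlonglongrightarrow> vbar"
    using bounded_imp_convergent_subsequence by blast
  define s where "s = r \<circ> r'"
  have s: "strict_mono s" unfolding s_def using strict_mono_o[OF r r'(1)] .
  have vs: "(\<lambda>j. v (s j)) \<longlonglongrightarrow> vbar" using r'(2) by (simp add: s_def comp_def)
  have xs: "(\<lambda>j. x (s j)) \<longlonglongrightarrow> xbar"
    using LIMSEQ_subseq_LIMSEQ[OF lim r'(1)] by (simp add: s_def comp_def)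
  have ds: "(\<lambda>j. x (Suc (s j)) - x (s j)) \<longlonglongrightarrow> 0"
    using LIMSEQ_subseq_LIMSEQ[OF steps_tendsto_0 s] by (simp add: comp_def)
  have xs1: "(\<lambda>j. x (Suc (s j))) \<longlonglongrightarrow> xbar" using tendsto_add[OF xs ds] by simp
  have Ax: "(\<lambda>j. A (s j) (x (s j))) \<longlonglongrightarrow> E xbar"
  proof -
    have "(\<lambda>j. E (x (s j))) \<longlonglongrightarrow> E xbar"
      by (rule continuous_on_tendsto_compose[OF E_cont xs]) auto
    from tendsto_add[OF LIMSEQ_subseq_LIMSEQ[OF A_minus_E_tendsto_0 s] this] show ?thesis by (simp add: comp_def)
  qed
  have upper: "E y \<le> E xbar + vbar \<bullet> (y - xbar) + B * (norm (y - xbar))\<^sup>2" if y: "norm (y - xbar) < \<delta>" for y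
  proof (rule LIMSEQ_le)
    have "y \<in> T" using ST[OF xbarS] y by (auto simp: dist_norm norm_minus_commute)
    then have "(\<lambda>k. A k y) \<longlonglongrightarrow> E y" by (rule tendsto_uniform_limitI[OF uniform])
    from LIMSEQ_subseq_LIMSEQ[OF this s] show "(\<lambda>j. A (s j) y) \<longlonglongrightarrow> E y" by (simp add: comp_def)
    show "(\<lambda>j. A (s j) (x (s j)) + v (s j) \<bullet> (y - x (s j)) + B * (norm (y - x (s j)))\<^sup>2)
        \<longlonglongrightarrow> E xbar + vbar \<bullet> (y - xbar) + B * (norm (y - xbar))\<^sup>2"
      by (intro tendsto_intros Ax vs xs)
    have "(\<lambda>j. norm (y - x (s j))) \<longlonglongrightarrow> norm (y - xbar)" by (intro tendsto_intros xs)
    then have "\<forall>\<^sub>F j in sequentially. norm (y - x (s j)) < \<delta>" using y by (rule order_tendstoD(2))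
    then obtain N where "\<forall>j\<ge>N. norm (y - x (s j)) < \<delta>" unfolding eventually_sequentially by blast
    then show "\<exists>N. \<forall>j\<ge>N. A (s j) y \<le> A (s j) (x (s j)) + v (s j) \<bullet> (y - x (s j)) + B * (norm (y - x (s j)))\<^sup>2"
      using mean_subgradient_upper[OF v(1)] by blast
  qed
  have vbar: "vbar \<in> clarke_subdiff E xbar"
    by (rule clarke_subdiffI_quadratic_upper_bound[OF \<delta> upper])
  define q where "q w = vbar \<bullet> (w - xbar) + 1 / (2 * c) * (norm (w - xbar))\<^sup>2" for w
  \<comment> \<open>Every fixed competitor \<open>w\<close> bounds the limit of the values \<open>\<psi>\<close> takes after the steps.\<close>
  have comp: "\<exists>h. h \<longlonglongrightarrow> pw + q w \<and> (\<forall>j. penalty (Suc (s j)) \<le> h j)" if pw: "\<psi> w = ereal pw" for w pw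
  proof (intro exI conjI allI)
    let ?h = "\<lambda>j. pw + (v (s j) \<bullet> (w - x (s j)) + 1 / (2 * c) * (norm (w - x (s j)))\<^sup>2)
       - v (s j) \<bullet> (x (Suc (s j)) - x (s j))"
    have "?h \<longlonglongrightarrow> pw + (vbar \<bullet> (w - xbar) + 1 / (2 * c) * (norm (w - xbar))\<^sup>2) - vbar \<bullet> 0"
      by (intro tendsto_intros vs xs ds)
    then show "?h \<longlonglongrightarrow> pw + q w" unfolding q_def by simp
    fix j
    let ?k = "s j"
    have "penalty (Suc ?k) + (v ?k \<bullet> (x (Suc ?k) - x ?k) + 1 / (2 * \<gamma> ?k) * (norm (x (Suc ?k) - x ?k))\<^sup>2)
        \<le> pw + (v ?k \<bullet> (w - x ?k) + 1 / (2 * \<gamma> ?k) * (norm (w - x ?k))\<^sup>2)"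
      using v(3)[of ?k, unfolded mem_prox_iff[OF v(2)], rule_format, of w] unfolding psi_x pw by simp
    moreover have "0 \<le> 1 / (2 * \<gamma> ?k) * (norm (x (Suc ?k) - x ?k))\<^sup>2" using v(2)[of ?k] by simp
    moreover have "1 / (2 * \<gamma> ?k) * (norm (w - x ?k))\<^sup>2 \<le> 1 / (2 * c) * (norm (w - x ?k))\<^sup>2"
      using c v(2)[of ?k] by (intro mult_right_mono divide_left_mono) auto
    ultimately show "penalty (Suc ?k) \<le> ?h j" by linarith
  qed
  have le: "\<psi> xbar \<le> \<psi> w + ereal (q w)" for w
  proof (cases "\<psi> w")
    case (real pw)
    show ?thesis
    proof (rule ccontr)
      assume "\<not> ?thesis"
      then have "ereal (pw + q w) < \<psi> xbar" using real by simp
      then obtain z where z: "ereal (pw + q w) < z" "z < \<psi> xbar" using dense by blast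
      obtain h where h: "h \<longlonglongrightarrow> pw + q w" "\<And>j. penalty (Suc (s j)) \<le> h j" using comp[OF real] by blast
      have "\<forall>\<^sub>F j in sequentially. z < \<psi> (x (Suc (s j)))"
        by (rule lower_semicont_eventually_less[OF lsc xs1 z(2)])
      moreover have "\<forall>\<^sub>F j in sequentially. ereal (h j) < z"
        using h(1) z(1) by (intro order_tendstoD(2)[where y = "ereal (pw + q w)"]) auto
      ultimately have "\<forall>\<^sub>F j in sequentially. False"
      proof eventually_elim
        case (elim j)
        then have "ereal (h j) < ereal (penalty (Suc (s j)))" unfolding psi_x by (rule less_trans[rotated])
        then show ?case using h(2)[of j] by simp
      qed
      then show False by simp
    qed
  qed (use psi_not_MInf in auto)
  have "xbar \<in> prox c \<psi> (xbar - c *\<^sub>R vbar)"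
    unfolding mem_prox_iff[OF c(1)] using le unfolding q_def by simp
  then show "stationary_point E \<psi> xbar" unfolding stationary_point_def using vbar c(1) by blast
  have "\<psi> xbar < \<infinity>" using le[of "x 0"] unfolding psi_x by (cases "\<psi> xbar") auto
  then obtain px where px: "\<psi> xbar = ereal px" using psi_not_MInf[of xbar] by (cases "\<psi> xbar") auto
  obtain h where h: "h \<longlonglongrightarrow> px + q xbar" "\<And>j. penalty (Suc (s j)) \<le> h j" using comp[OF px] by blast
  have penalty_lim: "(\<lambda>j. penalty (Suc (s j))) \<longlonglongrightarrow> px"
  proof (rule order_tendstoI)
    fix y assume "y < px"
    then have "ereal y < \<psi> xbar" unfolding px by simp
    from lower_semicont_eventually_less[OF lsc xs1 this]
    show "\<forall>\<^sub>F j in sequentially. y < penalty (Suc (s j))" unfolding psi_x by simp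
  next
    fix y assume "px < y"
    then have "\<forall>\<^sub>F j in sequentially. h j < y" using h(1) by (intro order_tendstoD(2)[OF h(1)]) (simp add: q_def)
    then show "\<forall>\<^sub>F j in sequentially. penalty (Suc (s j)) < y"
      by eventually_elim (use h(2) le_less_trans in blast)
  qed
  have s1: "strict_mono (\<lambda>j. Suc (s j))" using s by (simp add: strict_mono_def)
  have "(\<lambda>j. objective (Suc (s j)) - (A (Suc (s j)) (x (Suc (s j))) - E (x (Suc (s j))))) \<longlonglongrightarrow> objective_limit - 0"
    using LIMSEQ_subseq_LIMSEQ[OF objective_tendsto s1] LIMSEQ_subseq_LIMSEQ[OF A_minus_E_tendsto_0 s1]
    by (intro tendsto_diff) (simp_all add: comp_def)
  moreover have "(\<lambda>j. E (x (Suc (s j))) + penalty (Suc (s j))) \<longlonglongrightarrow> E xbar + px"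
    by (intro tendsto_add penalty_lim continuous_on_tendsto_compose[OF E_cont xs1]) auto
  ultimately have "objective_limit = E xbar + px" unfolding objective_def by (simp add: algebra_simps) (metis LIMSEQ_unique)
  then show "composite E \<psi> xbar = ereal objective_limit" unfolding composite_def px by simp
qed

end

section \<open>Almost sure convergence of the algorithm\<close>

theorem theorem3p5:
  fixes \<mu> :: "'x measure"
    and P :: "'w measure"
    and \<phi> :: "'x \<Rightarrow> real ^ 'd \<Rightarrow> real"
    and \<psi> :: "real ^ 'd \<Rightarrow> ereal"
    and \<xi> :: "nat \<Rightarrow> 'w \<Rightarrow> 'x"
    and n :: "nat \<Rightarrow> nat"
    and F :: "nat \<Rightarrow> 'w measure"
    and x :: "nat \<Rightarrow> 'w \<Rightarrow> real ^ 'd"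
    and \<gamma> :: "nat \<Rightarrow> 'w \<Rightarrow> real"
    and x0 :: "real ^ 'd"
    and \<rho> \<sigma> \<gamma>min :: real
  defines "\<Phi> \<equiv> composite (expect_fun \<mu> \<phi>) \<psi>"
    and "\<Phi>k \<equiv> (\<lambda>k \<omega>. composite (sample_avg (n k) (\<lambda>j. \<phi> (\<xi> j \<omega>))) \<psi>)"
  assumes "prob_space \<mu>" and "prob_space P"
    \<comment> \<open>problem data\<close>
    and "proper_fun \<psi>" and "lower_semicont \<psi>" and "prox_bounded \<psi>"
    and "upper_C2_normal_integrand \<mu> \<phi>"
    and "ereal_integrable \<mu> (\<lambda>s. INF y. ereal (\<phi> s y) + \<psi> y)"
    \<comment> \<open>sampling\<close>
    and "prob_space.indep_vars P (\<lambda>_. \<mu>) \<xi> {1..}"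
    and "\<And>i. 1 \<le> i \<Longrightarrow> distr P \<mu> (\<xi> i) = \<mu>"
    and "mono n" and "\<And>k. 0 < n k" and "filterlim n at_top sequentially"
    \<comment> \<open>filtration\<close>
    and "filtration (space P) F" and "\<And>k. subalgebra P (F k)"
    and "\<And>k. x (Suc k) \<in> borel_measurable (F k)"
    and "\<And>k j. 1 \<le> j \<Longrightarrow> j \<le> n k \<Longrightarrow> \<xi> j \<in> measurable (F k) \<mu>"
    and "\<And>k j. n k < j \<Longrightarrow>
           prob_space.indep_set P {\<xi> j -` A \<inter> space P | A. A \<in> sets \<mu>} (sets (F k))"
    \<comment> \<open>algorithm\<close>
    and "0 < \<rho>" and "\<rho> < 1" and "0 < \<sigma>" and "0 < \<gamma>min"
    and "x0 \<in> edom \<Phi>"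
    and "\<And>\<omega>. \<omega> \<in> space P \<Longrightarrow> x 0 \<omega> = x0"
    and "\<And>\<omega> k. \<omega> \<in> space P \<Longrightarrow>
           pss_iteration \<rho> \<sigma> \<gamma>min \<psi> (n k) (\<lambda>i. \<phi> (\<xi> i \<omega>)) (x k \<omega>) (\<gamma> k \<omega>) (x (Suc k) \<omega>)"
  shows "\<exists>\<Omega>' \<in> sets P. measure P (space P - \<Omega>') = 0 \<and>
    (\<forall>\<omega>\<in>\<Omega>'. bounded (range (\<lambda>k. x k \<omega>)) \<longrightarrow>
      (\<exists>L::real.
         (\<lambda>k. \<Phi>k k \<omega> (x k \<omega>)) \<longlonglongrightarrow> ereal L \<and>
         (\<lambda>k. \<Phi> (x k \<omega>)) \<longlonglongrightarrow> ereal L \<and>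
         summable (\<lambda>k. (norm (x (Suc k) \<omega> - x k \<omega>))\<^sup>2) \<and>
         (INF k. \<gamma> k \<omega>) > 0 \<and>
         (\<forall>r xbar. strict_mono r \<longrightarrow> (\<lambda>j. x (r j) \<omega>) \<longlonglongrightarrow> xbar \<longrightarrow>
            stationary_point (expect_fun \<mu> \<phi>) \<psi> xbar \<and> \<Phi> xbar = ereal L) \<and>
         accumulation_points (\<lambda>k. x k \<omega>) \<noteq> {} \<and>
         closed (accumulation_points (\<lambda>k. x k \<omega>)) \<and>
         connected (accumulation_points (\<lambda>k. x k \<omega>)) \<and>
         (\<forall>xbar. xbar isolated_in accumulation_points (\<lambda>k. x k \<omega>) \<longrightarrow>
            (\<lambda>k. x k \<omega>) \<longlonglongrightarrow> xbar \<and>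
            stationary_point (expect_fun \<mu> \<phi>) \<psi> xbar)))"
proof -
  note prob_mu = assms(3) and prob_P = assms(4) and upper = assms(8)
  interpret P: prob_space P by (rule prob_P)
  have C2: "\<And>p. upper_C2_around \<mu> \<phi> p" using upper unfolding upper_C2_normal_integrand_def by blast
  interpret adapted_sampling P \<mu> \<xi> \<phi> n F "\<lambda>k. x (Suc k)"
  proof (intro adapted_sampling.intro iid_integrand.intro iid_integrand_axioms.intro adapted_sampling_axioms.intro)
    show "loc_Lipschitz_sq_int \<mu> \<phi> p" for p using C2[of p] unfolding upper_C2_around_def by blast
  qed (fact assms)+
  have "\<forall>R. \<exists>l \<delta>. 0 < \<delta> \<and> integrable \<mu> l \<and>
    (\<forall>s\<in>space \<mu>. \<forall>y\<in>cube R. \<forall>v\<in>clarke_subdiff (\<phi> s) y. \<forall>z. norm (z - y) < \<delta> \<longrightarrow>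
       \<phi> s z \<le> \<phi> s y + v \<bullet> (z - y) + l s * (norm (z - y))\<^sup>2)"
    using compact_upper_C2_modulus[OF compact_cube C2] by blast
  then obtain l \<delta> where \<delta>: "\<And>R. 0 < \<delta> R" and l_int: "\<And>R. integrable \<mu> (l R)"
    and l_upper: "\<And>R s y v z. s \<in> space \<mu> \<Longrightarrow> y \<in> cube R \<Longrightarrow> v \<in> clarke_subdiff (\<phi> s) y \<Longrightarrow>
       norm (z - y) < \<delta> R \<Longrightarrow> \<phi> s z \<le> \<phi> s y + v \<bullet> (z - y) + l R s * (norm (z - y))\<^sup>2"
    by metis
\<comment> \<open>The four almost sure properties. Each is required for all cubes, since the cube that contains the
  trajectory depends on the outcome.\<close>
  define good where "good \<omega> \<longleftrightarrow>
      (\<forall>R. summable (\<lambda>k. indicator (cube R) (x (Suc k) \<omega>) * (avg (Suc k) \<omega> (x (Suc k) \<omega>) - avg k \<omega> (x (Suc k) \<omega>)))) \<and>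
      (\<forall>R. uniform_limit (cube R) (\<lambda>m. sample_avg m (\<lambda>j. \<phi> (\<xi> j \<omega>))) E sequentially) \<and>
      (\<forall>R. \<exists>B. \<forall>m. (\<Sum>j=1..m. modulus R (\<xi> j \<omega>)) / real m \<le> B) \<and>
      (\<forall>R. \<exists>B. \<forall>m. (\<Sum>j=1..m. l R (\<xi> j \<omega>)) / real m \<le> B)" for \<omega>
  have "AE \<omega> in P. \<forall>R. \<exists>B. \<forall>m. (\<Sum>j=1..m. modulus R (\<xi> j \<omega>)) / real m \<le> B"
    unfolding AE_all_countable by (intro allI sample_means_bounded integrable_modulus)
  moreover have "AE \<omega> in P. \<forall>R. \<exists>B. \<forall>m. (\<Sum>j=1..m. l R (\<xi> j \<omega>)) / real m \<le> B"
    unfolding AE_all_countable by (intro allI sample_means_bounded l_int)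
  ultimately have "AE \<omega> in P. good \<omega>"
    using resampling_errors_summable uniform_law_of_large_numbers
    unfolding good_def by eventually_elim (intro conjI)
  then obtain N where N: "{\<omega> \<in> space P. \<not> good \<omega>} \<subseteq> N" "emeasure P N = 0" "N \<in> sets P"
    by (rule AE_E)
  define \<Omega>' where "\<Omega>' = space P - N"
  have \<Omega>'_sets: "\<Omega>' \<in> sets P" unfolding \<Omega>'_def using N(3) by auto
  have "space P - \<Omega>' = N" unfolding \<Omega>'_def using sets.sets_into_space[OF N(3)] by auto
  then have null: "measure P (space P - \<Omega>') = 0" using N(2) by (simp add: measure_def)
  show ?thesis
  proof (intro bexI[OF _ \<Omega>'_sets] conjI null ballI impI, goal_cases)
    case (1 \<omega>)
    then have w: "\<omega> \<in> \<Omega>'" and bdd: "bounded (range (\<lambda>k. x k \<omega>))" .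
    have sp: "\<omega> \<in> space P" and g: "good \<omega>" using w N(1) unfolding \<Omega>'_def by auto
    have xi_sp: "\<xi> j \<omega> \<in> space \<mu>" if "1 \<le> j" for j
      using measurable_space[OF xi_measurable[OF that] sp] .
    obtain r where r: "\<And>k. norm (x k \<omega>) \<le> r" using bdd unfolding bounded_iff by auto
    define R where "R = nat \<lceil>r\<rceil>"
    have xR: "x k \<omega> \<in> cube R" for k
      by (rule mem_cubeI) (use r[of k] in \<open>unfold R_def, linarith\<close>)
    obtain BK where BK: "\<And>m. (\<Sum>j=1..m. modulus (Suc R) (\<xi> j \<omega>)) / real m \<le> BK"
      using g unfolding good_def by blast
    obtain Bl where Bl: "\<And>m. (\<Sum>j=1..m. l R (\<xi> j \<omega>)) / real m \<le> Bl"
      using g unfolding good_def by blast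
    interpret T: pss_trajectory \<rho> \<sigma> \<gamma>min \<psi> n "\<lambda>j. \<phi> (\<xi> j \<omega>)" E "\<lambda>k. x k \<omega>" "\<lambda>k. \<gamma> k \<omega>"
      "cube R" "cube (Suc R)" "min 1 (\<delta> R)" "\<lambda>j. modulus (Suc R) (\<xi> j \<omega>)" "\<lambda>j. l R (\<xi> j \<omega>)" "max BK Bl"
    proof
      show "pss_iteration \<rho> \<sigma> \<gamma>min \<psi> (n k) (\<lambda>j. \<phi> (\<xi> j \<omega>)) (x k \<omega>) (\<gamma> k \<omega>) (x (Suc k) \<omega>)" for k
        by (rule assms(26)[OF sp])
      have "\<Phi> x0 < \<infinity>" using assms(24) unfolding edom_def by simp
      then show "\<psi> (x 0 \<omega>) < \<infinity>"
        unfolding \<Phi>_def composite_def assms(25)[OF sp] by (cases "\<psi> x0") auto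
      show "compact (cube R :: (real ^ 'd) set)" by (rule compact_cube)
      show "0 < min 1 (\<delta> R)" using \<delta> by simp
      show "ball y (min 1 (\<delta> R)) \<subseteq> cube (Suc R)" if "y \<in> cube R" for y :: "real ^ 'd"
      proof
        fix z assume "z \<in> ball y (min 1 (\<delta> R))"
        then have "norm (z - y) \<le> 1" by (simp add: dist_norm norm_minus_commute)
        then show "z \<in> cube (Suc R)" by (rule mem_cube_Suc[OF that])
      qed
      show "\<bar>\<phi> (\<xi> j \<omega>) y\<bar> \<le> modulus (Suc R) (\<xi> j \<omega>)" if "1 \<le> j" "y \<in> cube (Suc R)" for j y
        by (rule abs_le_modulus[OF xi_sp[OF that(1)] that(2)])
      show "\<bar>\<phi> (\<xi> j \<omega>) y - \<phi> (\<xi> j \<omega>) z\<bar> \<le> modulus (Suc R) (\<xi> j \<omega>) * norm (y - z)"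
        if "1 \<le> j" "y \<in> cube (Suc R)" "z \<in> cube (Suc R)" for j y z
        by (rule modulus_Lipschitz[OF xi_sp[OF that(1)] that(2,3)])
      show "\<phi> (\<xi> j \<omega>) z \<le> \<phi> (\<xi> j \<omega>) y + v \<bullet> (z - y) + l R (\<xi> j \<omega>) * (norm (z - y))\<^sup>2"
        if "1 \<le> j" "y \<in> cube R" "v \<in> clarke_subdiff (\<phi> (\<xi> j \<omega>)) y" "norm (z - y) < min 1 (\<delta> R)" for j y z v
        by (rule l_upper[OF xi_sp[OF that(1)] that(2,3)]) (use that(4) in simp)
      show "(\<Sum>j = 1..n k. modulus (Suc R) (\<xi> j \<omega>)) / real (n k) \<le> max BK Bl" for k
        using BK[of "n k"] by linarith
      show "(\<Sum>j = 1..n k. l R (\<xi> j \<omega>)) / real (n k) \<le> max BK Bl" for k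
        using Bl[of "n k"] by linarith
      have "uniform_limit (cube (Suc R)) (\<lambda>m. sample_avg m (\<lambda>j. \<phi> (\<xi> j \<omega>))) E sequentially"
        using g unfolding good_def by blast
      then show "uniform_limit (cube (Suc R)) (\<lambda>k. avg k \<omega>) E sequentially"
        unfolding uniform_limit_iff using assms(14) eventually_compose_filterlim by blast
      show "continuous_on UNIV E" by (rule continuous_E)
      have "summable (\<lambda>k. indicator (cube R) (x (Suc k) \<omega>) * (avg (Suc k) \<omega> (x (Suc k) \<omega>) - avg k \<omega> (x (Suc k) \<omega>)))"
        using g unfolding good_def by blast
      then show "summable (\<lambda>k. avg (Suc k) \<omega> (x (Suc k) \<omega>) - avg k \<omega> (x (Suc k) \<omega>))"
        using xR by simp
    qed (use assms xR in auto)
    let ?X = "\<lambda>k. x k \<omega>"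
    obtain c where c: "0 < c" "\<And>k. c \<le> \<gamma> k \<omega>" using T.stepsize_bounded_below by blast
    have "c \<le> (INF k. \<gamma> k \<omega>)" using c(2) by (intro cINF_greatest) auto
    then have inf_pos: "(INF k. \<gamma> k \<omega>) > 0" using c(1) by linarith
    have "(\<lambda>k. dist (x (Suc k) \<omega>) (x k \<omega>)) \<longlonglongrightarrow> 0"
      using tendsto_norm[OF T.steps_tendsto_0] by (simp add: dist_norm)
    then have conn: "connected (accumulation_points ?X)"
      by (rule connected_accumulation_points[OF bdd])
    have stat: "stationary_point E \<psi> xbar \<and> \<Phi> xbar = ereal T.objective_limit"
      if "strict_mono r" "(\<lambda>j. x (r j) \<omega>) \<longlonglongrightarrow> xbar" for r xbar
      using T.stationary_limit[OF that] unfolding \<Phi>_def by simp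
    have iso: "?X \<longlonglongrightarrow> xbar \<and> stationary_point E \<psi> xbar" if "xbar isolated_in accumulation_points ?X" for xbar
    proof -
      have "?X \<longlonglongrightarrow> xbar" by (rule tendsto_isolated_accumulation_point[OF bdd conn that])
      then show ?thesis using stat[OF strict_mono_id] by simp
    qed
    show ?case
    proof (intro exI[of _ T.objective_limit] conjI allI impI)
      show "(\<lambda>k. \<Phi>k k \<omega> (x k \<omega>)) \<longlonglongrightarrow> ereal T.objective_limit" "(\<lambda>k. \<Phi> (x k \<omega>)) \<longlonglongrightarrow> ereal T.objective_limit"
        using T.composite_tendsto unfolding \<Phi>k_def \<Phi>_def by auto
    qed (use T.summable_steps inf_pos stat accumulation_points_nonempty[OF bdd] closed_accumulation_points
        conn iso in auto)
  qed
qed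

end
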